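(* Let $(M,\omega)$ be a four-dimensional symplectic manifold, let $\rho_1,\rho_2\colon M\to M$ be two distinct commuting antisymplectic involutions, and let $H\colon M\to\mathbb{R}$ be a smooth function with $H\circ\rho_1=H$ and $H\circ\rho_2=H$. Let $v$ be a doubly symmetric periodic orbit of the Hamiltonian vector field $X_H$ (with respect to $\rho_1,\rho_2$). Then $v$ is not negative hyperbolic.
   Context: Conventions. A diffeomorphism $\rho$ of $M$ is an antisymplectic involution if $\rho^2=\mathrm{id}$ and $\rho^*\omega=-\omega$. The Hamiltonian vector field $X_H$ is defined by $dH=\omega(\cdot,X_H)$, and $\phi^t_H$ denotes its flow. Put $S^1=\mathbb{R}/\mathbb{Z}$. A simple periodic orbit is an injective map $v\colon S^1\to M$ for which there is $\tau>0$ (its period) with $\partial_t v(t)=\tau X_H(v(t))$ for all $t\in S^1$. Doubly symmetric orbits. A simple periodic orbit $v$ is symmetric with respect to $\rho_1$ if $\rho_1(v(-t))=v(t)$ for all $t\in S^1$. It is doubly symmetric (with respect to $\rho_1,\rho_2$) if it is symmetric with respect to $\rho_1$ and in addition $\rho_2(v(0))=v(\tfrac12)$. Reduced monodromy. Let $c=H(v(0))$ be the energy of $v$ and $\Sigma=H^{-1}(c)$, which is a hypersurface near $v$. The linear map $d\phi^\tau_H(v(0))$ preserves $T_{v(0)}\Sigma$ and fixes $X_H(v(0))$. The induced map $M_v$ on the two-dimensional symplectic vector space $T_{v(0)}\Sigma/\langle X_H(v(0))\rangle$ is the reduced monodromy; $\det M_v=1$. The orbit $v$ is positive hyperbolic if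 $\mathrm{tr}(M_v)>2$, negative hyperbolic if $\mathrm{tr}(M_v)<-2$, and elliptic if $-2\le\mathrm{tr}(M_v)\le 2$. *)

theory Defs
  imports "HOL-Analysis.Analysis" "HOL-Library.Function_Algebras"
begin

instantiation "fun" :: (type, real_vector) real_vector
begin
definition scaleR_fun_def: "scaleR a f = (\<lambda>x. a *\<^sub>R f x)"
instance
  by standard (auto simp: scaleR_fun_def fun_eq_iff scaleR_add_right scaleR_add_left)
end

text \<open>For open \<open>S\<close> in a Euclidean space, \<open>Ck_on k S f\<close> says that \<open>f\<close> is of class
  \<open>C\<close>-\<open>k\<close> on \<open>S\<close>: it is differentiable and each directional derivative along a constant vector
  is of class \<open>C\<close>-\<open>(k - 1)\<close>.\<close>

primrec Ck_on :: "nat \<Rightarrow> 'e::euclidean_space set \<Rightarrow> ('e \<Rightarrow> 'f::real_normed_vector) \<Rightarrow> bool" where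
  "Ck_on 0 S f \<longleftrightarrow> continuous_on S f"
| "Ck_on (Suc k) S f \<longleftrightarrow>
     f differentiable_on S \<and> (\<forall>u. Ck_on k S (\<lambda>x. frechet_derivative f (at x) u))"

definition smooth_on :: "'e::euclidean_space set \<Rightarrow> ('e \<Rightarrow> 'f::real_normed_vector) \<Rightarrow> bool" where
  "smooth_on S f \<longleftrightarrow> (\<forall>k. Ck_on k S f)"


section \<open>Smooth manifolds\<close>

text \<open>The manifold is the whole type \<open>'a\<close> with its class topology; its smooth structure is given
  by an atlas, and its dimension is that of the model space \<open>'e\<close>. A chart is a pair of a domain and
  a coordinate map; the values of the coordinate map outside the domain are irrelevant.\<close>

type_synonym ('a, 'e) chart = "'a set \<times> ('a \<Rightarrow> 'e)"

abbreviation chart_dom :: "('a, 'e) chart \<Rightarrow> 'a set" where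
  "chart_dom \<kappa> \<equiv> fst \<kappa>"

abbreviation coords :: "('a, 'e) chart \<Rightarrow> 'a \<Rightarrow> 'e" where
  "coords \<kappa> \<equiv> snd \<kappa>"

abbreviation chart_inv :: "('a, 'e) chart \<Rightarrow> 'e \<Rightarrow> 'a" where
  "chart_inv \<kappa> \<equiv> inv_into (chart_dom \<kappa>) (coords \<kappa>)"

definition is_chart :: "('a::topological_space, 'e::euclidean_space) chart \<Rightarrow> bool" where
  "is_chart \<kappa> \<longleftrightarrow> open (chart_dom \<kappa>) \<and> open (coords \<kappa> ` chart_dom \<kappa>) \<and>
     homeomorphism (chart_dom \<kappa>) (coords \<kappa> ` chart_dom \<kappa>) (coords \<kappa>) (chart_inv \<kappa>)"

definition smooth_atlas :: "('a::topological_space, 'e::euclidean_space) chart set \<Rightarrow> bool" where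
  "smooth_atlas A \<longleftrightarrow>
     (\<forall>\<kappa>\<in>A. is_chart \<kappa>) \<and> (\<Union>\<kappa>\<in>A. chart_dom \<kappa>) = UNIV \<and>
     (\<forall>\<kappa>\<in>A. \<forall>\<kappa>'\<in>A.
        smooth_on (coords \<kappa> ` (chart_dom \<kappa> \<inter> chart_dom \<kappa>')) (coords \<kappa>' \<circ> chart_inv \<kappa>))"

definition chart_at :: "('a, 'e) chart set \<Rightarrow> 'a \<Rightarrow> ('a, 'e) chart" where
  "chart_at A p = (SOME \<kappa>. \<kappa> \<in> A \<and> p \<in> chart_dom \<kappa>)"

definition smooth_function ::
    "('a::topological_space, 'e::euclidean_space) chart set \<Rightarrow> ('a \<Rightarrow> real) \<Rightarrow> bool" where
  "smooth_function A f \<longleftrightarrow> (\<forall>\<kappa>\<in>A. smooth_on (coords \<kappa> ` chart_dom \<kappa>) (f \<circ> chart_inv \<kappa>))"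

definition smooth_self_map ::
    "('a::topological_space, 'e::euclidean_space) chart set \<Rightarrow> ('a \<Rightarrow> 'a) \<Rightarrow> bool" where
  "smooth_self_map A f \<longleftrightarrow> continuous_on UNIV f \<and>
     (\<forall>\<kappa>\<in>A. \<forall>\<kappa>'\<in>A.
        smooth_on (coords \<kappa> ` (chart_dom \<kappa> \<inter> f -` chart_dom \<kappa>')) (coords \<kappa>' \<circ> f \<circ> chart_inv \<kappa>))"

definition diffeomorphism ::
    "('a::topological_space, 'e::euclidean_space) chart set \<Rightarrow> ('a \<Rightarrow> 'a) \<Rightarrow> bool" where
  "diffeomorphism A f \<longleftrightarrow> bij f \<and> smooth_self_map A f \<and> smooth_self_map A (inv f)"


section \<open>Tangent vectors\<close>

text \<open>A tangent vector at \<open>p\<close> is a family of coordinate vectors, one for each chart around \<open>p\<close>,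
  related by the derivatives of the transition maps; it is extended by \<open>0\<close> to the other charts so
  that tangent vectors are determined by their coordinates. The vector space operations are the
  pointwise ones.\<close>

type_synonym ('a, 'e) tvec = "('a, 'e) chart \<Rightarrow> 'e"

definition tangent_space ::
    "('a, 'e::euclidean_space) chart set \<Rightarrow> 'a \<Rightarrow> ('a, 'e) tvec set" where
  "tangent_space A p = {X.
     (\<forall>\<kappa>. \<not> (\<kappa> \<in> A \<and> p \<in> chart_dom \<kappa>) \<longrightarrow> X \<kappa> = 0) \<and>
     (\<forall>\<kappa>\<in>A. \<forall>\<kappa>'\<in>A. p \<in> chart_dom \<kappa> \<longrightarrow> p \<in> chart_dom \<kappa>' \<longrightarrow>
        X \<kappa>' = frechet_derivative (coords \<kappa>' \<circ> chart_inv \<kappa>) (at (coords \<kappa> p)) (X \<kappa>))}"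

text \<open>The tangent vector at \<open>p\<close> whose coordinate vector in the chart \<open>\<kappa>\<close> is \<open>u\<close>.\<close>

definition tangent_of ::
    "('a, 'e::euclidean_space) chart set \<Rightarrow> ('a, 'e) chart \<Rightarrow> 'a \<Rightarrow> 'e \<Rightarrow> ('a, 'e) tvec" where
  "tangent_of A \<kappa> p u = (\<lambda>\<kappa>'. if \<kappa>' \<in> A \<and> p \<in> chart_dom \<kappa>'
     then frechet_derivative (coords \<kappa>' \<circ> chart_inv \<kappa>) (at (coords \<kappa> p)) u else 0)"

text \<open>The differentials of a self-map and of a real function. By the chain rule they do not
  depend on the chart chosen at \<open>p\<close>. They only use the values of the map near \<open>p\<close>.\<close>

definition diff_map ::
    "('a, 'e::euclidean_space) chart set \<Rightarrow> ('a \<Rightarrow> 'a) \<Rightarrow> 'a \<Rightarrow> ('a, 'e) tvec \<Rightarrow> ('a, 'e) tvec" where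
  "diff_map A f p X = (\<lambda>\<kappa>'. if \<kappa>' \<in> A \<and> f p \<in> chart_dom \<kappa>'
     then frechet_derivative (coords \<kappa>' \<circ> f \<circ> chart_inv (chart_at A p))
            (at (coords (chart_at A p) p)) (X (chart_at A p))
     else 0)"

definition diff_fun ::
    "('a, 'e::euclidean_space) chart set \<Rightarrow> ('a \<Rightarrow> real) \<Rightarrow> 'a \<Rightarrow> ('a, 'e) tvec \<Rightarrow> real" where
  "diff_fun A f p X =
     frechet_derivative (f \<circ> chart_inv (chart_at A p)) (at (coords (chart_at A p) p)) (X (chart_at A p))"

definition has_velocity ::
    "('a::topological_space, 'e::euclidean_space) chart set \<Rightarrow> (real \<Rightarrow> 'a) \<Rightarrow> real \<Rightarrow> ('a, 'e) tvec \<Rightarrow> bool"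
  where
  "has_velocity A \<gamma> t X \<longleftrightarrow> isCont \<gamma> t \<and> X \<in> tangent_space A (\<gamma> t) \<and>
     (\<forall>\<kappa>\<in>A. \<gamma> t \<in> chart_dom \<kappa> \<longrightarrow> ((coords \<kappa> \<circ> \<gamma>) has_vector_derivative X \<kappa>) (at t))"

text \<open>The tangent space at \<open>p\<close> of a submanifold \<open>S\<close>: the velocities of curves in \<open>S\<close> through \<open>p\<close>.\<close>

definition tangent_space_sub ::
    "('a::topological_space, 'e::euclidean_space) chart set \<Rightarrow> 'a set \<Rightarrow> 'a \<Rightarrow> ('a, 'e) tvec set" where
  "tangent_space_sub A S p = {X. \<exists>\<gamma>. (\<forall>t. \<gamma> t \<in> S) \<and> \<gamma> 0 = p \<and> has_velocity A \<gamma> 0 X}"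


section \<open>Symplectic forms and Hamiltonian flows\<close>

definition form_in_chart ::
    "('a, 'e::euclidean_space) chart set \<Rightarrow> ('a \<Rightarrow> ('a, 'e) tvec \<Rightarrow> ('a, 'e) tvec \<Rightarrow> real)
       \<Rightarrow> ('a, 'e) chart \<Rightarrow> 'e \<Rightarrow> 'e \<Rightarrow> 'e \<Rightarrow> real" where
  "form_in_chart A \<omega> \<kappa> x u w =
     \<omega> (chart_inv \<kappa> x) (tangent_of A \<kappa> (chart_inv \<kappa> x) u) (tangent_of A \<kappa> (chart_inv \<kappa> x) w)"

definition two_form ::
    "('a, 'e::euclidean_space) chart set \<Rightarrow> ('a \<Rightarrow> ('a, 'e) tvec \<Rightarrow> ('a, 'e) tvec \<Rightarrow> real) \<Rightarrow> bool" where
  "two_form A \<omega> \<longleftrightarrow>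
     (\<forall>p. \<forall>X\<in>tangent_space A p. \<forall>Y\<in>tangent_space A p. \<forall>Z\<in>tangent_space A p. \<forall>a b.
        \<omega> p (a *\<^sub>R X + b *\<^sub>R Y) Z = a * \<omega> p X Z + b * \<omega> p Y Z) \<and>
     (\<forall>p. \<forall>X\<in>tangent_space A p. \<forall>Y\<in>tangent_space A p. \<omega> p Y X = - \<omega> p X Y) \<and>
     (\<forall>\<kappa>\<in>A. \<forall>u w. smooth_on (coords \<kappa> ` chart_dom \<kappa>) (\<lambda>x. form_in_chart A \<omega> \<kappa> x u w))"

text \<open>The exterior derivative in a chart, evaluated on constant vector fields (whose brackets
  vanish).\<close>

definition closed_form ::
    "('a, 'e::euclidean_space) chart set \<Rightarrow> ('a \<Rightarrow> ('a, 'e) tvec \<Rightarrow> ('a, 'e) tvec \<Rightarrow> real) \<Rightarrow> bool" where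
  "closed_form A \<omega> \<longleftrightarrow> (\<forall>\<kappa>\<in>A. \<forall>x\<in>coords \<kappa> ` chart_dom \<kappa>. \<forall>u v w.
     frechet_derivative (\<lambda>x. form_in_chart A \<omega> \<kappa> x v w) (at x) u +
     frechet_derivative (\<lambda>x. form_in_chart A \<omega> \<kappa> x w u) (at x) v +
     frechet_derivative (\<lambda>x. form_in_chart A \<omega> \<kappa> x u v) (at x) w = 0)"

definition symplectic_form ::
    "('a, 'e::euclidean_space) chart set \<Rightarrow> ('a \<Rightarrow> ('a, 'e) tvec \<Rightarrow> ('a, 'e) tvec \<Rightarrow> real) \<Rightarrow> bool" where
  "symplectic_form A \<omega> \<longleftrightarrow> two_form A \<omega> \<and> closed_form A \<omega> \<and>
     (\<forall>p. \<forall>X\<in>tangent_space A p. (\<forall>Y\<in>tangent_space A p. \<omega> p X Y = 0) \<longrightarrow> X = 0)"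

definition symplectic_manifold ::
    "('a::{t2_space, second_countable_topology}, 'e::euclidean_space) chart set
       \<Rightarrow> ('a \<Rightarrow> ('a, 'e) tvec \<Rightarrow> ('a, 'e) tvec \<Rightarrow> real) \<Rightarrow> bool" where
  "symplectic_manifold A \<omega> \<longleftrightarrow> smooth_atlas A \<and> symplectic_form A \<omega>"

definition antisymplectic_involution ::
    "('a::topological_space, 'e::euclidean_space) chart set
       \<Rightarrow> ('a \<Rightarrow> ('a, 'e) tvec \<Rightarrow> ('a, 'e) tvec \<Rightarrow> real) \<Rightarrow> ('a \<Rightarrow> 'a) \<Rightarrow> bool" where
  "antisymplectic_involution A \<omega> \<rho> \<longleftrightarrow> diffeomorphism A \<rho> \<and> \<rho> \<circ> \<rho> = id \<and>
     (\<forall>p. \<forall>X\<in>tangent_space A p. \<forall>Y\<in>tangent_space A p.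
        \<omega> (\<rho> p) (diff_map A \<rho> p X) (diff_map A \<rho> p Y) = - \<omega> p X Y)"

definition ham_field ::
    "('a, 'e::euclidean_space) chart set \<Rightarrow> ('a \<Rightarrow> ('a, 'e) tvec \<Rightarrow> ('a, 'e) tvec \<Rightarrow> real)
       \<Rightarrow> ('a \<Rightarrow> real) \<Rightarrow> 'a \<Rightarrow> ('a, 'e) tvec" where
  "ham_field A \<omega> H p =
     (THE X. X \<in> tangent_space A p \<and> (\<forall>Y\<in>tangent_space A p. diff_fun A H p Y = \<omega> p Y X))"

text \<open>The local flow of a vector field: \<open>flow A X t p\<close> is the value at time \<open>t\<close> of an integral
  curve that starts at \<open>p\<close> and is defined on an open interval containing \<open>0\<close> and \<open>t\<close>. It is
  unspecified at points from which no such curve exists.\<close>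

definition flow ::
    "('a::topological_space, 'e::euclidean_space) chart set \<Rightarrow> ('a \<Rightarrow> ('a, 'e) tvec)
       \<Rightarrow> real \<Rightarrow> 'a \<Rightarrow> 'a" where
  "flow A X t p = (THE q. \<exists>\<gamma> I. open I \<and> is_interval I \<and> 0 \<in> I \<and> t \<in> I \<and> \<gamma> 0 = p \<and>
     (\<forall>s\<in>I. has_velocity A \<gamma> s (X (\<gamma> s))) \<and> \<gamma> t = q)"


section \<open>Periodic orbits\<close>

definition is_period ::
    "('a::topological_space, 'e::euclidean_space) chart set \<Rightarrow> ('a \<Rightarrow> ('a, 'e) tvec)
       \<Rightarrow> (real \<Rightarrow> 'a) \<Rightarrow> real \<Rightarrow> bool" where
  "is_period A X v \<tau> \<longleftrightarrow> \<tau> > 0 \<and> (\<forall>t. has_velocity A v t (\<tau> *\<^sub>R X (v t)))"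

text \<open>A map on the circle \<open>\<real>/\<int>\<close> is represented by its lift to \<open>\<real>\<close>; the equivalence below says that
  \<open>v\<close> is 1-periodic and that the map it induces on \<open>\<real>/\<int>\<close> is injective.\<close>

definition simple_periodic_orbit ::
    "('a::topological_space, 'e::euclidean_space) chart set \<Rightarrow> ('a \<Rightarrow> ('a, 'e) tvec)
       \<Rightarrow> (real \<Rightarrow> 'a) \<Rightarrow> bool" where
  "simple_periodic_orbit A X v \<longleftrightarrow>
     (\<forall>s t. v s = v t \<longleftrightarrow> s - t \<in> \<int>) \<and> (\<exists>\<tau>. is_period A X v \<tau>)"

definition orbit_period ::
    "('a::topological_space, 'e::euclidean_space) chart set \<Rightarrow> ('a \<Rightarrow> ('a, 'e) tvec)
       \<Rightarrow> (real \<Rightarrow> 'a) \<Rightarrow> real" where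
  "orbit_period A X v = (THE \<tau>. is_period A X v \<tau>)"

definition symmetric_orbit :: "('a \<Rightarrow> 'a) \<Rightarrow> (real \<Rightarrow> 'a) \<Rightarrow> bool" where
  "symmetric_orbit \<rho> v \<longleftrightarrow> (\<forall>t. \<rho> (v (- t)) = v t)"

definition doubly_symmetric_orbit :: "('a \<Rightarrow> 'a) \<Rightarrow> ('a \<Rightarrow> 'a) \<Rightarrow> (real \<Rightarrow> 'a) \<Rightarrow> bool" where
  "doubly_symmetric_orbit \<rho>1 \<rho>2 v \<longleftrightarrow> symmetric_orbit \<rho>1 v \<and> \<rho>2 (v 0) = v (1 / 2)"


section \<open>Reduced monodromy\<close>

text \<open>The quotient of a subspace \<open>V\<close> by a subspace \<open>N\<close> is the set of cosets of \<open>N\<close> in \<open>V\<close>, and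
  \<open>coset_comb N a C b D\<close> is the linear combination \<open>a C + b D\<close> in this quotient. Adding \<open>N\<close> ensures
  that the result is a full coset also if \<open>a\<close> or \<open>b\<close> is zero.\<close>

definition quotient_space :: "'v::real_vector set \<Rightarrow> 'v set \<Rightarrow> 'v set set" where
  "quotient_space V N = (\<lambda>x. (+) x ` N) ` V"

definition coset_comb ::
    "'v::real_vector set \<Rightarrow> real \<Rightarrow> 'v set \<Rightarrow> real \<Rightarrow> 'v set \<Rightarrow> 'v set" where
  "coset_comb N a C b D = {a *\<^sub>R x + b *\<^sub>R y + n | x y n. x \<in> C \<and> y \<in> D \<and> n \<in> N}"

definition quotient_basis :: "'v::real_vector set \<Rightarrow> 'v set \<Rightarrow> 'v set \<Rightarrow> 'v set \<Rightarrow> bool" where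
  "quotient_basis V N E F \<longleftrightarrow> E \<in> quotient_space V N \<and> F \<in> quotient_space V N \<and>
     (\<forall>C\<in>quotient_space V N. \<exists>!c. C = coset_comb N (fst c) E (snd c) F)"

text \<open>The trace of an endomorphism \<open>T\<close> of a two-dimensional quotient: the trace of its matrix with
  respect to any basis \<open>E, F\<close>.\<close>

definition quotient_trace :: "'v::real_vector set \<Rightarrow> 'v set \<Rightarrow> ('v set \<Rightarrow> 'v set) \<Rightarrow> real" where
  "quotient_trace V N T = (THE s. \<exists>E F a b c d. quotient_basis V N E F \<and>
     T E = coset_comb N a E c F \<and> T F = coset_comb N b E d F \<and> s = a + d)"

text \<open>The differential of the time-\<open>\<tau>\<close> flow maps cosets of the line spanned by the vector field to
  such cosets, so the map induced on the quotient is the image map.\<close>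

definition reduced_monodromy ::
    "('a::topological_space, 'e::euclidean_space) chart set \<Rightarrow> ('a \<Rightarrow> ('a, 'e) tvec)
       \<Rightarrow> (real \<Rightarrow> 'a) \<Rightarrow> ('a, 'e) tvec set \<Rightarrow> ('a, 'e) tvec set" where
  "reduced_monodromy A X v C = diff_map A (flow A X (orbit_period A X v)) (v 0) ` C"

definition negative_hyperbolic ::
    "('a::topological_space, 'e::euclidean_space) chart set
       \<Rightarrow> ('a \<Rightarrow> ('a, 'e) tvec \<Rightarrow> ('a, 'e) tvec \<Rightarrow> real) \<Rightarrow> ('a \<Rightarrow> real) \<Rightarrow> (real \<Rightarrow> 'a) \<Rightarrow> bool" where
  "negative_hyperbolic A \<omega> H v \<longleftrightarrow>
     quotient_trace (tangent_space_sub A (H -` {H (v 0)}) (v 0)) (span {ham_field A \<omega> H (v 0)})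
       (reduced_monodromy A (ham_field A \<omega> H) v) < - 2"

end

theory Submission
  imports Defs
begin

text \<open>Write \<open>\<phi>\<close> for the Hamiltonian flow, \<open>\<tau>\<close> for the period and \<open>p = v 0\<close>. An antisymplectic symmetry of
  \<open>H\<close> reverses the flow. Hence \<open>\<rho>2 (v s) = v (1 / 2 - s)\<close>, and \<open>R = \<rho>1\<close> and \<open>S = \<rho>2 \<circ> \<phi> (\<tau> / 2)\<close> are both
  involutions near their common fixed point \<open>p\<close>; both preserve \<open>H\<close> and take \<open>v s\<close> to \<open>v (- s)\<close>. As
  \<open>\<rho>1\<close> and \<open>\<rho>2\<close> commute, \<open>\<phi> \<tau> = R \<circ> S \<circ> R \<circ> S\<close> near \<open>p\<close>. The differentials of \<open>R\<close> and \<open>S\<close> at \<open>p\<close> therefore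
  induce involutions \<open>r\<close> and \<open>s\<close> of the plane \<open>T \<Sigma> / \<langle>X\<rangle>\<close>, and the reduced monodromy is \<open>(r s)\<^sup>2\<close>. Since \<open>r s\<close>
  has determinant \<open>1\<close> or \<open>-1\<close>, the trace of its square is \<open>(tr (r s))\<^sup>2 - 2 * det (r s) \<ge> -2\<close>.

  Most of the work is to justify that this calculation computes the reduced monodromy. The flow must
  be defined near \<open>p\<close> and differentiable at \<open>p\<close>: \<open>C1_local_flow\<close> proves differentiability in the initial
  condition for short times in Euclidean space, \<open>C1_on_ham\<close> shows by Cramer's rule that the Hamiltonian
  vector field is of class \<open>C\<close>-1 in every chart, and \<open>regular_along_curve\<close> extends regularity of the flow
  along the orbit. The tangent space of the level set is identified with the kernel of \<open>dH\<close> in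
  \<open>tangent_space_level\<close>, and \<open>quotient_trace_two_involutions\<close> is the calculation in the quotient.\<close>

section \<open>Maps of class C1\<close>

text \<open>Class \<open>C\<close>-1, with derivatives taken in the ambient space. Only the values of the derivative on fixed
  vectors are required to be continuous; in finite dimension this is continuity in the operator norm.\<close>

definition C1_on :: "'e::euclidean_space set \<Rightarrow> ('e \<Rightarrow> 'f::real_normed_vector) \<Rightarrow> bool" where
  "C1_on S f \<longleftrightarrow> (\<exists>f'. (\<forall>x\<in>S. (f has_derivative f' x) (at x)) \<and> (\<forall>u. continuous_on S (\<lambda>x. f' x u)))"

lemma C1_on_blinfun:
  assumes "C1_on S f"
  obtains F where "\<And>x. x \<in> S \<Longrightarrow> (f has_derivative blinfun_apply (F x)) (at x)" "continuous_on S F"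
proof -
  obtain f' where f': "\<And>x. x \<in> S \<Longrightarrow> (f has_derivative f' x) (at x)" "\<And>u. continuous_on S (\<lambda>x. f' x u)"
    using assms by (auto simp: C1_on_def)
  have F: "blinfun_apply (Blinfun (f' x)) = f' x" if "x \<in> S" for x
    by (intro bounded_linear_Blinfun_apply has_derivative_bounded_linear[OF f'(1)[OF that]])
  have "continuous_on S (\<lambda>x. Blinfun (f' x))"
  proof (rule continuous_on_blinfun_componentwise)
    show "continuous_on S (\<lambda>x. blinfun_apply (Blinfun (f' x)) i)" for i
      using f'(2)[of i] F by (simp cong: continuous_on_cong)
  qed
  with F f'(1) show thesis by (intro that[of "\<lambda>x. Blinfun (f' x)"]) auto
qed

lemma C1_on_cong:
  assumes "C1_on S f" "open S" "\<And>x. x \<in> S \<Longrightarrow> g x = f x"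
  shows "C1_on S g"
proof -
  obtain f' where f': "\<And>x. x \<in> S \<Longrightarrow> (f has_derivative f' x) (at x)" "\<And>u. continuous_on S (\<lambda>x. f' x u)"
    using assms(1) unfolding C1_on_def by blast
  have "(g has_derivative f' x) (at x)" if "x \<in> S" for x
    by (rule has_derivative_transform_within_open[OF f'(1)[OF that] assms(2) that assms(3)[symmetric]])
  with f'(2) show ?thesis unfolding C1_on_def by blast
qed

lemma C1_on_const: "C1_on S (\<lambda>x. c)"
  unfolding C1_on_def by (intro exI[of _ "\<lambda>x u. 0"]) auto

lemma C1_on_add:
  assumes "C1_on S f" "C1_on S g"
  shows "C1_on S (\<lambda>x. f x + g x)"
proof -
  obtain f' g' where "\<forall>x\<in>S. (f has_derivative f' x) (at x)" "\<forall>u. continuous_on S (\<lambda>x. f' x u)"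
      "\<forall>x\<in>S. (g has_derivative g' x) (at x)" "\<forall>u. continuous_on S (\<lambda>x. g' x u)"
    using assms unfolding C1_on_def by blast
  then show ?thesis
    unfolding C1_on_def
    by (intro exI[of _ "\<lambda>x u. f' x u + g' x u"]) (auto intro!: derivative_intros continuous_intros)
qed

lemma C1_on_continuous_on: "C1_on S f \<Longrightarrow> continuous_on S f"
  unfolding C1_on_def using has_derivative_continuous
  by (intro continuous_at_imp_continuous_on) blast

lemma C1_on_mult:
  fixes f g :: "'e::euclidean_space \<Rightarrow> real"
  assumes "C1_on S f" "C1_on S g"
  shows "C1_on S (\<lambda>x. f x * g x)"
proof -
  obtain f' g' where "\<forall>x\<in>S. (f has_derivative f' x) (at x)" "\<forall>u. continuous_on S (\<lambda>x. f' x u)"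
      "\<forall>x\<in>S. (g has_derivative g' x) (at x)" "\<forall>u. continuous_on S (\<lambda>x. g' x u)"
    using assms unfolding C1_on_def by blast
  then show ?thesis
    unfolding C1_on_def using C1_on_continuous_on[OF assms(1)] C1_on_continuous_on[OF assms(2)]
    by (intro exI[of _ "\<lambda>x u. f x * g' x u + f' x u * g x"]) (auto intro!: has_derivative_mult continuous_intros)
qed

lemma C1_on_inverse:
  fixes f :: "'e::euclidean_space \<Rightarrow> real"
  assumes "C1_on S f" "\<And>x. x \<in> S \<Longrightarrow> f x \<noteq> 0"
  shows "C1_on S (\<lambda>x. inverse (f x))"
proof -
  obtain f' where f': "\<And>x. x \<in> S \<Longrightarrow> (f has_derivative f' x) (at x)" "\<And>u. continuous_on S (\<lambda>x. f' x u)"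
    using assms unfolding C1_on_def by blast
  show ?thesis
    unfolding C1_on_def
  proof (intro exI[of _ "\<lambda>x u. - (inverse (f x) * f' x u * inverse (f x))"] conjI ballI allI)
    show "((\<lambda>x. inverse (f x)) has_derivative (\<lambda>u. - (inverse (f x) * f' x u * inverse (f x)))) (at x)"
      if "x \<in> S" for x
      by (rule Deriv.has_derivative_inverse[OF assms(2)[OF that] f'(1)[OF that]])
    show "continuous_on S (\<lambda>x. - (inverse (f x) * f' x u * inverse (f x)))" for u
      using assms(2) by (intro continuous_intros f'(2) C1_on_continuous_on[OF assms(1)]) auto
  qed
qed

lemma C1_on_sum:
  assumes "\<And>i. i \<in> I \<Longrightarrow> C1_on S (f i)"
  shows "C1_on S (\<lambda>x. \<Sum>i\<in>I. f i x)"
  using assms by (induction I rule: infinite_finite_induct) (auto intro: C1_on_const C1_on_add)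

lemma C1_on_prod:
  fixes f :: "'i \<Rightarrow> 'e::euclidean_space \<Rightarrow> real"
  assumes "\<And>i. i \<in> I \<Longrightarrow> C1_on S (f i)"
  shows "C1_on S (\<lambda>x. \<Prod>i\<in>I. f i x)"
  using assms by (induction I rule: infinite_finite_induct) (auto intro: C1_on_const C1_on_mult)

lemma C1_on_det:
  fixes f :: "'n::finite \<Rightarrow> 'n \<Rightarrow> 'e::euclidean_space \<Rightarrow> real"
  assumes "\<And>i j. C1_on S (f i j)"
  shows "C1_on S (\<lambda>x. det (\<chi> i j. f i j x))"
  unfolding det_def using assms by (auto intro!: C1_on_sum C1_on_mult C1_on_const C1_on_prod)

lemma C1_on_vec:
  fixes f :: "'n::finite \<Rightarrow> 'e::euclidean_space \<Rightarrow> real"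
  assumes "\<And>i. C1_on S (f i)"
  shows "C1_on S (\<lambda>x. \<chi> i. f i x)"
proof -
  have "\<exists>f'. \<forall>i. (\<forall>x\<in>S. (f i has_derivative f' i x) (at x)) \<and> (\<forall>u. continuous_on S (\<lambda>x. f' i x u))"
    using assms unfolding C1_on_def by (intro choice) blast
  then obtain f' where f': "\<And>i x. x \<in> S \<Longrightarrow> (f i has_derivative f' i x) (at x)"
      "\<And>i u. continuous_on S (\<lambda>x. f' i x u)" by blast
  show ?thesis
    unfolding C1_on_def
  proof (intro exI[of _ "\<lambda>x u. \<chi> i. f' i x u"] conjI ballI allI)
    show "((\<lambda>x. \<chi> i. f i x) has_derivative (\<lambda>u. \<chi> i. f' i x u)) (at x)" if "x \<in> S" for x
      using f'(1)[OF that]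
      by (subst has_derivative_componentwise_within) (auto simp: Basis_vec_def inner_axis)
    show "continuous_on S (\<lambda>x. \<chi> i. f' i x u)" for u
      using f'(2) by (intro continuous_on_vec_lambda) auto
  qed
qed

text \<open>Near a point, a \<open>C\<close>-1 vector field is bounded and Lipschitz, and its first-order Taylor remainder
  is small uniformly in the base point.\<close>

lemma C1_on_uniform_linearization:
  fixes X :: "'e::euclidean_space \<Rightarrow> 'e"
  assumes U: "open U" "C1_on U X" "x0 \<in> U"
  obtains r L B F where "r > 0" "cball x0 r \<subseteq> U" "L \<ge> 0" "continuous_on (cball x0 r) F"
    and "\<And>x. x \<in> cball x0 r \<Longrightarrow> norm (X x) \<le> B"
    and "\<And>x. x \<in> cball x0 r \<Longrightarrow> norm (F x) \<le> L"
    and "\<And>x y. x \<in> cball x0 r \<Longrightarrow> y \<in> cball x0 r \<Longrightarrow> norm (X x - X y) \<le> L * norm (x - y)"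
    and "\<And>\<eta>. \<eta> > 0 \<Longrightarrow> \<exists>d>0. \<forall>x\<in>cball x0 r. \<forall>y\<in>cball x0 r. norm (y - x) < d \<longrightarrow>
           norm (X y - X x - blinfun_apply (F x) (y - x)) \<le> \<eta> * norm (y - x)"
proof -
  obtain F where F: "\<And>x. x \<in> U \<Longrightarrow> (X has_derivative blinfun_apply (F x)) (at x)" "continuous_on U F"
    using C1_on_blinfun[OF U(2)] by blast
  obtain r where r: "r > 0" "cball x0 r \<subseteq> U"
    using U open_contains_cball by metis
  have contF: "continuous_on (cball x0 r) F" using F(2) r continuous_on_subset by blast
  have contX: "continuous_on (cball x0 r) X"
    using F(1) r by (meson continuous_at_imp_continuous_on has_derivative_continuous subsetD)
  have "bounded (F ` cball x0 r)" "bounded (X ` cball x0 r)"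
    by (intro compact_imp_bounded compact_continuous_image contF contX compact_cball)+
  then obtain L B where L: "L > 0" "\<And>x. x \<in> cball x0 r \<Longrightarrow> norm (F x) \<le> L"
    and B: "\<And>x. x \<in> cball x0 r \<Longrightarrow> norm (X x) \<le> B"
    by (metis bounded_pos imageI)
  have der: "(X has_derivative blinfun_apply (F x)) (at x within S)" if "x \<in> cball x0 r" for x S
    using F(1) r that by (meson has_derivative_at_withinI subsetD)
  show thesis
  proof (rule that[OF r less_imp_le[OF L(1)] contF B L(2)])
    show "norm (X x - X y) \<le> L * norm (x - y)" if "x \<in> cball x0 r" "y \<in> cball x0 r" for x y
      by (rule differentiable_bound[OF convex_cball der _ that])
         (use L in \<open>auto simp: norm_blinfun.rep_eq\<close>)
    fix \<eta> :: real assume \<eta>: "\<eta> > 0"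
    have "uniformly_continuous_on (cball x0 r) F"
      by (intro compact_uniformly_continuous contF compact_cball)
    then obtain d where d: "d > 0" "\<And>x y. x \<in> cball x0 r \<Longrightarrow> y \<in> cball x0 r \<Longrightarrow> dist y x < d \<Longrightarrow> dist (F y) (F x) < \<eta>"
      using \<eta> unfolding uniformly_continuous_on_def by metis
    show "\<exists>d>0. \<forall>x\<in>cball x0 r. \<forall>y\<in>cball x0 r. norm (y - x) < d \<longrightarrow>
           norm (X y - X x - blinfun_apply (F x) (y - x)) \<le> \<eta> * norm (y - x)"
    proof (intro exI[of _ d] conjI ballI impI d(1))
      fix x y assume xy: "x \<in> cball x0 r" "y \<in> cball x0 r" "norm (y - x) < d"
      have "norm (X y - X x - blinfun_apply (F x) (y - x)) \<le> norm (y - x) * \<eta>"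
      proof (rule differentiable_bound_linearization[where S = "closed_segment x y" and ?x0.0 = x])
        have sub: "closed_segment x y \<subseteq> cball x0 r"
          using xy by (simp add: closed_segment_subset)
        show "x + t *\<^sub>R (y - x) \<in> closed_segment x y" if "t \<in> {0..1}" for t
          using that by (auto simp: in_segment algebra_simps intro!: exI[of _ t])
        fix z assume z: "z \<in> closed_segment x y"
        then show "(X has_derivative blinfun_apply (F z)) (at z within closed_segment x y)"
          using sub by (intro der) auto
        have "dist z x \<le> dist y x" using z by (metis dist_commute dist_in_closed_segment)
        then have "norm (F z - F x) \<le> \<eta>"
          using d(2)[of x z] xy z sub by (force simp: dist_norm)
        then show "onorm (blinfun_apply (F z) - blinfun_apply (F x)) \<le> \<eta>"
          by (simp add: norm_blinfun.rep_eq fun_diff_def minus_blinfun.rep_eq)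
      qed simp
      then show "norm (X y - X x - blinfun_apply (F x) (y - x)) \<le> \<eta> * norm (y - x)"
        by (simp add: mult.commute)
    qed
  qed
qed

section \<open>Ordinary differential equations\<close>

lemma curve_mean_value_bound:
  fixes c :: "real \<Rightarrow> 'e::real_normed_vector"
  assumes "\<And>s. s \<in> {-e..e} \<Longrightarrow> (c has_vector_derivative c' s) (at s within {-e..e})"
    and "\<And>s. s \<in> {-e..e} \<Longrightarrow> norm (c' s) \<le> B"
    and "s \<in> {-e..e}" "t \<in> {-e..e}"
  shows "norm (c t - c s) \<le> B * \<bar>t - s\<bar>"
proof -
  have "onorm (\<lambda>x. x *\<^sub>R c' u) \<le> B" if "u \<in> {-e..e}" for u
    using assms(2)[OF that] onorm_scaleR_left[OF bounded_linear_ident, of "c' u"]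
    by (simp add: onorm_id)
  then show ?thesis
    using differentiable_bound[of "{-e..e}" c "\<lambda>s x. x *\<^sub>R c' s" B t s] assms
    by (simp add: has_vector_derivative_def)
qed

lemma curve_continuous_on:
  fixes c :: "real \<Rightarrow> 'e::real_normed_vector"
  assumes "\<And>s. s \<in> S \<Longrightarrow> (c has_vector_derivative c' s) (at s within S)"
  shows "continuous_on S c"
  unfolding continuous_on_eq_continuous_within
  using assms has_vector_derivative_continuous by blast

text \<open>A Gronwall estimate on an interval so short that no exponential is needed: at a maximum of
  \<open>norm (c t)\<close> the mean value inequality can be absorbed into the left-hand side.\<close>

lemma gronwall_short_interval:
  fixes c :: "real \<Rightarrow> 'e::real_normed_vector"
  assumes e: "0 \<le> e" and L: "0 \<le> L" "e * L \<le> 1 / 2" and \<delta>: "0 \<le> \<delta>"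
    and der: "\<And>s. s \<in> {-e..e} \<Longrightarrow> (c has_vector_derivative c' s) (at s within {-e..e})"
    and bound: "\<And>s. s \<in> {-e..e} \<Longrightarrow> norm (c' s) \<le> L * norm (c s) + \<delta>"
    and t: "t \<in> {-e..e}"
  shows "norm (c t) \<le> 2 * (norm (c 0) + e * \<delta>)"
proof -
  have cont: "continuous_on {-e..e} (\<lambda>t. norm (c t))"
    by (intro continuous_on_norm curve_continuous_on[OF der])
  obtain m where m: "m \<in> {-e..e}" "\<And>s. s \<in> {-e..e} \<Longrightarrow> norm (c s) \<le> norm (c m)"
    using continuous_attains_sup[OF _ _ cont] t by auto
  define B where "B = L * norm (c m) + \<delta>"
  have B: "norm (c' s) \<le> B" if "s \<in> {-e..e}" for s
    using bound[OF that] m(2)[OF that] L mult_left_mono[of "norm (c s)" "norm (c m)" L]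
    by (auto simp: B_def)
  have "B \<ge> 0" using L \<delta> by (auto simp: B_def)
  have "norm (c m - c 0) \<le> B * \<bar>m - 0\<bar>"
    using curve_mean_value_bound[OF der B, of 0 m] m e by auto
  also have "\<dots> \<le> B * e" using m \<open>B \<ge> 0\<close> by (intro mult_left_mono) auto
  also have "\<dots> = (e * L) * norm (c m) + e * \<delta>" by (simp add: B_def algebra_simps)
  also have "\<dots> \<le> 1 / 2 * norm (c m) + e * \<delta>" using L by (intro add_right_mono mult_right_mono) auto
  finally have "norm (c m) \<le> 2 * (norm (c 0) + e * \<delta>)"
    using norm_triangle_sub[of "c m" "c 0"] by simp
  then show ?thesis using m(2)[OF t] by simp
qed

text \<open>On an interval of length at most \<open>1 / L\<close> the Picard operator is a contraction of the bounded
  continuous functions on the whole real line; arguments outside the interval are clamped to it.\<close>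

lemma picard_short_interval:
  fixes f :: "real \<Rightarrow> 'e::euclidean_space \<Rightarrow> 'e"
  assumes e: "0 \<le> e" and L: "0 \<le> L" "e * L \<le> 1 / 2"
    and cont: "\<And>g. continuous_on {-e..e} g \<Longrightarrow> continuous_on {-e..e} (\<lambda>t. f t (g t))"
    and lip: "\<And>t x y. t \<in> {-e..e} \<Longrightarrow> norm (f t x - f t y) \<le> L * norm (x - y)"
  shows "\<exists>c. c 0 = x \<and> (\<forall>t\<in>{-e..e}. (c has_vector_derivative f t (c t)) (at t within {-e..e}))"
proof -
  define J where "J g t = integral {-e..t} (\<lambda>s. f s (g s))" for g t
  have J: "(J g has_vector_derivative f t (g t)) (at t within {-e..e})"
    if "continuous_on UNIV g" "t \<in> {-e..e}" for g t
    using integral_has_vector_derivative[OF cont[OF continuous_on_subset[OF that(1)]] that(2)]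
    by (simp add: J_def[abs_def])
  \<comment> \<open>The Picard operator; subtracting \<open>J g 0\<close> moves the base point of the integral from \<open>- e\<close> to \<open>0\<close>.\<close>
  define T where "T g t = x + (J g (clamp (-e) e t) - J g 0)" for g t
  have cl: "clamp (-e) e t \<in> {-e..e}" for t :: real
    using clamp_in_interval[of "-e" e t] e by simp
  have T: "T g \<in> bcontfun" if g: "continuous_on UNIV g" for g
  proof -
    have c: "continuous_on (cbox (-e) e) (J g)"
      unfolding cbox_interval by (rule curve_continuous_on[OF J[OF g]])
    have "continuous_on UNIV (T g)"
      unfolding T_def by (intro continuous_intros clamp_continuous_on c)
    moreover have "bounded (range (\<lambda>t. J g (clamp (-e) e t)))"
      by (rule clamp_bounded) (intro compact_imp_bounded compact_continuous_image c compact_cbox)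
    then have "bounded ((\<lambda>z. (x - J g 0) + z) ` range (\<lambda>t. J g (clamp (-e) e t)))"
      by (rule bounded_translation)
    then have "bounded (range (T g))"
      by (simp add: T_def[abs_def] image_image algebra_simps)
    ultimately show ?thesis by (simp add: bcontfun_def)
  qed
  define F where "F g = Bcontfun (T (apply_bcontfun g))" for g
  have F: "apply_bcontfun (F g) = T (apply_bcontfun g)" for g
    unfolding F_def by (intro Bcontfun_inverse T) simp
  have "dist (F g) (F h) \<le> 1 / 2 * dist g h" for g h
  proof (rule dist_bound)
    fix t
    define s where "s = clamp (-e) e t"
    have s: "s \<in> {-e..e}" unfolding s_def by (rule cl)
    define D where "D t = J (apply_bcontfun g) t - J (apply_bcontfun h) t" for t
    have "norm (D s - D 0) \<le> (L * dist g h) * \<bar>s - 0\<bar>"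
    proof (rule curve_mean_value_bound)
      fix u assume u: "u \<in> {-e..e}"
      show "(D has_vector_derivative f u (g u) - f u (h u)) (at u within {-e..e})"
        unfolding D_def using u by (intro has_vector_derivative_diff J) auto
      have "norm (f u (g u) - f u (h u)) \<le> L * norm (g u - h u)" by (rule lip[OF u])
      also have "\<dots> \<le> L * dist g h"
        using dist_bounded[of g u h] L by (intro mult_left_mono) (auto simp: dist_norm)
      finally show "norm (f u (g u) - f u (h u)) \<le> L * dist g h" .
    qed (use s e in auto)
    also have "\<dots> \<le> (L * dist g h) * e" using s L by (intro mult_left_mono) auto
    also have "\<dots> = (e * L) * dist g h" by simp
    also have "\<dots> \<le> 1 / 2 * dist g h" using L by (intro mult_right_mono) auto
    finally show "dist (F g t) (F h t) \<le> 1 / 2 * dist g h"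
      by (simp add: F T_def D_def s_def dist_norm algebra_simps)
  qed
  then obtain g where "F g = g"
    using banach_fix_type[of "1/2" F] by auto
  then have g: "apply_bcontfun g t = x + (J (apply_bcontfun g) t - J (apply_bcontfun g) 0)" if "t \<in> {-e..e}" for t
    using fun_cong[OF F[of g], of t] clamp_cancel_cbox[of t "-e" e] that \<open>F g = g\<close> by (simp add: T_def)
  have "(apply_bcontfun g has_vector_derivative f t (g t)) (at t within {-e..e})" if t: "t \<in> {-e..e}" for t
  proof (rule has_vector_derivative_transform[OF t g])
    show "((\<lambda>t. x + (J (apply_bcontfun g) t - J (apply_bcontfun g) 0)) has_vector_derivative f t (g t))
       (at t within {-e..e})"
      using has_vector_derivative_add[OF has_vector_derivative_const
          has_vector_derivative_diff[OF J[OF _ t] has_vector_derivative_const]] by simp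
  qed
  moreover have "apply_bcontfun g 0 = x" using g[of 0] e by simp
  ultimately show ?thesis by blast
qed

lemma C1_local_uniqueness:
  fixes X :: "'e::euclidean_space \<Rightarrow> 'e"
  assumes U: "open U" "C1_on U X" "c t0 \<in> U" and eq: "c t0 = c' t0"
    and I: "open I" "t0 \<in> I"
    and der: "\<And>t. t \<in> I \<Longrightarrow> (c has_vector_derivative X (c t)) (at t)"
      "\<And>t. t \<in> I \<Longrightarrow> (c' has_vector_derivative X (c' t)) (at t)"
  shows "\<exists>d>0. \<forall>t. \<bar>t - t0\<bar> < d \<longrightarrow> c t = c' t"
proof -
  obtain r L where r: "r > 0" and L: "L \<ge> 0"
    and lip: "\<And>x y. x \<in> cball (c t0) r \<Longrightarrow> y \<in> cball (c t0) r \<Longrightarrow> norm (X x - X y) \<le> L * norm (x - y)"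
    using C1_on_uniform_linearization[OF U] by metis
  have near: "\<exists>d>0. \<forall>t. \<bar>t - t0\<bar> \<le> d \<longrightarrow> t \<in> I \<and> f t \<in> cball (c t0) r"
    if f: "\<And>t. t \<in> I \<Longrightarrow> (f has_vector_derivative X (f t)) (at t)" "f t0 = c t0" for f
  proof -
    have "(f \<longlongrightarrow> f t0) (at t0)"
      using f(1)[OF I(2)] has_vector_derivative_continuous continuous_within by blast
    then have "\<forall>\<^sub>F t in at t0. f t \<in> ball (c t0) r"
      using r f(2) by (intro topological_tendstoD) auto
    then obtain d where d: "d > 0" "\<And>t. t \<noteq> t0 \<Longrightarrow> dist t t0 < d \<Longrightarrow> f t \<in> ball (c t0) r"
      by (auto simp: eventually_at)
    obtain k where k: "k > 0" "ball t0 k \<subseteq> I" using I openE by blast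
    show ?thesis
    proof (intro exI[of _ "min d k / 2"] conjI allI impI)
      fix t assume t: "\<bar>t - t0\<bar> \<le> min d k / 2"
      then have "dist t t0 < d" "dist t0 t < k"
        using d k by (auto simp: dist_real_def abs_minus_commute)
      then show "t \<in> I" "f t \<in> cball (c t0) r"
        using d(2)[of t] k(2) f(2) r by (cases "t = t0"; auto)+
    qed (use d k in auto)
  qed
  obtain d1 where d1: "d1 > 0" "\<And>t. \<bar>t - t0\<bar> \<le> d1 \<Longrightarrow> t \<in> I \<and> c t \<in> cball (c t0) r"
    using near[OF der(1)] by auto
  obtain d2 where d2: "d2 > 0" "\<And>t. \<bar>t - t0\<bar> \<le> d2 \<Longrightarrow> t \<in> I \<and> c' t \<in> cball (c t0) r"
    using near[OF der(2)] eq by auto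
  define e where "e = min (min d1 d2) (1 / (2 * (L + 1)))"
  have e: "e > 0" "e \<le> d1" "e \<le> d2" using d1 d2 L by (auto simp: e_def)
  have "e * L \<le> 1 / (2 * (L + 1)) * L" using L by (intro mult_right_mono) (auto simp: e_def)
  also have "\<dots> \<le> 1 / 2" using L by (simp add: field_simps)
  finally have eL: "e * L \<le> 1 / 2" .
  have "c t = c' t" if t: "\<bar>t - t0\<bar> < e" for t
  proof -
    have sh: "((\<lambda>s. f (t0 + s)) has_vector_derivative X (f (t0 + s))) (at s within {-e..e})"
      if f: "\<And>t. t \<in> I \<Longrightarrow> (f has_vector_derivative X (f t)) (at t)" and "s \<in> {-e..e}" for f s
    proof -
      have "t0 + s \<in> I" using d1(2)[of "t0 + s"] that e by auto
      then have "(f has_vector_derivative X (f (t0 + s))) (at (t0 + s))" by (rule f)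
      then have "(f has_vector_derivative X (f (t0 + s))) (at (t0 + s) within (\<lambda>s. t0 + s) ` {-e..e})"
        by (rule has_vector_derivative_at_within)
      moreover have "((\<lambda>s. t0 + s) has_vector_derivative 1) (at s within {-e..e})"
        by (auto intro!: derivative_eq_intros)
      ultimately show ?thesis
        using vector_diff_chain_within by (fastforce simp: o_def)
    qed
    have "norm (c (t0 + (t - t0)) - c' (t0 + (t - t0))) \<le> 2 * (norm (c (t0 + 0) - c' (t0 + 0)) + e * 0)"
    proof (rule gronwall_short_interval[OF _ L eL])
      fix s assume s: "s \<in> {-e..e}"
      show "((\<lambda>s. c (t0 + s) - c' (t0 + s)) has_vector_derivative X (c (t0 + s)) - X (c' (t0 + s)))
          (at s within {-e..e})"
        by (intro has_vector_derivative_diff sh der s)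
      have "\<bar>t0 + s - t0\<bar> \<le> e" using s by auto
      then have "c (t0 + s) \<in> cball (c t0) r" "c' (t0 + s) \<in> cball (c t0) r"
        using d1(2)[of "t0 + s"] d2(2)[of "t0 + s"] e by linarith+
      then show "norm (X (c (t0 + s)) - X (c' (t0 + s))) \<le> L * norm (c (t0 + s) - c' (t0 + s)) + 0"
        using lip by auto
    qed (use e t in auto)
    then show ?thesis using eq by simp
  qed
  then show ?thesis using e(1) by blast
qed

text \<open>The local flow \<open>\<Phi>\<close> of a \<open>C\<close>-1 vector field is differentiable in the initial condition.\<close>

theorem C1_local_flow:
  fixes X :: "'e::euclidean_space \<Rightarrow> 'e"
  assumes U: "open U" "C1_on U X" "x0 \<in> U"
  obtains e r \<Phi> where "e > 0" "r > 0"
    and "\<And>x. x \<in> ball x0 r \<Longrightarrow> \<Phi> x 0 = x"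
    and "\<And>x t. x \<in> ball x0 r \<Longrightarrow> t \<in> {-e..e} \<Longrightarrow> \<Phi> x t \<in> U"
    and "\<And>x t. x \<in> ball x0 r \<Longrightarrow> t \<in> {-e..e} \<Longrightarrow>
           (\<Phi> x has_vector_derivative X (\<Phi> x t)) (at t within {-e..e})"
    and "\<And>x t. x \<in> ball x0 r \<Longrightarrow> t \<in> {-e..e} \<Longrightarrow> (\<lambda>y. \<Phi> y t) differentiable (at x)"
proof -
  obtain r L B F where r: "r > 0" and sub: "cball x0 r \<subseteq> U" and L: "L \<ge> 0" and contF: "continuous_on (cball x0 r) F"
    and B: "\<And>x. x \<in> cball x0 r \<Longrightarrow> norm (X x) \<le> B"
    and FL: "\<And>x. x \<in> cball x0 r \<Longrightarrow> norm (F x) \<le> L"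
    and lip: "\<And>x y. x \<in> cball x0 r \<Longrightarrow> y \<in> cball x0 r \<Longrightarrow> norm (X x - X y) \<le> L * norm (x - y)"
    and lin: "\<And>\<eta>. \<eta> > 0 \<Longrightarrow> \<exists>d>0. \<forall>x\<in>cball x0 r. \<forall>y\<in>cball x0 r. norm (y - x) < d \<longrightarrow>
           norm (X y - X x - blinfun_apply (F x) (y - x)) \<le> \<eta> * norm (y - x)"
    using C1_on_uniform_linearization[OF U] by metis
  have B0: "B \<ge> 0" using B[of x0] r norm_ge_zero order_trans by (meson centre_in_cball less_imp_le)
  \<comment> \<open>Precomposition with the nearest-point projection makes the field globally Lipschitz.\<close>
  define \<pi> where "\<pi> = closest_point (cball x0 r)"
  have \<pi>: "\<pi> x \<in> cball x0 r" for x
    unfolding \<pi>_def using r by (intro closest_point_in_set) auto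
  have \<pi>_id: "\<pi> x = x" if "x \<in> cball x0 r" for x
    unfolding \<pi>_def using that by (rule closest_point_self)
  have \<pi>_lip: "norm (\<pi> x - \<pi> y) \<le> norm (x - y)" for x y
    unfolding \<pi>_def using closest_point_lipschitz[of "cball x0 r" x y] r by (simp add: dist_norm)
  define Y where "Y x = X (\<pi> x)" for x
  have Ylip: "norm (Y x - Y y) \<le> L * norm (x - y)" for x y
    unfolding Y_def using lip[OF \<pi> \<pi>, of x y] mult_left_mono[OF \<pi>_lip[of x y] L] by linarith
  have YX: "Y x = X x" if "x \<in> cball x0 r" for x unfolding Y_def using \<pi>_id[OF that] by simp
  have Ycont: "continuous_on UNIV Y"
    by (rule lipschitz_on_continuous_on[of L]) (use Ylip L in \<open>auto simp: lipschitz_on_def dist_norm\<close>)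
  define e where "e = min (r / (2 * (B + 1))) (1 / (2 * (L + 1)))"
  have e: "e > 0" using r B0 L by (auto simp: e_def)
  have "e * L \<le> 1 / (2 * (L + 1)) * L" using L by (intro mult_right_mono) (auto simp: e_def)
  also have "\<dots> \<le> 1 / 2" using L by (simp add: field_simps)
  finally have eL: "e * L \<le> 1 / 2" .
  have "B * e \<le> B * (r / (2 * (B + 1)))" using B0 by (intro mult_left_mono) (auto simp: e_def)
  also have "\<dots> < r / 2" using B0 r by (simp add: field_simps)
  finally have eB: "B * e < r / 2" .
  have "\<exists>c. c 0 = x \<and> (\<forall>t\<in>{-e..e}. (c has_vector_derivative Y (c t)) (at t within {-e..e}))" for x
  proof (rule picard_short_interval[OF less_imp_le[OF e] L eL, of "\<lambda>t. Y"])
    show "continuous_on {- e..e} (\<lambda>t. Y (g t))" if "continuous_on {-e..e} g" for g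
      by (rule continuous_on_compose2[OF Ycont that]) auto
  qed (rule Ylip)
  then obtain \<Phi> where \<Phi>0: "\<And>x. \<Phi> x 0 = x"
    and \<Phi>: "\<And>x t. t \<in> {-e..e} \<Longrightarrow> (\<Phi> x has_vector_derivative Y (\<Phi> x t)) (at t within {-e..e})"
    by metis
  have stay: "\<Phi> x t \<in> cball x0 r" if x: "x \<in> ball x0 (r / 2)" and t: "t \<in> {-e..e}" for x t
  proof -
    have "norm (\<Phi> x t - \<Phi> x 0) \<le> B * \<bar>t - 0\<bar>"
      by (rule curve_mean_value_bound[OF \<Phi>]) (use B[OF \<pi>] t e in \<open>auto simp: Y_def\<close>)
    also have "\<dots> \<le> B * e" using t B0 by (intro mult_left_mono) auto
    also have "\<dots> < r / 2" by (rule eB)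
    finally have "dist x (\<Phi> x t) < r / 2" by (simp add: \<Phi>0 dist_norm norm_minus_commute)
    then show ?thesis using x dist_triangle[of x0 "\<Phi> x t" x] by simp
  qed
  have close: "norm (\<Phi> y t - \<Phi> x t) \<le> 2 * norm (y - x)" if t: "t \<in> {-e..e}" for x y t
  proof -
    have "norm (\<Phi> y t - \<Phi> x t) \<le> 2 * (norm (\<Phi> y 0 - \<Phi> x 0) + e * 0)"
      by (rule gronwall_short_interval[OF less_imp_le[OF e] L eL _ _ _ t])
         (use Ylip in \<open>auto intro!: has_vector_derivative_diff \<Phi>\<close>)
    then show ?thesis by (simp add: \<Phi>0)
  qed
  have diff: "(\<lambda>y. \<Phi> y t) differentiable (at x)" if x: "x \<in> ball x0 (r / 2)" and t: "t \<in> {-e..e}" for x t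
  proof -
    \<comment> \<open>The derivative is the solution of the linearized equation along the orbit of \<open>x\<close>.\<close>
    have cont\<Phi>: "continuous_on {-e..e} (\<Phi> x)" by (rule curve_continuous_on[OF \<Phi>])
    have contA: "continuous_on {-e..e} (\<lambda>t. F (\<Phi> x t))"
      by (rule continuous_on_compose2[OF contF cont\<Phi>]) (use stay x in auto)
    have AL: "norm (blinfun_apply (F (\<Phi> x s)) u) \<le> L * norm u" if "s \<in> {-e..e}" for s u
      using norm_blinfun[of "F (\<Phi> x s)" u] mult_right_mono[OF FL[OF stay[OF x that]], of "norm u"] by simp
    have "\<exists>c. c 0 = u \<and> (\<forall>t\<in>{-e..e}. (c has_vector_derivative F (\<Phi> x t) (c t)) (at t within {-e..e}))" for u
    proof (rule picard_short_interval[OF less_imp_le[OF e] L eL, of "\<lambda>t. blinfun_apply (F (\<Phi> x t))"])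
      show "continuous_on {- e..e} (\<lambda>t. F (\<Phi> x t) (g t))" if "continuous_on {-e..e} g" for g
        by (intro continuous_intros contA that)
      show "norm (F (\<Phi> x t) u - F (\<Phi> x t) w) \<le> L * norm (u - w)" if "t \<in> {-e..e}" for t u w
        using AL[OF that, of "u - w"] by (simp add: blinfun.diff_right)
    qed
    then obtain W where W0: "\<And>u. W u 0 = u"
      and W: "\<And>u t. t \<in> {-e..e} \<Longrightarrow> (W u has_vector_derivative F (\<Phi> x t) (W u t)) (at t within {-e..e})"
      by metis
    have "norm (W (a *\<^sub>R u + b *\<^sub>R w) t - (a *\<^sub>R W u t + b *\<^sub>R W w t))
        \<le> 2 * (norm (W (a *\<^sub>R u + b *\<^sub>R w) 0 - (a *\<^sub>R W u 0 + b *\<^sub>R W w 0)) + e * 0)" for a b u w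
    proof (rule gronwall_short_interval[OF less_imp_le[OF e] L eL _ _ _ t])
      fix s assume s: "s \<in> {-e..e}"
      show "((\<lambda>t. W (a *\<^sub>R u + b *\<^sub>R w) t - (a *\<^sub>R W u t + b *\<^sub>R W w t)) has_vector_derivative
          F (\<Phi> x s) (W (a *\<^sub>R u + b *\<^sub>R w) s - (a *\<^sub>R W u s + b *\<^sub>R W w s))) (at s within {-e..e})"
        by (rule derivative_eq_intros W[OF s] refl |
            simp add: blinfun.diff_right blinfun.add_right blinfun.scaleR_right)+
      show "norm (F (\<Phi> x s) (W (a *\<^sub>R u + b *\<^sub>R w) s - (a *\<^sub>R W u s + b *\<^sub>R W w s)))
          \<le> L * norm (W (a *\<^sub>R u + b *\<^sub>R w) s - (a *\<^sub>R W u s + b *\<^sub>R W w s)) + 0"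
        using AL[OF s] by simp
    qed simp
    then have comb: "W (a *\<^sub>R u + b *\<^sub>R w) t = a *\<^sub>R W u t + b *\<^sub>R W w t" for a b u w
      by (simp add: W0)
    have "linear (\<lambda>u. W u t)"
      by (rule linearI) (use comb[of 1 _ 1] comb[of _ _ 0 0] in auto)
    then have "bounded_linear (\<lambda>u. W u t)" by (simp add: linear_conv_bounded_linear)
    moreover have "\<exists>d>0. \<forall>y. norm (y - x) < d \<longrightarrow>
        norm (\<Phi> y t - \<Phi> x t - W (y - x) t) \<le> \<epsilon> * norm (y - x)" if \<epsilon>: "\<epsilon> > 0" for \<epsilon>
    proof -
      \<comment> \<open>The Gronwall estimate gives the error \<open>2 * e * \<eta> * (2 * norm (y - x))\<close>.\<close>
      define \<eta> where "\<eta> = \<epsilon> / (4 * e)"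
      have \<eta>: "\<eta> > 0" using \<epsilon> e by (simp add: \<eta>_def)
      obtain d where d: "d > 0" "\<And>x y. x\<in>cball x0 r \<Longrightarrow> y\<in>cball x0 r \<Longrightarrow> norm (y - x) < d \<Longrightarrow>
           norm (X y - X x - blinfun_apply (F x) (y - x)) \<le> \<eta> * norm (y - x)"
        using lin[OF \<eta>] by blast
      obtain k where k: "k > 0" "ball x k \<subseteq> ball x0 (r / 2)"
        using openE[OF open_ball x] by blast
      show ?thesis
      proof (intro exI[of _ "min k (d / 2)"] conjI allI impI)
        fix y assume y: "norm (y - x) < min k (d / 2)"
        have y': "y \<in> ball x0 (r / 2)" using y k by (auto simp: dist_norm norm_minus_commute)
        have "norm (\<Phi> y t - \<Phi> x t - W (y - x) t)
            \<le> 2 * (norm (\<Phi> y 0 - \<Phi> x 0 - W (y - x) 0) + e * (\<eta> * (2 * norm (y - x))))"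
        proof (rule gronwall_short_interval[OF less_imp_le[OF e] L eL _ _ _ t])
          fix s assume s: "s \<in> {-e..e}"
          show "((\<lambda>t. \<Phi> y t - \<Phi> x t - W (y - x) t) has_vector_derivative
              Y (\<Phi> y s) - Y (\<Phi> x s) - F (\<Phi> x s) (W (y - x) s)) (at s within {-e..e})"
            by (intro has_vector_derivative_diff \<Phi> W s)
          have st: "\<Phi> x s \<in> cball x0 r" "\<Phi> y s \<in> cball x0 r" using stay s x y' by auto
          have "norm (\<Phi> y s - \<Phi> x s) < d" using close[OF s, of y x] y by simp
          then have "norm (X (\<Phi> y s) - X (\<Phi> x s) - F (\<Phi> x s) (\<Phi> y s - \<Phi> x s)) \<le> \<eta> * norm (\<Phi> y s - \<Phi> x s)"
            by (intro d(2) st)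
          also have "\<dots> \<le> \<eta> * (2 * norm (y - x))" using close[OF s] \<eta> by (intro mult_left_mono) auto
          finally have 1: "norm (X (\<Phi> y s) - X (\<Phi> x s) - F (\<Phi> x s) (\<Phi> y s - \<Phi> x s)) \<le> \<eta> * (2 * norm (y - x))" .
          \<comment> \<open>The deviation solves the linearized equation up to the Taylor remainder of \<open>X\<close>.\<close>
          have "Y (\<Phi> y s) - Y (\<Phi> x s) - F (\<Phi> x s) (W (y - x) s) =
              F (\<Phi> x s) (\<Phi> y s - \<Phi> x s - W (y - x) s)
              + (X (\<Phi> y s) - X (\<Phi> x s) - F (\<Phi> x s) (\<Phi> y s - \<Phi> x s))"
            by (simp add: YX[OF st(1)] YX[OF st(2)] blinfun.diff_right)
          then show "norm (Y (\<Phi> y s) - Y (\<Phi> x s) - F (\<Phi> x s) (W (y - x) s))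
              \<le> L * norm (\<Phi> y s - \<Phi> x s - W (y - x) s) + \<eta> * (2 * norm (y - x))"
            using norm_triangle_le[OF add_mono[OF AL[OF s] 1]] by simp
        qed (use \<eta> in auto)
        also have "\<dots> = \<epsilon> * norm (y - x)" using e by (simp add: \<Phi>0 W0 \<eta>_def)
        finally show "norm (\<Phi> y t - \<Phi> x t - W (y - x) t) \<le> \<epsilon> * norm (y - x)" .
      qed (use k d in auto)
    qed
    ultimately have "((\<lambda>y. \<Phi> y t) has_derivative (\<lambda>u. W u t)) (at x)"
      unfolding has_derivative_at_alt by blast
    then show ?thesis unfolding differentiable_def by blast
  qed
  show thesis
  proof (rule that[of e "r / 2" \<Phi>])
    show "\<Phi> x t \<in> U" if "x \<in> ball x0 (r / 2)" "t \<in> {-e..e}" for x t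
      using stay[OF that] sub by blast
    show "(\<Phi> x has_vector_derivative X (\<Phi> x t)) (at t within {-e..e})"
      if "x \<in> ball x0 (r / 2)" "t \<in> {-e..e}" for x t
      using \<Phi>[OF that(2), of x] YX[OF stay[OF that]] by simp
  qed (use e r \<Phi>0 diff in auto)
qed

section \<open>Differentials on a manifold\<close>

lemma isCont_eventually_in:
  assumes "isCont f p" "open V" "f p \<in> V"
  shows "\<forall>\<^sub>F x in nhds p. f x \<in> V"
proof -
  have "(f \<longlongrightarrow> f p) (nhds p)" using assms(1) by (simp add: isCont_def tendsto_at_iff_tendsto_nhds)
  then show ?thesis using assms(2,3) by (rule topological_tendstoD)
qed

lemma has_derivative_eventually_cong:
  assumes "(f has_derivative D) (at x)" "\<forall>\<^sub>F y in nhds x. g y = f y"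
  shows "(g has_derivative D) (at x)"
  using assms(2) eventually_nhds_x_imp_x[OF assms(2)]
  by (intro has_derivative_transform_eventually[OF assms(1)])
     (auto simp: eventually_at_filter elim: eventually_mono)

lemma smooth_on_differentiable:
  assumes "smooth_on S f" "open S" "x \<in> S"
  shows "f differentiable (at x)"
proof -
  have "Ck_on (Suc 0) S f" using assms(1) by (simp only: smooth_on_def)
  then show ?thesis using assms(2,3) by (simp add: differentiable_on_eq_differentiable_at)
qed

lemma Ck_on_C1_on:
  assumes "Ck_on (Suc 0) S f" "open S"
  shows "C1_on S f"
proof -
  have "(f has_derivative frechet_derivative f (at x)) (at x)" if "x \<in> S" for x
    using assms that by (simp add: differentiable_on_eq_differentiable_at frechet_derivative_works)
  with assms(1) show ?thesis
    unfolding C1_on_def by (intro exI[of _ "\<lambda>x. frechet_derivative f (at x)"]) simp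
qed

lemma smooth_on_C1_on:
  assumes "smooth_on S f" "open S"
  shows "C1_on S f" and "C1_on S (\<lambda>x. frechet_derivative f (at x) u)"
proof -
  have "Ck_on (Suc 0) S f" "Ck_on (Suc (Suc 0)) S f" using assms(1) by (simp_all only: smooth_on_def)
  then show "C1_on S f" "C1_on S (\<lambda>x. frechet_derivative f (at x) u)"
    using assms(2) Ck_on_C1_on by (blast, metis Ck_on.simps(2))
qed

locale atlas =
  fixes A :: "('a::t2_space, 'e::euclidean_space) chart set"
  assumes smooth_atlas: "smooth_atlas A"
begin

lemma chart_inv_coords [simp]: "\<kappa> \<in> A \<Longrightarrow> p \<in> chart_dom \<kappa> \<Longrightarrow> chart_inv \<kappa> (coords \<kappa> p) = p"
  using smooth_atlas unfolding smooth_atlas_def is_chart_def homeomorphism_def by auto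

lemma coords_chart_inv [simp]: "\<kappa> \<in> A \<Longrightarrow> x \<in> coords \<kappa> ` chart_dom \<kappa> \<Longrightarrow> coords \<kappa> (chart_inv \<kappa> x) = x"
  by (rule f_inv_into_f)

lemma chart_inv_in_dom: "x \<in> coords \<kappa> ` chart_dom \<kappa> \<Longrightarrow> chart_inv \<kappa> x \<in> chart_dom \<kappa>"
  by (rule inv_into_into)

lemma open_chart_dom: "\<kappa> \<in> A \<Longrightarrow> open (chart_dom \<kappa>)"
  and open_chart_image: "\<kappa> \<in> A \<Longrightarrow> open (coords \<kappa> ` chart_dom \<kappa>)"
  using smooth_atlas unfolding smooth_atlas_def is_chart_def by auto

lemma isCont_coords: "\<kappa> \<in> A \<Longrightarrow> p \<in> chart_dom \<kappa> \<Longrightarrow> isCont (coords \<kappa>) p"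
  and isCont_chart_inv: "\<kappa> \<in> A \<Longrightarrow> x \<in> coords \<kappa> ` chart_dom \<kappa> \<Longrightarrow> isCont (chart_inv \<kappa>) x"
proof -
  have "is_chart \<kappa>" if "\<kappa> \<in> A" using smooth_atlas that unfolding smooth_atlas_def by blast
  then have "open (chart_dom \<kappa>)" "continuous_on (chart_dom \<kappa>) (coords \<kappa>)"
      "open (coords \<kappa> ` chart_dom \<kappa>)" "continuous_on (coords \<kappa> ` chart_dom \<kappa>) (chart_inv \<kappa>)"
    if "\<kappa> \<in> A"
    using that unfolding is_chart_def homeomorphism_def by blast+
  then show "\<kappa> \<in> A \<Longrightarrow> p \<in> chart_dom \<kappa> \<Longrightarrow> isCont (coords \<kappa>) p"
    and "\<kappa> \<in> A \<Longrightarrow> x \<in> coords \<kappa> ` chart_dom \<kappa> \<Longrightarrow> isCont (chart_inv \<kappa>) x"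
    using continuous_on_eq_continuous_at by blast+
qed

lemma open_coords_image:
  assumes "\<kappa> \<in> A" "open V" "V \<subseteq> chart_dom \<kappa>"
  shows "open (coords \<kappa> ` V)"
proof -
  have "coords \<kappa> ` V = coords \<kappa> ` chart_dom \<kappa> \<inter> chart_inv \<kappa> -` V"
    using assms by auto
  moreover have "continuous_on (coords \<kappa> ` chart_dom \<kappa>) (chart_inv \<kappa>)"
    using isCont_chart_inv[OF assms(1)] by (simp add: continuous_at_imp_continuous_on)
  ultimately show ?thesis
    using assms open_chart_image by (metis continuous_on_open_vimage inf_commute)
qed

lemma chart_at: "chart_at A p \<in> A" "p \<in> chart_dom (chart_at A p)"
proof -
  have "\<exists>\<kappa>. \<kappa> \<in> A \<and> p \<in> chart_dom \<kappa>"
    using smooth_atlas unfolding smooth_atlas_def by blast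
  from someI_ex[OF this] show "chart_at A p \<in> A" "p \<in> chart_dom (chart_at A p)"
    by (auto simp: chart_at_def)
qed

text \<open>Here \<open>D\<close> is the differential at \<open>p\<close> of a self-map \<open>f\<close>, in coordinates given by \<open>\<kappa>\<close> around
  \<open>p\<close> and \<open>\<kappa>'\<close> around \<open>f p\<close>. Continuity on the manifold is part of the definition because the
  coordinate expression only makes sense near \<open>p\<close> if \<open>f\<close> maps a neighbourhood of \<open>p\<close> into the
  domain of \<open>\<kappa>'\<close>.\<close>

definition map_deriv ::
    "('a \<Rightarrow> 'a) \<Rightarrow> 'a \<Rightarrow> ('a, 'e) chart \<Rightarrow> ('a, 'e) chart \<Rightarrow> ('e \<Rightarrow> 'e) \<Rightarrow> bool" where
  "map_deriv f p \<kappa> \<kappa>' D \<longleftrightarrow> \<kappa> \<in> A \<and> \<kappa>' \<in> A \<and> p \<in> chart_dom \<kappa> \<and> f p \<in> chart_dom \<kappa>' \<and> isCont f p \<and>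
     (coords \<kappa>' \<circ> f \<circ> chart_inv \<kappa> has_derivative D) (at (coords \<kappa> p))"

text \<open>The same for a real function; continuity of the coordinate expression at the point suffices.\<close>

definition fun_deriv :: "('a \<Rightarrow> real) \<Rightarrow> 'a \<Rightarrow> ('a, 'e) chart \<Rightarrow> ('e \<Rightarrow> real) \<Rightarrow> bool" where
  "fun_deriv h p \<kappa> D \<longleftrightarrow> \<kappa> \<in> A \<and> p \<in> chart_dom \<kappa> \<and> (h \<circ> chart_inv \<kappa> has_derivative D) (at (coords \<kappa> p))"

lemma map_deriv_unique: "map_deriv f p \<kappa> \<kappa>' D \<Longrightarrow> map_deriv f p \<kappa> \<kappa>' D' \<Longrightarrow> D = D'"
  unfolding map_deriv_def by (blast intro: has_derivative_unique)

lemma eventually_chart_inv: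
  assumes "\<kappa> \<in> A" "p \<in> chart_dom \<kappa>" "\<forall>\<^sub>F x in nhds p. P x"
  shows "\<forall>\<^sub>F y in nhds (coords \<kappa> p). P (chart_inv \<kappa> y)"
proof -
  obtain V where V: "open V" "p \<in> V" "\<forall>x\<in>V. P x"
    using assms(3) by (auto simp: eventually_nhds)
  have "\<forall>\<^sub>F y in nhds (coords \<kappa> p). chart_inv \<kappa> y \<in> V"
    using V assms by (intro isCont_eventually_in isCont_chart_inv) auto
  then show ?thesis by (rule eventually_mono) (use V in auto)
qed

lemma map_deriv_comp:
  assumes "map_deriv f p \<kappa> \<kappa>' D" "map_deriv g (f p) \<kappa>' \<kappa>'' E"
  shows "map_deriv (g \<circ> f) p \<kappa> \<kappa>'' (E \<circ> D)"
proof -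
  have [simp]: "\<kappa> \<in> A" "\<kappa>' \<in> A" "p \<in> chart_dom \<kappa>" "f p \<in> chart_dom \<kappa>'"
    using assms by (auto simp: map_deriv_def)
  have "((coords \<kappa>'' \<circ> g \<circ> chart_inv \<kappa>') \<circ> (coords \<kappa>' \<circ> f \<circ> chart_inv \<kappa>) has_derivative E \<circ> D)
      (at (coords \<kappa> p))"
    using assms by (intro diff_chain_at) (auto simp: map_deriv_def)
  moreover have "\<forall>\<^sub>F x in nhds p. f x \<in> chart_dom \<kappa>'"
    using assms by (intro isCont_eventually_in) (auto simp: map_deriv_def open_chart_dom)
  from eventually_chart_inv[OF _ _ this, of \<kappa>]
  have "\<forall>\<^sub>F y in nhds (coords \<kappa> p). (coords \<kappa>'' \<circ> (g \<circ> f) \<circ> chart_inv \<kappa>) y =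
      ((coords \<kappa>'' \<circ> g \<circ> chart_inv \<kappa>') \<circ> (coords \<kappa>' \<circ> f \<circ> chart_inv \<kappa>)) y"
    by (auto elim: eventually_mono)
  ultimately have "(coords \<kappa>'' \<circ> (g \<circ> f) \<circ> chart_inv \<kappa> has_derivative E \<circ> D) (at (coords \<kappa> p))"
    by (rule has_derivative_eventually_cong)
  moreover have "isCont (g \<circ> f) p"
    using assms unfolding map_deriv_def o_def by (blast intro: isCont_o2)
  ultimately show ?thesis using assms by (simp add: map_deriv_def)
qed

lemma fun_deriv_comp:
  assumes "map_deriv f p \<kappa> \<kappa>' D" "fun_deriv h (f p) \<kappa>' E"
  shows "fun_deriv (h \<circ> f) p \<kappa> (E \<circ> D)"
proof -
  have [simp]: "\<kappa> \<in> A" "\<kappa>' \<in> A" "p \<in> chart_dom \<kappa>" "f p \<in> chart_dom \<kappa>'"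
    using assms by (auto simp: map_deriv_def)
  have "((h \<circ> chart_inv \<kappa>') \<circ> (coords \<kappa>' \<circ> f \<circ> chart_inv \<kappa>) has_derivative E \<circ> D) (at (coords \<kappa> p))"
    using assms by (intro diff_chain_at) (auto simp: map_deriv_def fun_deriv_def)
  moreover have "\<forall>\<^sub>F x in nhds p. f x \<in> chart_dom \<kappa>'"
    using assms by (intro isCont_eventually_in) (auto simp: map_deriv_def open_chart_dom)
  from eventually_chart_inv[OF _ _ this, of \<kappa>]
  have "\<forall>\<^sub>F y in nhds (coords \<kappa> p). (h \<circ> f \<circ> chart_inv \<kappa>) y =
      ((h \<circ> chart_inv \<kappa>') \<circ> (coords \<kappa>' \<circ> f \<circ> chart_inv \<kappa>)) y"
    by (auto elim: eventually_mono)
  ultimately have "(h \<circ> f \<circ> chart_inv \<kappa> has_derivative E \<circ> D) (at (coords \<kappa> p))"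
    by (rule has_derivative_eventually_cong)
  then show ?thesis using assms by (simp add: fun_deriv_def)
qed

lemma map_deriv_cong:
  assumes f: "map_deriv f p \<kappa> \<kappa>' D" and eq: "\<forall>\<^sub>F x in nhds p. g x = f x"
  shows "map_deriv g p \<kappa> \<kappa>' D"
proof -
  have "\<forall>\<^sub>F y in nhds (coords \<kappa> p). (coords \<kappa>' \<circ> g \<circ> chart_inv \<kappa>) y = (coords \<kappa>' \<circ> f \<circ> chart_inv \<kappa>) y"
    using f eventually_chart_inv[OF _ _ eq, of \<kappa>] by (auto simp: map_deriv_def elim: eventually_mono)
  then have "\<And>E. (coords \<kappa>' \<circ> f \<circ> chart_inv \<kappa> has_derivative E) (at (coords \<kappa> p)) \<Longrightarrow>
      (coords \<kappa>' \<circ> g \<circ> chart_inv \<kappa> has_derivative E) (at (coords \<kappa> p))"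
    by (rule has_derivative_eventually_cong[rotated])
  then have "(coords \<kappa>' \<circ> g \<circ> chart_inv \<kappa> has_derivative D) (at (coords \<kappa> p))"
    using f by (simp add: map_deriv_def)
  moreover have "isCont g p"
    using f isCont_cong[OF eq] by (simp add: map_deriv_def)
  ultimately show ?thesis
    using f eventually_nhds_x_imp_x[OF eq] by (simp add: map_deriv_def)
qed

lemma fun_deriv_cong:
  assumes f: "fun_deriv f p \<kappa> D" and eq: "\<forall>\<^sub>F x in nhds p. g x = f x"
  shows "fun_deriv g p \<kappa> D"
proof -
  have "\<forall>\<^sub>F y in nhds (coords \<kappa> p). (g \<circ> chart_inv \<kappa>) y = (f \<circ> chart_inv \<kappa>) y"
    using f eventually_chart_inv[OF _ _ eq, of \<kappa>] by (auto simp: fun_deriv_def elim: eventually_mono)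
  with has_derivative_eventually_cong[of "f \<circ> chart_inv \<kappa>" D "coords \<kappa> p" "g \<circ> chart_inv \<kappa>"] show ?thesis
    using f unfolding fun_deriv_def by blast
qed

text \<open>The differential at \<open>p\<close> of the change of coordinates from \<open>\<kappa>\<close> to \<open>\<kappa>'\<close>.\<close>

definition transition :: "'a \<Rightarrow> ('a, 'e) chart \<Rightarrow> ('a, 'e) chart \<Rightarrow> 'e \<Rightarrow> 'e" where
  "transition p \<kappa> \<kappa>' = frechet_derivative (coords \<kappa>' \<circ> chart_inv \<kappa>) (at (coords \<kappa> p))"

lemma map_deriv_transition:
  assumes "\<kappa> \<in> A" "\<kappa>' \<in> A" "p \<in> chart_dom \<kappa>" "p \<in> chart_dom \<kappa>'"
  shows "map_deriv id p \<kappa> \<kappa>' (transition p \<kappa> \<kappa>')"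
proof -
  have "smooth_on (coords \<kappa> ` (chart_dom \<kappa> \<inter> chart_dom \<kappa>')) (coords \<kappa>' \<circ> chart_inv \<kappa>)"
    using smooth_atlas assms unfolding smooth_atlas_def by blast
  moreover have "open (coords \<kappa> ` (chart_dom \<kappa> \<inter> chart_dom \<kappa>'))"
    using assms by (intro open_coords_image) (auto intro: open_chart_dom)
  ultimately have "(coords \<kappa>' \<circ> chart_inv \<kappa>) differentiable (at (coords \<kappa> p))"
    using assms by (intro smooth_on_differentiable) auto
  then show ?thesis
    using assms by (simp add: map_deriv_def transition_def frechet_derivative_works)
qed

lemma map_deriv_change_target:
  assumes "map_deriv f p \<kappa> \<kappa>' D" "\<kappa>'' \<in> A" "f p \<in> chart_dom \<kappa>''"
  shows "map_deriv f p \<kappa> \<kappa>'' (transition (f p) \<kappa>' \<kappa>'' \<circ> D)"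
proof -
  have "map_deriv id (f p) \<kappa>' \<kappa>'' (transition (f p) \<kappa>' \<kappa>'')"
    using assms by (intro map_deriv_transition) (auto simp: map_deriv_def)
  from map_deriv_comp[OF assms(1) this] show ?thesis by (simp only: id_comp)
qed

lemma map_deriv_change_source:
  assumes "map_deriv f p \<kappa> \<kappa>' D" "\<kappa>0 \<in> A" "p \<in> chart_dom \<kappa>0"
  shows "map_deriv f p \<kappa>0 \<kappa>' (D \<circ> transition p \<kappa>0 \<kappa>)"
proof -
  have "map_deriv id p \<kappa>0 \<kappa> (transition p \<kappa>0 \<kappa>)"
    using assms by (intro map_deriv_transition) (auto simp: map_deriv_def)
  moreover have "map_deriv f (id p) \<kappa> \<kappa>' D" using assms by simp
  ultimately show ?thesis using map_deriv_comp by fastforce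
qed

lemma map_deriv_comp_obtain:
  assumes f: "map_deriv f p \<kappa> \<kappa>' D" and g: "map_deriv g (f p) \<kappa>2 \<kappa>3 E"
  obtains F where "map_deriv (g \<circ> f) p \<kappa> \<kappa>3 F"
proof -
  have "\<kappa>' \<in> A" "f p \<in> chart_dom \<kappa>'" using f by (auto simp: map_deriv_def)
  from map_deriv_comp[OF f map_deriv_change_source[OF g this]] show thesis by (rule that)
qed

lemma fun_deriv_change:
  assumes "fun_deriv h p \<kappa> D" "\<kappa>0 \<in> A" "p \<in> chart_dom \<kappa>0"
  shows "fun_deriv h p \<kappa>0 (D \<circ> transition p \<kappa>0 \<kappa>)"
proof -
  have "map_deriv id p \<kappa>0 \<kappa> (transition p \<kappa>0 \<kappa>)"
    using assms by (intro map_deriv_transition) (auto simp: fun_deriv_def)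
  moreover have "fun_deriv h (id p) \<kappa> D" using assms by simp
  ultimately show ?thesis using fun_deriv_comp by fastforce
qed

lemma transition_comp:
  assumes "\<kappa> \<in> A" "\<kappa>' \<in> A" "\<kappa>'' \<in> A" "p \<in> chart_dom \<kappa>" "p \<in> chart_dom \<kappa>'" "p \<in> chart_dom \<kappa>''"
  shows "transition p \<kappa>' \<kappa>'' (transition p \<kappa> \<kappa>' u) = transition p \<kappa> \<kappa>'' u"
proof -
  have "map_deriv id p \<kappa> \<kappa>'' (transition p \<kappa>' \<kappa>'' \<circ> transition p \<kappa> \<kappa>')"
    using map_deriv_change_target[OF map_deriv_transition, of \<kappa> \<kappa>' p \<kappa>''] assms by simp
  from map_deriv_unique[OF this map_deriv_transition] show ?thesis
    using assms by (auto simp: fun_eq_iff)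
qed

lemma map_deriv_id: "\<kappa> \<in> A \<Longrightarrow> p \<in> chart_dom \<kappa> \<Longrightarrow> map_deriv id p \<kappa> \<kappa> id"
proof -
  assume a: "\<kappa> \<in> A" "p \<in> chart_dom \<kappa>"
  have "\<forall>\<^sub>F y in nhds (coords \<kappa> p). y \<in> coords \<kappa> ` chart_dom \<kappa>"
    using a open_chart_image by (intro eventually_nhds_in_open) auto
  then have "\<forall>\<^sub>F y in nhds (coords \<kappa> p). (coords \<kappa> \<circ> id \<circ> chart_inv \<kappa>) y = id y"
    using a by (auto elim: eventually_mono)
  then have "(coords \<kappa> \<circ> id \<circ> chart_inv \<kappa> has_derivative id) (at (coords \<kappa> p))"
    using has_derivative_ident[folded id_def] by (rule has_derivative_eventually_cong[rotated])
  then show ?thesis using a by (simp add: map_deriv_def)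
qed

lemma transition_self: "\<kappa> \<in> A \<Longrightarrow> p \<in> chart_dom \<kappa> \<Longrightarrow> transition p \<kappa> \<kappa> u = u"
  by (simp add: map_deriv_unique[OF map_deriv_transition map_deriv_id])

lemma tangent_space_iff:
  "X \<in> tangent_space A p \<longleftrightarrow> (\<forall>\<kappa>. \<not> (\<kappa> \<in> A \<and> p \<in> chart_dom \<kappa>) \<longrightarrow> X \<kappa> = 0) \<and>
     (\<forall>\<kappa>\<in>A. \<forall>\<kappa>'\<in>A. p \<in> chart_dom \<kappa> \<longrightarrow> p \<in> chart_dom \<kappa>' \<longrightarrow> X \<kappa>' = transition p \<kappa> \<kappa>' (X \<kappa>))"
  by (simp add: tangent_space_def transition_def)

lemma tangent_transition:
  assumes "X \<in> tangent_space A p" "\<kappa> \<in> A" "\<kappa>' \<in> A" "p \<in> chart_dom \<kappa>" "p \<in> chart_dom \<kappa>'"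
  shows "transition p \<kappa> \<kappa>' (X \<kappa>) = X \<kappa>'"
  using assms(1)[unfolded tangent_space_iff, THEN conjunct2, rule_format, OF assms(2-)] by (rule sym)

lemma tangent_of_eq:
  "tangent_of A \<kappa> p u = (\<lambda>\<kappa>'. if \<kappa>' \<in> A \<and> p \<in> chart_dom \<kappa>' then transition p \<kappa> \<kappa>' u else 0)"
  by (simp add: tangent_of_def transition_def fun_eq_iff)

lemma tangent_of_in: "\<kappa> \<in> A \<Longrightarrow> p \<in> chart_dom \<kappa> \<Longrightarrow> tangent_of A \<kappa> p u \<in> tangent_space A p"
  by (simp add: tangent_space_iff tangent_of_eq transition_comp)

lemma tangent_of_apply [simp]: "\<kappa> \<in> A \<Longrightarrow> p \<in> chart_dom \<kappa> \<Longrightarrow> tangent_of A \<kappa> p u \<kappa> = u"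
  by (simp add: tangent_of_eq transition_self)

lemma tangent_of_coordinate:
  "\<kappa> \<in> A \<Longrightarrow> p \<in> chart_dom \<kappa> \<Longrightarrow> X \<in> tangent_space A p \<Longrightarrow> tangent_of A \<kappa> p (X \<kappa>) = X"
  using tangent_space_iff[of X p, THEN iffD1, THEN conjunct1, rule_format]
  by (intro ext) (auto simp: tangent_of_eq tangent_transition)

lemma tangent_eqI:
  assumes "\<kappa> \<in> A" "p \<in> chart_dom \<kappa>" "X \<in> tangent_space A p" "Y \<in> tangent_space A p" "X \<kappa> = Y \<kappa>"
  shows "X = Y"
  using tangent_of_coordinate assms by metis

lemma transition_linear:
  assumes "\<kappa> \<in> A" "\<kappa>' \<in> A" "p \<in> chart_dom \<kappa>" "p \<in> chart_dom \<kappa>'"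
  shows "linear (transition p \<kappa> \<kappa>')"
  using map_deriv_transition[OF assms] unfolding map_deriv_def by (blast intro: has_derivative_linear)

lemma tangent_of_comb:
  assumes "\<kappa> \<in> A" "p \<in> chart_dom \<kappa>"
  shows "tangent_of A \<kappa> p (a *\<^sub>R u + b *\<^sub>R w) = a *\<^sub>R tangent_of A \<kappa> p u + b *\<^sub>R tangent_of A \<kappa> p w"
proof
  fix \<kappa>' show "tangent_of A \<kappa> p (a *\<^sub>R u + b *\<^sub>R w) \<kappa>' = (a *\<^sub>R tangent_of A \<kappa> p u + b *\<^sub>R tangent_of A \<kappa> p w) \<kappa>'"
  proof (cases "\<kappa>' \<in> A \<and> p \<in> chart_dom \<kappa>'")
    case True
    then have "linear (transition p \<kappa> \<kappa>')" using assms by (intro transition_linear) auto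
    with True show ?thesis by (simp add: tangent_of_eq scaleR_fun_def linear_add linear_scale)
  qed (auto simp: tangent_of_eq scaleR_fun_def)
qed

lemma tangent_space_comb:
  assumes "X \<in> tangent_space A p" "Y \<in> tangent_space A p"
  shows "a *\<^sub>R X + b *\<^sub>R Y \<in> tangent_space A p"
proof -
  have "tangent_of A (chart_at A p) p (a *\<^sub>R X (chart_at A p) + b *\<^sub>R Y (chart_at A p)) = a *\<^sub>R X + b *\<^sub>R Y"
    by (simp add: tangent_of_comb[OF chart_at] tangent_of_coordinate[OF chart_at] assms)
  then show ?thesis using tangent_of_in[OF chart_at] by metis
qed

lemma subspace_tangent_space: "subspace (tangent_space A p)"
proof (rule subspaceI)
  show z: "0 \<in> tangent_space A p"
    using transition_linear by (auto simp: tangent_space_iff linear_0)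
  show "X + Y \<in> tangent_space A p" if "X \<in> tangent_space A p" "Y \<in> tangent_space A p" for X Y
    using tangent_space_comb[OF that, of 1 1] by simp
  show "c *\<^sub>R X \<in> tangent_space A p" if "X \<in> tangent_space A p" for c X
    using tangent_space_comb[OF that z, of c 0] by simp
qed

lemma diff_map_eq:
  assumes f: "map_deriv f p \<kappa> \<kappa>' D" and X: "X \<in> tangent_space A p"
  shows "diff_map A f p X = tangent_of A \<kappa>' (f p) (D (X \<kappa>))"
proof
  fix \<kappa>''
  let ?k = "chart_at A p"
  show "diff_map A f p X \<kappa>'' = tangent_of A \<kappa>' (f p) (D (X \<kappa>)) \<kappa>''"
  proof (cases "\<kappa>'' \<in> A \<and> f p \<in> chart_dom \<kappa>''")
    case True
    have "map_deriv f p ?k \<kappa>'' (transition (f p) \<kappa>' \<kappa>'' \<circ> (D \<circ> transition p ?k \<kappa>))"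
      using True by (intro map_deriv_change_target map_deriv_change_source[OF f] chart_at) auto
    then have "frechet_derivative (coords \<kappa>'' \<circ> f \<circ> chart_inv ?k) (at (coords ?k p)) =
        transition (f p) \<kappa>' \<kappa>'' \<circ> (D \<circ> transition p ?k \<kappa>)"
      by (intro frechet_derivative_at[symmetric]) (simp add: map_deriv_def)
    moreover have "transition p ?k \<kappa> (X ?k) = X \<kappa>"
      using f by (intro tangent_transition[OF X] chart_at) (auto simp: map_deriv_def)
    ultimately show ?thesis using True by (simp add: diff_map_def tangent_of_eq)
  qed (auto simp: diff_map_def tangent_of_def)
qed

lemma diff_fun_eq:
  assumes h: "fun_deriv h p \<kappa> D" and X: "X \<in> tangent_space A p"
  shows "diff_fun A h p X = D (X \<kappa>)"
proof -
  let ?k = "chart_at A p"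
  have "fun_deriv h p ?k (D \<circ> transition p ?k \<kappa>)"
    by (intro fun_deriv_change[OF h] chart_at)
  then have "frechet_derivative (h \<circ> chart_inv ?k) (at (coords ?k p)) = D \<circ> transition p ?k \<kappa>"
    by (intro frechet_derivative_at[symmetric]) (simp add: fun_deriv_def)
  moreover have "transition p ?k \<kappa> (X ?k) = X \<kappa>"
    using h by (intro tangent_transition[OF X] chart_at) (auto simp: fun_deriv_def)
  ultimately show ?thesis by (simp add: diff_fun_def)
qed

lemma smooth_function_fun_deriv:
  assumes "smooth_function A h" "\<kappa> \<in> A" "p \<in> chart_dom \<kappa>"
  obtains D where "fun_deriv h p \<kappa> D"
proof -
  have "(h \<circ> chart_inv \<kappa>) differentiable (at (coords \<kappa> p))"
    using assms by (intro smooth_on_differentiable[OF _ open_chart_image]) (auto simp: smooth_function_def)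
  then show thesis using that assms by (auto simp: fun_deriv_def differentiable_def)
qed

lemma smooth_self_map_deriv:
  assumes "smooth_self_map A f" "\<kappa> \<in> A" "\<kappa>' \<in> A" "p \<in> chart_dom \<kappa>" "f p \<in> chart_dom \<kappa>'"
  obtains D where "map_deriv f p \<kappa> \<kappa>' D"
proof -
  have cont: "isCont f p" and "continuous_on UNIV f"
    using assms by (auto simp: smooth_self_map_def continuous_on_eq_continuous_at)
  then have "open (chart_dom \<kappa> \<inter> f -` chart_dom \<kappa>')"
    using assms by (intro open_Int open_vimage open_chart_dom)
  then have "open (coords \<kappa> ` (chart_dom \<kappa> \<inter> f -` chart_dom \<kappa>'))"
    using assms by (intro open_coords_image) auto
  then have "(coords \<kappa>' \<circ> f \<circ> chart_inv \<kappa>) differentiable (at (coords \<kappa> p))"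
    using assms by (intro smooth_on_differentiable) (auto simp: smooth_self_map_def)
  then show thesis using that assms cont by (auto simp: map_deriv_def differentiable_def)
qed

lemma vector_derivative_map:
  assumes cont: "isCont \<gamma> t" and f: "map_deriv f (\<gamma> t) \<kappa> \<kappa>' D"
    and \<gamma>: "((coords \<kappa> \<circ> \<gamma>) has_vector_derivative u) (at t)"
  shows "((coords \<kappa>' \<circ> (f \<circ> \<gamma>)) has_vector_derivative D u) (at t)"
proof -
  have a: "\<kappa> \<in> A" "\<gamma> t \<in> chart_dom \<kappa>"
    and D: "(coords \<kappa>' \<circ> f \<circ> chart_inv \<kappa> has_derivative D) (at ((coords \<kappa> \<circ> \<gamma>) t))"
    using f by (auto simp: map_deriv_def)
  have "((coords \<kappa>' \<circ> f \<circ> chart_inv \<kappa>) \<circ> (coords \<kappa> \<circ> \<gamma>) has_derivative D \<circ> (\<lambda>s. s *\<^sub>R u)) (at t)"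
    using \<gamma> D unfolding has_vector_derivative_def by (intro diff_chain_at)
  moreover have "D \<circ> (\<lambda>s. s *\<^sub>R u) = (\<lambda>s. s *\<^sub>R D u)"
    using has_derivative_linear[OF D] by (simp add: fun_eq_iff linear_scale)
  moreover have "\<forall>\<^sub>F s in nhds t. (coords \<kappa>' \<circ> (f \<circ> \<gamma>)) s = ((coords \<kappa>' \<circ> f \<circ> chart_inv \<kappa>) \<circ> (coords \<kappa> \<circ> \<gamma>)) s"
    using isCont_eventually_in[OF cont open_chart_dom a(2)] a(1) by (auto elim: eventually_mono)
  ultimately show ?thesis
    unfolding has_vector_derivative_def by (metis has_derivative_eventually_cong)
qed

text \<open>A velocity need only be computed in one chart.\<close>

lemma velocity_chartI:
  assumes cont: "isCont \<gamma> t" and X: "X \<in> tangent_space A (\<gamma> t)" and \<kappa>: "\<kappa> \<in> A" "\<gamma> t \<in> chart_dom \<kappa>"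
    and \<gamma>: "((coords \<kappa> \<circ> \<gamma>) has_vector_derivative X \<kappa>) (at t)"
  shows "has_velocity A \<gamma> t X"
  unfolding has_velocity_def
proof (intro conjI ballI impI cont X)
  fix \<kappa>' assume k: "\<kappa>' \<in> A" "\<gamma> t \<in> chart_dom \<kappa>'"
  have "((coords \<kappa>' \<circ> (id \<circ> \<gamma>)) has_vector_derivative transition (\<gamma> t) \<kappa> \<kappa>' (X \<kappa>)) (at t)"
    using k \<kappa> by (intro vector_derivative_map[OF cont _ \<gamma>] map_deriv_transition)
  then show "((coords \<kappa>' \<circ> \<gamma>) has_vector_derivative X \<kappa>') (at t)"
    by (simp only: tangent_transition[OF X \<kappa>(1) k(1) \<kappa>(2) k(2)] id_comp)
qed

lemma velocity_map:
  assumes \<gamma>: "has_velocity A \<gamma> t X" and f: "map_deriv f (\<gamma> t) \<kappa> \<kappa>' D"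
  shows "has_velocity A (f \<circ> \<gamma>) t (tangent_of A \<kappa>' (f (\<gamma> t)) (D (X \<kappa>)))"
proof -
  have a: "\<kappa> \<in> A" "\<kappa>' \<in> A" "\<gamma> t \<in> chart_dom \<kappa>" "f (\<gamma> t) \<in> chart_dom \<kappa>'" "isCont f (\<gamma> t)"
    using f by (auto simp: map_deriv_def)
  have cont: "isCont \<gamma> t" using \<gamma> by (simp add: has_velocity_def)
  show ?thesis
  proof (rule velocity_chartI[of _ _ _ \<kappa>'])
    show "isCont (f \<circ> \<gamma>) t" unfolding o_def by (rule isCont_o2[OF cont a(5)])
    show "((coords \<kappa>' \<circ> (f \<circ> \<gamma>)) has_vector_derivative tangent_of A \<kappa>' (f (\<gamma> t)) (D (X \<kappa>)) \<kappa>') (at t)"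
      using vector_derivative_map[OF cont f, of "X \<kappa>"] \<gamma> a by (simp add: has_velocity_def)
  qed (use a in \<open>auto simp: tangent_of_in\<close>)
qed

lemma velocity_unique:
  assumes "has_velocity A \<gamma> t X" "has_velocity A \<gamma> t Y"
  shows "X = Y"
proof (rule tangent_eqI[OF chart_at])
  show "X \<in> tangent_space A (\<gamma> t)" "Y \<in> tangent_space A (\<gamma> t)"
    using assms by (auto simp: has_velocity_def)
  show "X (chart_at A (\<gamma> t)) = Y (chart_at A (\<gamma> t))"
    using assms chart_at[of "\<gamma> t"] unfolding has_velocity_def by (blast intro: vector_derivative_unique_at)
qed

lemma velocity_cong:
  assumes "has_velocity A \<gamma> t X" and eq: "\<forall>\<^sub>F s in nhds t. \<gamma>' s = \<gamma> s"
  shows "has_velocity A \<gamma>' t X"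
proof -
  have "\<gamma>' t = \<gamma> t" using eq by (rule eventually_nhds_x_imp_x)
  moreover have "isCont \<gamma>' t" using assms isCont_cong by (auto simp: has_velocity_def)
  moreover have "\<forall>\<^sub>F s in nhds t. (coords \<kappa> \<circ> \<gamma>') s = (coords \<kappa> \<circ> \<gamma>) s" for \<kappa> :: "('a, 'e) chart"
    using eq by (auto elim: eventually_mono)
  then have "((coords \<kappa> \<circ> \<gamma>) has_vector_derivative X \<kappa>) (at t) \<Longrightarrow> ((coords \<kappa> \<circ> \<gamma>') has_vector_derivative X \<kappa>) (at t)"
    for \<kappa> :: "('a, 'e) chart"
    unfolding has_vector_derivative_def by (rule has_derivative_eventually_cong[rotated])
  ultimately show ?thesis
    using assms(1) by (simp add: has_velocity_def)
qed

lemma velocity_affine_reparam: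
  assumes "has_velocity A \<gamma> (a * t + b) X"
  shows "has_velocity A (\<lambda>s. \<gamma> (a * s + b)) t (a *\<^sub>R X)"
  unfolding has_velocity_def
proof (intro conjI ballI impI)
  have "isCont \<gamma> (a * t + b)" using assms by (simp add: has_velocity_def)
  moreover have "isCont (\<lambda>s. a * s + b) t" by simp
  ultimately show "isCont (\<lambda>s. \<gamma> (a * s + b)) t" by (rule isCont_o2[rotated])
  show "a *\<^sub>R X \<in> tangent_space A (\<gamma> (a * t + b))"
    using assms by (simp add: has_velocity_def subspace_scale[OF subspace_tangent_space])
  fix \<kappa> assume "\<kappa> \<in> A" "\<gamma> (a * t + b) \<in> chart_dom \<kappa>"
  then have "((coords \<kappa> \<circ> \<gamma>) has_vector_derivative X \<kappa>) (at (a * t + b))"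
    using assms by (simp add: has_velocity_def)
  moreover have "((\<lambda>s. a * s + b) has_vector_derivative a) (at t)"
    by (auto intro!: derivative_eq_intros)
  ultimately have "((coords \<kappa> \<circ> \<gamma>) \<circ> (\<lambda>s. a * s + b) has_vector_derivative a *\<^sub>R X \<kappa>) (at t)"
    by (intro vector_diff_chain_at) auto
  then show "((coords \<kappa> \<circ> (\<lambda>s. \<gamma> (a * s + b))) has_vector_derivative (a *\<^sub>R X) \<kappa>) (at t)"
    by (simp add: o_def scaleR_fun_def)
qed

lemma velocity_fun:
  assumes \<gamma>: "has_velocity A \<gamma> t Y" and h: "fun_deriv h (\<gamma> t) \<kappa> D"
  shows "((h \<circ> \<gamma>) has_vector_derivative diff_fun A h (\<gamma> t) Y) (at t)"
proof -
  have a: "\<kappa> \<in> A" "\<gamma> t \<in> chart_dom \<kappa>"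
    and D: "(h \<circ> chart_inv \<kappa> has_derivative D) (at ((coords \<kappa> \<circ> \<gamma>) t))"
    using h by (auto simp: fun_deriv_def)
  have Y: "Y \<in> tangent_space A (\<gamma> t)" and cont: "isCont \<gamma> t"
    and der: "((coords \<kappa> \<circ> \<gamma>) has_vector_derivative Y \<kappa>) (at t)"
    using \<gamma> a by (auto simp: has_velocity_def)
  have "((h \<circ> chart_inv \<kappa>) \<circ> (coords \<kappa> \<circ> \<gamma>) has_derivative D \<circ> (\<lambda>s. s *\<^sub>R Y \<kappa>)) (at t)"
    using der D unfolding has_vector_derivative_def by (intro diff_chain_at)
  moreover have "D \<circ> (\<lambda>s. s *\<^sub>R Y \<kappa>) = (\<lambda>s. s *\<^sub>R diff_fun A h (\<gamma> t) Y)"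
    using has_derivative_linear[OF D] diff_fun_eq[OF h Y] by (simp add: fun_eq_iff linear_scale)
  moreover have "\<forall>\<^sub>F s in nhds t. (h \<circ> \<gamma>) s = ((h \<circ> chart_inv \<kappa>) \<circ> (coords \<kappa> \<circ> \<gamma>)) s"
    using isCont_eventually_in[OF cont open_chart_dom a(2)] a(1) by (auto elim: eventually_mono)
  ultimately show ?thesis
    unfolding has_vector_derivative_def by (metis has_derivative_eventually_cong)
qed

lemma velocity_diff_map:
  assumes "has_velocity A \<gamma> t Y" "map_deriv f (\<gamma> t) \<kappa> \<kappa>' D"
  shows "has_velocity A (f \<circ> \<gamma>) t (diff_map A f (\<gamma> t) Y)"
  using velocity_map[OF assms] diff_map_eq[OF assms(2)] assms(1) by (simp add: has_velocity_def)

lemma diff_map_in: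
  assumes "map_deriv f p \<kappa> \<kappa>' D" "Y \<in> tangent_space A p"
  shows "diff_map A f p Y \<in> tangent_space A (f p)"
  using assms by (simp add: diff_map_eq[OF assms] tangent_of_in map_deriv_def)

lemma diff_map_comp:
  assumes f: "map_deriv f p \<kappa> \<kappa>' D" and g: "map_deriv g (f p) \<kappa>2 \<kappa>3 E" and Y: "Y \<in> tangent_space A p"
  shows "diff_map A (g \<circ> f) p Y = diff_map A g (f p) (diff_map A f p Y)"
proof -
  have k: "\<kappa>' \<in> A" "f p \<in> chart_dom \<kappa>'" using f by (auto simp: map_deriv_def)
  note g' = map_deriv_change_source[OF g k]
  show ?thesis
    using diff_map_eq[OF map_deriv_comp[OF f g'] Y] diff_map_eq[OF g' diff_map_in[OF f Y]]
      diff_map_eq[OF f Y] k by simp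
qed

lemma diff_map_cong:
  assumes f: "map_deriv f p \<kappa> \<kappa>' D" and eq: "\<forall>\<^sub>F x in nhds p. g x = f x" and Y: "Y \<in> tangent_space A p"
  shows "diff_map A g p Y = diff_map A f p Y"
  using diff_map_eq[OF map_deriv_cong[OF f eq] Y] diff_map_eq[OF f Y] eventually_nhds_x_imp_x[OF eq] by simp

lemma diff_map_id: "Y \<in> tangent_space A p \<Longrightarrow> diff_map A id p Y = Y"
  using diff_map_eq[OF map_deriv_id[OF chart_at]] tangent_of_coordinate[OF chart_at] by simp

lemma diff_map_comb:
  assumes f: "map_deriv f p \<kappa> \<kappa>' D" and Y: "Y \<in> tangent_space A p" "Z \<in> tangent_space A p"
  shows "diff_map A f p (a *\<^sub>R Y + b *\<^sub>R Z) = a *\<^sub>R diff_map A f p Y + b *\<^sub>R diff_map A f p Z"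
proof -
  have D: "linear D" and k: "\<kappa>' \<in> A" "f p \<in> chart_dom \<kappa>'"
    using f has_derivative_linear by (auto simp: map_deriv_def)
  have "D ((a *\<^sub>R Y + b *\<^sub>R Z) \<kappa>) = a *\<^sub>R D (Y \<kappa>) + b *\<^sub>R D (Z \<kappa>)"
    using D by (simp add: scaleR_fun_def linear_add linear_scale)
  then show ?thesis
    by (simp add: diff_map_eq[OF f] Y tangent_space_comb tangent_of_comb[OF k])
qed

lemma diff_fun_comp:
  assumes f: "map_deriv f p \<kappa> \<kappa>' D" and h: "fun_deriv h (f p) \<kappa>2 E" and Y: "Y \<in> tangent_space A p"
  shows "diff_fun A (h \<circ> f) p Y = diff_fun A h (f p) (diff_map A f p Y)"
proof -
  have k: "\<kappa>' \<in> A" "f p \<in> chart_dom \<kappa>'" using f by (auto simp: map_deriv_def)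
  note h' = fun_deriv_change[OF h k]
  show ?thesis
    using diff_fun_eq[OF fun_deriv_comp[OF f h'] Y] diff_fun_eq[OF h' diff_map_in[OF f Y]]
      diff_map_eq[OF f Y] k by simp
qed

lemma diff_fun_cong:
  assumes f: "fun_deriv f p \<kappa> D" and eq: "\<forall>\<^sub>F x in nhds p. g x = f x" and Y: "Y \<in> tangent_space A p"
  shows "diff_fun A g p Y = diff_fun A f p Y"
  using diff_fun_eq[OF fun_deriv_cong[OF f eq] Y] diff_fun_eq[OF f Y] by simp

end

section \<open>The flow of a vector field on a manifold\<close>

text \<open>A vector field whose coordinate expressions in the charts of \<open>A\<close> are of class \<open>C\<close>-1.\<close>

locale C1_vector_field = atlas A for A :: "('a::t2_space, 'e::euclidean_space) chart set" +
  fixes X :: "'a \<Rightarrow> ('a, 'e) tvec"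
  assumes X_tangent: "X p \<in> tangent_space A p"
    and X_C1: "\<kappa> \<in> A \<Longrightarrow> C1_on (coords \<kappa> ` chart_dom \<kappa>) (\<lambda>x. X (chart_inv \<kappa> x) \<kappa>)"
begin

text \<open>The velocity at each point of \<open>I\<close> is two-sided, so the notion is meant for open \<open>I\<close>.\<close>

definition integral_curve :: "(real \<Rightarrow> 'a) \<Rightarrow> real set \<Rightarrow> bool" where
  "integral_curve \<gamma> I \<longleftrightarrow> (\<forall>s\<in>I. has_velocity A \<gamma> s (X (\<gamma> s)))"

lemma integral_curve_isCont: "integral_curve \<gamma> I \<Longrightarrow> s \<in> I \<Longrightarrow> isCont \<gamma> s"
  by (auto simp: integral_curve_def has_velocity_def)

lemma integral_curve_subset: "integral_curve \<gamma> I \<Longrightarrow> J \<subseteq> I \<Longrightarrow> integral_curve \<gamma> J"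
  by (auto simp: integral_curve_def)

lemma integral_curve_shift:
  assumes "integral_curve \<gamma> I"
  shows "integral_curve (\<lambda>s. \<gamma> (s + a)) {s. s + a \<in> I}"
  using assms velocity_affine_reparam[of \<gamma> 1 _ a] by (auto simp: integral_curve_def)

lemma integral_curve_locally_unique:
  assumes \<gamma>: "integral_curve \<gamma> I" "integral_curve \<gamma>' I" and I: "open I" "t0 \<in> I" and eq: "\<gamma> t0 = \<gamma>' t0"
  shows "\<forall>\<^sub>F t in nhds t0. \<gamma> t = \<gamma>' t"
proof -
  define \<kappa> where "\<kappa> = chart_at A (\<gamma> t0)"
  have \<kappa>: "\<kappa> \<in> A" "\<gamma> t0 \<in> chart_dom \<kappa>" unfolding \<kappa>_def by (rule chart_at)+
  have "\<forall>\<^sub>F t in nhds t0. t \<in> I" using I by (rule eventually_nhds_in_open)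
  moreover have "\<forall>\<^sub>F t in nhds t0. \<gamma> t \<in> chart_dom \<kappa>" "\<forall>\<^sub>F t in nhds t0. \<gamma>' t \<in> chart_dom \<kappa>"
    using \<kappa> eq I \<gamma> by (auto intro!: isCont_eventually_in open_chart_dom integral_curve_isCont)
  ultimately have "\<forall>\<^sub>F t in nhds t0. t \<in> I \<and> \<gamma> t \<in> chart_dom \<kappa> \<and> \<gamma>' t \<in> chart_dom \<kappa>"
    by eventually_elim auto
  then obtain J where J: "open J" "t0 \<in> J"
    and in_J: "\<And>t. t \<in> J \<Longrightarrow> t \<in> I \<and> \<gamma> t \<in> chart_dom \<kappa> \<and> \<gamma>' t \<in> chart_dom \<kappa>"
    by (auto simp: eventually_nhds)
  have der: "((coords \<kappa> \<circ> c) has_vector_derivative X (chart_inv \<kappa> ((coords \<kappa> \<circ> c) t)) \<kappa>) (at t)"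
    if "integral_curve c I" "t \<in> I" "c t \<in> chart_dom \<kappa>" for c t
    using that \<kappa> by (auto simp: integral_curve_def has_velocity_def)
  have "\<exists>d>0. \<forall>t. \<bar>t - t0\<bar> < d \<longrightarrow> (coords \<kappa> \<circ> \<gamma>) t = (coords \<kappa> \<circ> \<gamma>') t"
    by (rule C1_local_uniqueness[OF open_chart_image[OF \<kappa>(1)] X_C1[OF \<kappa>(1)] _ _ J der[OF \<gamma>(1)] der[OF \<gamma>(2)]])
       (use \<kappa> eq in_J in auto)
  then have "\<forall>\<^sub>F t in nhds t0. (coords \<kappa> \<circ> \<gamma>) t = (coords \<kappa> \<circ> \<gamma>') t"
    by (simp add: eventually_nhds_metric dist_real_def)
  moreover have "\<forall>\<^sub>F t in nhds t0. t \<in> J" using J by (rule eventually_nhds_in_open)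
  ultimately show ?thesis
  proof eventually_elim
    case (elim t)
    then show ?case using in_J[OF elim(2)] chart_inv_coords[OF \<kappa>(1)] by (metis comp_apply)
  qed
qed

lemma integral_curve_unique:
  assumes \<gamma>: "integral_curve \<gamma> I" "integral_curve \<gamma>' I" and I: "open I" "is_interval I"
    and s: "s \<in> I" "\<gamma> s = \<gamma>' s" and t: "t \<in> I"
  shows "\<gamma> t = \<gamma>' t"
proof (rule connected_induction_simple[of I s t "\<lambda>t. \<gamma> t = \<gamma>' t"])
  fix a assume a: "a \<in> I"
  \<comment> \<open>Agreement is an open condition by local uniqueness, disagreement by the Hausdorff property.\<close>
  have "\<forall>\<^sub>F x in nhds a. (\<gamma> x = \<gamma>' x) = (\<gamma> a = \<gamma>' a)"
  proof (cases "\<gamma> a = \<gamma>' a")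
    case True
    then show ?thesis using integral_curve_locally_unique[OF \<gamma> I(1) a] by (auto elim: eventually_mono)
  next
    case False
    then obtain U V where UV: "open U" "open V" "\<gamma> a \<in> U" "\<gamma>' a \<in> V" "U \<inter> V = {}"
      using hausdorff[OF False] by blast
    have "\<forall>\<^sub>F x in nhds a. \<gamma> x \<in> U" "\<forall>\<^sub>F x in nhds a. \<gamma>' x \<in> V"
      using isCont_eventually_in[OF integral_curve_isCont[OF \<gamma>(1) a] UV(1,3)]
        isCont_eventually_in[OF integral_curve_isCont[OF \<gamma>(2) a] UV(2,4)] by auto
    then show ?thesis by eventually_elim (use UV False in auto)
  qed
  then obtain T where T: "open T" "a \<in> T" "\<And>x. x \<in> T \<Longrightarrow> (\<gamma> x = \<gamma>' x) = (\<gamma> a = \<gamma>' a)"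
    by (auto simp: eventually_nhds)
  then show "\<exists>T. openin (top_of_set I) T \<and> a \<in> T \<and> (\<forall>x\<in>T. \<forall>y\<in>T. \<gamma> x = \<gamma>' x \<longrightarrow> \<gamma> y = \<gamma>' y)"
    using a openin_open_Int[OF T(1), of I] by (intro exI[of _ "I \<inter> T"]) blast
qed (use assms is_interval_connected in auto)

text \<open>The orbit relation: an integral curve leads from \<open>p\<close> to \<open>q\<close> in time \<open>t\<close>. In contrast to the
  flow it needs no convention for incomplete orbits, and it is reversible and additive in time.\<close>

definition traj :: "'a \<Rightarrow> real \<Rightarrow> 'a \<Rightarrow> bool" where
  "traj p t q \<longleftrightarrow> (\<exists>\<gamma> I. open I \<and> is_interval I \<and> 0 \<in> I \<and> t \<in> I \<and> \<gamma> 0 = p \<and> integral_curve \<gamma> I \<and> \<gamma> t = q)"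

lemma traj_unique:
  assumes "traj p t q" "traj p t q'"
  shows "q = q'"
proof -
  obtain \<gamma> I where \<gamma>: "open I" "is_interval I" "0 \<in> I" "t \<in> I" "\<gamma> 0 = p" "integral_curve \<gamma> I" "\<gamma> t = q"
    using assms(1) unfolding traj_def by blast
  obtain \<gamma>' J where \<gamma>': "open J" "is_interval J" "0 \<in> J" "t \<in> J" "\<gamma>' 0 = p" "integral_curve \<gamma>' J" "\<gamma>' t = q'"
    using assms(2) unfolding traj_def by blast
  have "\<gamma> t = \<gamma>' t"
    by (rule integral_curve_unique[of \<gamma> "I \<inter> J" \<gamma>' 0 t])
       (use \<gamma> \<gamma>' integral_curve_subset[OF \<gamma>(6), of "I \<inter> J"] integral_curve_subset[OF \<gamma>'(6), of "I \<inter> J"]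
         in \<open>auto simp: is_interval_Int\<close>)
  then show ?thesis using \<gamma> \<gamma>' by simp
qed

lemma flow_traj:
  assumes "traj p t q"
  shows "flow A X t p = q"
proof -
  have "flow A X t p = (THE q. traj p t q)"
    by (simp only: flow_def traj_def integral_curve_def)
  then show ?thesis using the_equality[of "traj p t" q, OF assms traj_unique[OF _ assms]] by simp
qed

lemma trajI:
  assumes "open I" "is_interval I" "a \<in> I" "b \<in> I" "integral_curve \<gamma> I"
  shows "traj (\<gamma> a) (b - a) (\<gamma> b)"
proof -
  have eq: "{s. s + a \<in> I} = (+) (- a) ` I" by (force simp: image_iff)
  have "open {s. s + a \<in> I}" "is_interval {s. s + a \<in> I}"
    unfolding eq using open_translation[OF assms(1)] assms(2) by (blast, simp)
  then show ?thesis
    unfolding traj_def using assms integral_curve_shift[OF assms(5), of a]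
    by (intro exI[of _ "\<lambda>s. \<gamma> (s + a)"] exI[of _ "{s. s + a \<in> I}"]) auto
qed

lemma traj_reverse:
  assumes "traj p t q"
  shows "traj q (- t) p"
proof -
  from assms obtain \<gamma> I where \<gamma>: "open I" "is_interval I" "0 \<in> I" "t \<in> I" "\<gamma> 0 = p" "integral_curve \<gamma> I" "\<gamma> t = q"
    unfolding traj_def by blast
  then show ?thesis using trajI[OF \<gamma>(1,2,4,3,6)] by simp
qed

lemma traj_trans:
  assumes "traj p s q" "traj q t r"
  shows "traj p (s + t) r"
proof -
  obtain \<gamma> I where \<gamma>: "open I" "is_interval I" "0 \<in> I" "s \<in> I" "\<gamma> 0 = p" "integral_curve \<gamma> I" "\<gamma> s = q"
    using assms(1) unfolding traj_def by blast
  obtain \<gamma>' J0 where \<gamma>': "open J0" "is_interval J0" "0 \<in> J0" "t \<in> J0" "\<gamma>' 0 = q" "integral_curve \<gamma>' J0" "\<gamma>' t = r"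
    using assms(2) unfolding traj_def by blast
  define J where "J = {u. u + (- s) \<in> J0}"
  define \<delta> where "\<delta> u = \<gamma>' (u + (- s))" for u
  have "J = (+) s ` J0" by (force simp: J_def image_iff)
  then have J: "open J" "is_interval J" using open_translation[OF \<gamma>'(1)] \<gamma>'(2) by auto
  have \<delta>: "integral_curve \<delta> J" unfolding \<delta>_def J_def by (rule integral_curve_shift[OF \<gamma>'(6)])
  have st: "s \<in> J" "s + t \<in> J" "\<delta> s = q" "\<delta> (s + t) = r" using \<gamma>' by (auto simp: J_def \<delta>_def)
  have agree: "\<gamma> u = \<delta> u" if "u \<in> I" "u \<in> J" for u
    by (rule integral_curve_unique[of \<gamma> "I \<inter> J" \<delta> s u])
       (use \<gamma> J st that integral_curve_subset[OF \<gamma>(6), of "I \<inter> J"] integral_curve_subset[OF \<delta>, of "I \<inter> J"]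
         in \<open>auto simp: is_interval_Int\<close>)
  \<comment> \<open>The two integral curves agree where both are defined, so they glue.\<close>
  define \<eta> where "\<eta> u = (if u \<in> I then \<gamma> u else \<delta> u)" for u
  have \<eta>J: "\<eta> u = \<delta> u" if "u \<in> J" for u using agree that by (auto simp: \<eta>_def)
  have "integral_curve \<eta> (I \<union> J)"
    unfolding integral_curve_def
  proof
    fix u assume "u \<in> I \<union> J"
    then consider "u \<in> I" | "u \<in> J" by blast
    then show "has_velocity A \<eta> u (X (\<eta> u))"
    proof cases
      case 1
      have "\<forall>\<^sub>F x in nhds u. \<eta> x = \<gamma> x"
        using eventually_nhds_in_open[OF \<gamma>(1) 1] by eventually_elim (simp add: \<eta>_def)
      moreover have "has_velocity A \<gamma> u (X (\<gamma> u))" using \<gamma>(6) 1 by (simp add: integral_curve_def)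
      moreover have "\<eta> u = \<gamma> u" using 1 by (simp add: \<eta>_def)
      ultimately show ?thesis using velocity_cong by metis
    next
      case 2
      have "\<forall>\<^sub>F x in nhds u. \<eta> x = \<delta> x"
        using eventually_nhds_in_open[OF J(1) 2] by eventually_elim (rule \<eta>J)
      moreover have "has_velocity A \<delta> u (X (\<delta> u))" using \<delta> 2 by (simp add: integral_curve_def)
      ultimately show ?thesis using velocity_cong \<eta>J[OF 2] by metis
    qed
  qed
  moreover have "is_interval (I \<union> J)"
    unfolding is_interval_connected_1
    using \<gamma> J st by (intro connected_Un) (auto simp: is_interval_connected_1)
  ultimately show ?thesis
    unfolding traj_def using \<gamma> J st \<eta>J[OF st(2)]
    by (intro exI[of _ \<eta>] exI[of _ "I \<union> J"]) (auto simp: \<eta>_def)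
qed

text \<open>The time-\<open>t\<close> flow is \<open>regular\<close> at \<open>p\<close> if it is defined near \<open>p\<close> and differentiable at \<open>p\<close>.\<close>

definition regular :: "real \<Rightarrow> 'a \<Rightarrow> bool" where
  "regular t p \<longleftrightarrow> (\<forall>\<^sub>F x in nhds p. traj x t (flow A X t x)) \<and> (\<exists>\<kappa> \<kappa>' D. map_deriv (flow A X t) p \<kappa> \<kappa>' D)"

lemma regular_locally:
  obtains e W where "e > 0" "open W" "p0 \<in> W" "\<And>x t. x \<in> W \<Longrightarrow> \<bar>t\<bar> < e \<Longrightarrow> regular t x"
proof -
  define \<kappa> where "\<kappa> = chart_at A p0"
  have \<kappa>: "\<kappa> \<in> A" "p0 \<in> chart_dom \<kappa>" unfolding \<kappa>_def by (rule chart_at)+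
  define U where "U = coords \<kappa> ` chart_dom \<kappa>"
  obtain e r \<Phi> where e: "e > 0" "r > 0"
    and \<Phi>0: "\<And>x. x \<in> ball (coords \<kappa> p0) r \<Longrightarrow> \<Phi> x 0 = x"
    and \<Phi>U: "\<And>x t. x \<in> ball (coords \<kappa> p0) r \<Longrightarrow> t \<in> {-e..e} \<Longrightarrow> \<Phi> x t \<in> U"
    and \<Phi>: "\<And>x t. x \<in> ball (coords \<kappa> p0) r \<Longrightarrow> t \<in> {-e..e} \<Longrightarrow>
           (\<Phi> x has_vector_derivative X (chart_inv \<kappa> (\<Phi> x t)) \<kappa>) (at t within {-e..e})"
    and \<Phi>diff: "\<And>x t. x \<in> ball (coords \<kappa> p0) r \<Longrightarrow> t \<in> {-e..e} \<Longrightarrow> (\<lambda>y. \<Phi> y t) differentiable (at x)"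
    by (rule C1_local_flow[OF open_chart_image[OF \<kappa>(1)] X_C1[OF \<kappa>(1)], of "coords \<kappa> p0"])
       (use \<kappa> in \<open>auto simp: U_def\<close>)
  define W where "W = chart_dom \<kappa> \<inter> coords \<kappa> -` ball (coords \<kappa> p0) r"
  have "continuous_on (chart_dom \<kappa>) (coords \<kappa>)"
    using isCont_coords[OF \<kappa>(1)] by (simp add: continuous_at_imp_continuous_on)
  then have W: "open W" "p0 \<in> W"
    unfolding W_def using open_chart_dom[OF \<kappa>(1)] \<kappa> e by (auto intro: continuous_open_preimage)
  have traj: "traj x t (chart_inv \<kappa> (\<Phi> (coords \<kappa> x) t))" if x: "x \<in> W" and t: "\<bar>t\<bar> < e" for x t
  proof -
    define c where "c = \<Phi> (coords \<kappa> x)"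
    have x': "coords \<kappa> x \<in> ball (coords \<kappa> p0) r" using x by (auto simp: W_def)
    have "integral_curve (chart_inv \<kappa> \<circ> c) {-e<..<e}"
      unfolding integral_curve_def
    proof
      fix s assume s: "s \<in> {-e<..<e}"
      then have cU: "c s \<in> U" using \<Phi>U[OF x'] by (auto simp: c_def)
      have c: "(c has_vector_derivative X (chart_inv \<kappa> (c s)) \<kappa>) (at s)"
        using \<Phi>[OF x', of s] s at_within_Icc_at[of "-e" s e] by (auto simp: c_def)
      have cont: "isCont c s" using c has_vector_derivative_continuous by blast
      show "has_velocity A (chart_inv \<kappa> \<circ> c) s (X ((chart_inv \<kappa> \<circ> c) s))"
      proof (rule velocity_chartI[OF _ X_tangent \<kappa>(1)])
        show "isCont (chart_inv \<kappa> \<circ> c) s"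
          unfolding o_def by (rule isCont_o2[OF cont isCont_chart_inv[OF \<kappa>(1)]]) (use cU in \<open>simp add: U_def\<close>)
        show "(chart_inv \<kappa> \<circ> c) s \<in> chart_dom \<kappa>"
          using cU chart_inv_in_dom by (simp add: U_def)
        have "\<forall>\<^sub>F u in nhds s. c u \<in> U"
          using cont cU open_chart_image[OF \<kappa>(1)] by (intro isCont_eventually_in) (auto simp: U_def)
        then have "\<forall>\<^sub>F u in nhds s. (coords \<kappa> \<circ> (chart_inv \<kappa> \<circ> c)) u = c u"
          by eventually_elim (use \<kappa> in \<open>simp add: U_def\<close>)
        then show "((coords \<kappa> \<circ> (chart_inv \<kappa> \<circ> c)) has_vector_derivative X ((chart_inv \<kappa> \<circ> c) s) \<kappa>) (at s)"
          using has_derivative_eventually_cong[OF c[unfolded has_vector_derivative_def]]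
          by (simp add: has_vector_derivative_def)
      qed
    qed
    have "- e < t" "t < e" using t by linarith+
    with trajI[OF _ _ _ _ \<open>integral_curve _ _\<close>, of 0 t] show ?thesis
      using e x \<Phi>0[OF x'] \<kappa> by (auto simp: c_def W_def)
  qed
  have "regular t x" if x: "x \<in> W" and t: "\<bar>t\<bar> < e" for x t
    unfolding regular_def
  proof
    have flow: "flow A X t y = chart_inv \<kappa> (\<Phi> (coords \<kappa> y) t)" if "y \<in> W" for y
      by (rule flow_traj[OF traj[OF that t]])
    have inW: "\<forall>\<^sub>F y in nhds x. y \<in> W" using W(1) x by (rule eventually_nhds_in_open)
    then show "\<forall>\<^sub>F x in nhds x. traj x t (flow A X t x)"
      by eventually_elim (use traj[OF _ t] flow in auto)
    have x': "x \<in> chart_dom \<kappa>" "coords \<kappa> x \<in> ball (coords \<kappa> p0) r" using x by (auto simp: W_def)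
    have t': "t \<in> {-e..e}" using t by auto
    obtain D where D: "((\<lambda>y. \<Phi> y t) has_derivative D) (at (coords \<kappa> x))"
      using \<Phi>diff[OF x'(2) t'] unfolding differentiable_def by blast
    have "isCont (\<lambda>y. \<Phi> (coords \<kappa> y) t) x"
      by (rule isCont_o2[OF isCont_coords[OF \<kappa>(1) x'(1)]]) (rule has_derivative_continuous[OF D])
    then have "isCont (\<lambda>y. chart_inv \<kappa> (\<Phi> (coords \<kappa> y) t)) x"
      by (rule isCont_o2) (use \<Phi>U[OF x'(2) t'] in \<open>auto intro: isCont_chart_inv[OF \<kappa>(1)] simp: U_def\<close>)
    moreover have ev: "\<forall>\<^sub>F y in nhds x. flow A X t y = chart_inv \<kappa> (\<Phi> (coords \<kappa> y) t)"
      using inW by eventually_elim (rule flow)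
    ultimately have cont: "isCont (flow A X t) x" unfolding isCont_cong[OF ev] by simp
    have "\<forall>\<^sub>F y in nhds (coords \<kappa> x). (coords \<kappa> \<circ> flow A X t \<circ> chart_inv \<kappa>) y = \<Phi> y t"
    proof -
      have "\<forall>\<^sub>F y in nhds (coords \<kappa> x). y \<in> ball (coords \<kappa> p0) r" "\<forall>\<^sub>F y in nhds (coords \<kappa> x). y \<in> U"
        using eventually_nhds_in_open[OF open_ball x'(2)] eventually_nhds_in_open[OF open_chart_image[OF \<kappa>(1)]] x'(1)
        by (simp_all add: U_def del: mem_ball)
      moreover have "\<forall>\<^sub>F y in nhds (coords \<kappa> x). chart_inv \<kappa> y \<in> W"
        by (rule eventually_chart_inv[OF \<kappa>(1) x'(1) inW])
      ultimately show ?thesis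
        by eventually_elim (use \<Phi>U[OF _ t'] \<kappa> flow in \<open>auto simp: U_def\<close>)
    qed
    from has_derivative_eventually_cong[OF D this]
    have "map_deriv (flow A X t) x \<kappa> \<kappa> D"
      using \<kappa> x' cont flow[OF x] chart_inv_in_dom[of "\<Phi> (coords \<kappa> x) t" \<kappa>] \<Phi>U[OF x'(2) t']
      by (simp add: map_deriv_def U_def o_def)
    then show "\<exists>\<kappa> \<kappa>' D. map_deriv (flow A X t) x \<kappa> \<kappa>' D" by blast
  qed
  then show thesis using that e(1) W by blast
qed

lemma regular_add:
  assumes s: "regular s p" and t: "regular t (flow A X s p)"
  shows "regular (s + t) p"
proof -
  obtain \<kappa> \<kappa>' D where D: "map_deriv (flow A X s) p \<kappa> \<kappa>' D" using s by (auto simp: regular_def)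
  obtain \<kappa>2 \<kappa>3 E where E: "map_deriv (flow A X t) (flow A X s p) \<kappa>2 \<kappa>3 E" using t by (auto simp: regular_def)
  have "map_deriv (flow A X t) (flow A X s p) \<kappa>' \<kappa>3 (E \<circ> transition (flow A X s p) \<kappa>' \<kappa>2)"
    using D by (intro map_deriv_change_source[OF E]) (auto simp: map_deriv_def)
  note comp = map_deriv_comp[OF D this]
  obtain V where V: "open V" "flow A X s p \<in> V" "\<And>x. x \<in> V \<Longrightarrow> traj x t (flow A X t x)"
    using t by (auto simp: regular_def eventually_nhds)
  have "\<forall>\<^sub>F x in nhds p. flow A X s x \<in> V"
    using D V by (intro isCont_eventually_in) (auto simp: map_deriv_def)
  moreover have "\<forall>\<^sub>F x in nhds p. traj x s (flow A X s x)" using s by (simp add: regular_def)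
  ultimately have ev: "\<forall>\<^sub>F x in nhds p. traj x (s + t) ((flow A X t \<circ> flow A X s) x)"
    by eventually_elim (use V(3) traj_trans in auto)
  then have "\<forall>\<^sub>F x in nhds p. flow A X (s + t) x = (flow A X t \<circ> flow A X s) x"
    by eventually_elim (rule flow_traj)
  from map_deriv_cong[OF comp this]
  have "map_deriv (flow A X (s + t)) p \<kappa> \<kappa>3 (E \<circ> transition (flow A X s p) \<kappa>' \<kappa>2 \<circ> D)" .
  moreover have "\<forall>\<^sub>F x in nhds p. traj x (s + t) (flow A X (s + t) x)"
    using ev by eventually_elim (simp add: flow_traj)
  ultimately show ?thesis unfolding regular_def by blast
qed

text \<open>Along a complete orbit, regularity at time \<open>t\<close> is a locally constant condition on \<open>t\<close>, because
  short-time flows are regular near every point of the orbit.\<close>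

lemma regular_along_curve:
  assumes v: "integral_curve v UNIV"
  shows "regular t (v 0)"
proof (rule connected_induction_simple[of UNIV 0 t "\<lambda>t. regular t (v 0)"])
  show "regular 0 (v 0)" using regular_locally[of "v 0"] by (metis abs_zero)
  fix a :: real
  obtain e W where e: "e > 0" and W: "open W" "v a \<in> W" "\<And>x t. x \<in> W \<Longrightarrow> \<bar>t\<bar> < e \<Longrightarrow> regular t x"
    using regular_locally[of "v a"] by metis
  have "\<forall>\<^sub>F s in nhds a. v s \<in> W"
    using W integral_curve_isCont[OF v] by (intro isCont_eventually_in) auto
  moreover have "\<forall>\<^sub>F s in nhds a. s \<in> ball a (e / 2)"
    using e by (intro eventually_nhds_in_open) auto
  ultimately have "\<forall>\<^sub>F s in nhds a. v s \<in> W \<and> s \<in> ball a (e / 2)" by eventually_elim auto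
  then obtain T where T: "open T" "a \<in> T" "\<And>s. s \<in> T \<Longrightarrow> v s \<in> W \<and> s \<in> ball a (e / 2)"
    by (auto simp: eventually_nhds)
  have const: "regular y (v 0)" if xy: "x \<in> T" "y \<in> T" and x: "regular x (v 0)" for x y
  proof -
    have "flow A X x (v 0) = v x"
      using trajI[of UNIV 0 x v] v by (intro flow_traj) auto
    moreover have "\<bar>y - x\<bar> < e"
      using T(3)[OF xy(1)] T(3)[OF xy(2)] unfolding mem_ball dist_real_def by linarith
    then have "regular (y - x) (v x)" using T(3)[OF xy(1)] W(3) by blast
    ultimately have "regular (x + (y - x)) (v 0)" using x by (intro regular_add) auto
    then show ?thesis by simp
  qed
  have "openin (top_of_set UNIV) T" using T(1) by simp
  with T(2) const show "\<exists>T. openin (top_of_set UNIV) T \<and> a \<in> T \<and> (\<forall>x\<in>T. \<forall>y\<in>T. regular x (v 0) \<longrightarrow> regular y (v 0))"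
    by blast
qed simp_all

end

section \<open>The Hamiltonian vector field\<close>

text \<open>A symplectic form and a smooth function on a manifold that is modelled on \<open>real ^ 'n\<close>.\<close>

locale hamiltonian_system = atlas A for A :: "('a::t2_space, real ^ 'n) chart set" +
  fixes \<omega> :: "'a \<Rightarrow> ('a, real ^ 'n) tvec \<Rightarrow> ('a, real ^ 'n) tvec \<Rightarrow> real" and H :: "'a \<Rightarrow> real"
  assumes symplectic: "symplectic_form A \<omega>" and smooth_H: "smooth_function A H"
begin

abbreviation ham :: "'a \<Rightarrow> ('a, real ^ 'n) tvec" where "ham \<equiv> ham_field A \<omega> H"

lemma form_comb_left:
  assumes "X \<in> tangent_space A p" "Y \<in> tangent_space A p" "Z \<in> tangent_space A p"
  shows "\<omega> p (a *\<^sub>R X + b *\<^sub>R Y) Z = a * \<omega> p X Z + b * \<omega> p Y Z"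
proof -
  have "two_form A \<omega>" using symplectic by (simp add: symplectic_form_def)
  from this[unfolded two_form_def, THEN conjunct1, rule_format, OF assms] show ?thesis .
qed

lemma form_antisym:
  assumes "X \<in> tangent_space A p" "Y \<in> tangent_space A p"
  shows "\<omega> p Y X = - \<omega> p X Y"
proof -
  have "two_form A \<omega>" using symplectic by (simp add: symplectic_form_def)
  from this[unfolded two_form_def, THEN conjunct2, THEN conjunct1, rule_format, OF assms] show ?thesis .
qed

lemma form_nondegenerate:
  assumes X: "X \<in> tangent_space A p" and "\<And>Y. Y \<in> tangent_space A p \<Longrightarrow> \<omega> p Y X = 0"
  shows "X = 0"
proof -
  have "\<omega> p X Y = 0" if "Y \<in> tangent_space A p" for Y
    using assms(2)[OF that] form_antisym[OF that X] by simp
  then show ?thesis using symplectic X unfolding symplectic_form_def by blast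
qed

lemma form_coordinates:
  assumes \<kappa>: "\<kappa> \<in> A" "p \<in> chart_dom \<kappa>"
  shows "\<omega> p (tangent_of A \<kappa> p u) (tangent_of A \<kappa> p w) =
    (\<Sum>i\<in>UNIV. u $ i * (\<Sum>j\<in>UNIV. w $ j * \<omega> p (tangent_of A \<kappa> p (axis i 1)) (tangent_of A \<kappa> p (axis j 1))))"
proof -
  have lin: "linear (\<lambda>u. \<omega> p (tangent_of A \<kappa> p u) Z)" if Z: "Z \<in> tangent_space A p" for Z
  proof (rule linearI)
    note comb = form_comb_left[OF tangent_of_in[OF \<kappa>] tangent_of_in[OF \<kappa>] Z]
    show "\<omega> p (tangent_of A \<kappa> p (x + y)) Z = \<omega> p (tangent_of A \<kappa> p x) Z + \<omega> p (tangent_of A \<kappa> p y) Z" for x y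
      using comb[of 1 x 1 y] tangent_of_comb[OF \<kappa>, of 1 x 1 y] by simp
    show "\<omega> p (tangent_of A \<kappa> p (c *\<^sub>R x)) Z = c *\<^sub>R \<omega> p (tangent_of A \<kappa> p x) Z" for c x
      using comb[of c x 0 x] tangent_of_comb[OF \<kappa>, of c x 0 x] by simp
  qed
  have expand: "f u = (\<Sum>i\<in>UNIV. u $ i * f (axis i 1))" if "linear f" for f :: "real ^ 'n \<Rightarrow> real" and u
  proof -
    have "f u = f (\<Sum>i\<in>UNIV. u $ i *\<^sub>R axis i 1)"
      using basis_expansion[of u] by (simp add: scalar_mult_eq_scaleR)
    then show ?thesis using that by (simp add: linear_sum linear_scale)
  qed
  have "\<omega> p (tangent_of A \<kappa> p (axis i 1)) (tangent_of A \<kappa> p w) =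
      (\<Sum>j\<in>UNIV. w $ j * \<omega> p (tangent_of A \<kappa> p (axis i 1)) (tangent_of A \<kappa> p (axis j 1)))" for i
  proof -
    have anti: "\<omega> p (tangent_of A \<kappa> p (axis i 1)) (tangent_of A \<kappa> p u) =
        - \<omega> p (tangent_of A \<kappa> p u) (tangent_of A \<kappa> p (axis i 1))" for u
      by (rule form_antisym[OF tangent_of_in[OF \<kappa>] tangent_of_in[OF \<kappa>]])
    have "\<omega> p (tangent_of A \<kappa> p (axis i 1)) (tangent_of A \<kappa> p w) =
        - (\<Sum>j\<in>UNIV. w $ j * \<omega> p (tangent_of A \<kappa> p (axis j 1)) (tangent_of A \<kappa> p (axis i 1)))"
      using anti[of w] expand[OF lin[OF tangent_of_in[OF \<kappa>]], of w "axis i 1"] by metis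
    also have "\<dots> = (\<Sum>j\<in>UNIV. w $ j * - \<omega> p (tangent_of A \<kappa> p (axis j 1)) (tangent_of A \<kappa> p (axis i 1)))"
      by (simp add: sum_negf)
    also have "\<dots> = (\<Sum>j\<in>UNIV. w $ j * \<omega> p (tangent_of A \<kappa> p (axis i 1)) (tangent_of A \<kappa> p (axis j 1)))"
      by (intro sum.cong refl arg_cong2[where f = "(*)"] anti[symmetric])
    finally show ?thesis .
  qed
  then show ?thesis using expand[OF lin[OF tangent_of_in[OF \<kappa>]], of u w] by simp
qed

text \<open>In a chart, the equation \<open>dH = \<omega>(_, X)\<close> is the linear system \<open>B h = g\<close>, where \<open>B\<close> is the Gram
  matrix of \<open>\<omega>\<close> and \<open>g\<close> is the gradient of \<open>H\<close>. By Cramer's rule its solution is a \<open>C\<close>-1 function of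
  the base point.\<close>

definition gram :: "('a, real ^ 'n) chart \<Rightarrow> real ^ 'n \<Rightarrow> real ^ 'n ^ 'n" where
  "gram \<kappa> x = (\<chi> i j. form_in_chart A \<omega> \<kappa> x (axis i 1) (axis j 1))"

definition grad :: "('a, real ^ 'n) chart \<Rightarrow> real ^ 'n \<Rightarrow> real ^ 'n" where
  "grad \<kappa> x = (\<chi> i. frechet_derivative (H \<circ> chart_inv \<kappa>) (at x) (axis i 1))"

definition ham_coords :: "('a, real ^ 'n) chart \<Rightarrow> real ^ 'n \<Rightarrow> real ^ 'n" where
  "ham_coords \<kappa> x = (\<chi> k. det (\<chi> i j. if j = k then grad \<kappa> x $ i else gram \<kappa> x $ i $ j) / det (gram \<kappa> x))"

lemma form_gram:
  assumes "\<kappa> \<in> A" "p \<in> chart_dom \<kappa>"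
  shows "\<omega> p (tangent_of A \<kappa> p u) (tangent_of A \<kappa> p w) = (\<Sum>i\<in>UNIV. u $ i * (gram \<kappa> (coords \<kappa> p) *v w) $ i)"
  unfolding form_coordinates[OF assms, of u w]
  using assms by (simp add: gram_def matrix_vector_mult_def form_in_chart_def mult.commute)

lemma fun_deriv_H:
  assumes "\<kappa> \<in> A" "p \<in> chart_dom \<kappa>"
  shows "fun_deriv H p \<kappa> (frechet_derivative (H \<circ> chart_inv \<kappa>) (at (coords \<kappa> p)))"
  using smooth_function_fun_deriv[OF smooth_H assms] assms
  by (metis fun_deriv_def frechet_derivative_at)

lemma diff_H_grad:
  assumes "\<kappa> \<in> A" "p \<in> chart_dom \<kappa>"
  shows "diff_fun A H p (tangent_of A \<kappa> p u) = (\<Sum>i\<in>UNIV. u $ i * grad \<kappa> (coords \<kappa> p) $ i)"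
proof -
  let ?D = "frechet_derivative (H \<circ> chart_inv \<kappa>) (at (coords \<kappa> p))"
  have "linear ?D" using fun_deriv_H[OF assms] has_derivative_linear by (auto simp: fun_deriv_def)
  moreover have "?D u = ?D (\<Sum>i\<in>UNIV. u $ i *\<^sub>R axis i 1)"
    using basis_expansion[of u] by (simp add: scalar_mult_eq_scaleR)
  ultimately have "?D u = (\<Sum>i\<in>UNIV. u $ i * ?D (axis i 1))" by (simp add: linear_sum linear_scale)
  then show ?thesis
    using diff_fun_eq[OF fun_deriv_H[OF assms] tangent_of_in[OF assms]] assms by (simp add: grad_def)
qed

lemma det_gram_nonzero:
  assumes \<kappa>: "\<kappa> \<in> A" "p \<in> chart_dom \<kappa>"
  shows "det (gram \<kappa> (coords \<kappa> p)) \<noteq> 0"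
proof -
  have "w = 0" if w: "gram \<kappa> (coords \<kappa> p) *v w = 0" for w
  proof -
    have "tangent_of A \<kappa> p w = 0"
    proof (rule form_nondegenerate[OF tangent_of_in[OF \<kappa>]])
      fix Y assume "Y \<in> tangent_space A p"
      then have "Y = tangent_of A \<kappa> p (Y \<kappa>)" using tangent_of_coordinate[OF \<kappa>] by simp
      then show "\<omega> p Y (tangent_of A \<kappa> p w) = 0" using form_gram[OF \<kappa>, of "Y \<kappa>" w] w by simp
    qed
    then have "tangent_of A \<kappa> p w \<kappa> = 0" by simp
    then show "w = 0" using \<kappa> by simp
  qed
  then show ?thesis
    using matrix_left_invertible_ker invertible_left_inverse invertible_det_nz by metis
qed

lemma ham_coords_unique:
  assumes \<kappa>: "\<kappa> \<in> A" "p \<in> chart_dom \<kappa>"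
  shows "gram \<kappa> (coords \<kappa> p) *v h = grad \<kappa> (coords \<kappa> p) \<longleftrightarrow> h = ham_coords \<kappa> (coords \<kappa> p)"
  unfolding ham_coords_def by (rule cramer[OF det_gram_nonzero[OF \<kappa>]])

lemma ham_field_eq:
  assumes \<kappa>: "\<kappa> \<in> A" "p \<in> chart_dom \<kappa>"
  shows "ham p = tangent_of A \<kappa> p (ham_coords \<kappa> (coords \<kappa> p))"
    and "Y \<in> tangent_space A p \<Longrightarrow> diff_fun A H p Y = \<omega> p Y (ham p)"
proof -
  let ?x = "coords \<kappa> p"
  let ?X = "tangent_of A \<kappa> p (ham_coords \<kappa> ?x)"
  have g: "gram \<kappa> ?x *v ham_coords \<kappa> ?x = grad \<kappa> ?x" using ham_coords_unique[OF \<kappa>] by blast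
  have X: "diff_fun A H p Y = \<omega> p Y ?X" if "Y \<in> tangent_space A p" for Y
    using form_gram[OF \<kappa>, of "Y \<kappa>" "ham_coords \<kappa> ?x"] diff_H_grad[OF \<kappa>, of "Y \<kappa>"] g
      tangent_of_coordinate[OF \<kappa> that] by simp
  show eq: "ham p = ?X"
    unfolding ham_field_def
  proof (rule the_equality)
    show "?X \<in> tangent_space A p \<and> (\<forall>Y\<in>tangent_space A p. diff_fun A H p Y = \<omega> p Y ?X)"
      using X tangent_of_in[OF \<kappa>] by blast
    fix Z assume Z: "Z \<in> tangent_space A p \<and> (\<forall>Y\<in>tangent_space A p. diff_fun A H p Y = \<omega> p Y Z)"
    have "(gram \<kappa> ?x *v Z \<kappa>) $ i = grad \<kappa> ?x $ i" for i
      using form_gram[OF \<kappa>, of "axis i 1" "Z \<kappa>"] diff_H_grad[OF \<kappa>, of "axis i 1"] Z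
        tangent_of_coordinate[OF \<kappa>, of Z] tangent_of_in[OF \<kappa>, of "axis i 1"]
      by (simp add: axis_def if_distrib if_distribR cong: if_cong)
    then have "Z \<kappa> = ham_coords \<kappa> ?x" using ham_coords_unique[OF \<kappa>, of "Z \<kappa>"] by (simp add: vec_eq_iff)
    then show "Z = ?X" using tangent_of_coordinate[OF \<kappa>, of Z] Z by simp
  qed
  show "Y \<in> tangent_space A p \<Longrightarrow> diff_fun A H p Y = \<omega> p Y (ham p)" using X eq by simp
qed

lemma ham_tangent: "ham p \<in> tangent_space A p"
  using ham_field_eq(1)[OF chart_at] tangent_of_in[OF chart_at] by metis

lemma diff_H_ham: "Y \<in> tangent_space A p \<Longrightarrow> diff_fun A H p Y = \<omega> p Y (ham p)"
  by (rule ham_field_eq(2)[OF chart_at])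

lemma ham_unique:
  assumes "Z \<in> tangent_space A p" "\<And>Y. Y \<in> tangent_space A p \<Longrightarrow> diff_fun A H p Y = \<omega> p Y Z"
  shows "ham p = Z"
proof -
  have "1 *\<^sub>R ham p + (-1) *\<^sub>R Z = 0"
  proof (rule form_nondegenerate[OF tangent_space_comb[OF ham_tangent assms(1)]])
    fix Y assume Y: "Y \<in> tangent_space A p"
    have "\<omega> p Y (1 *\<^sub>R ham p + (-1) *\<^sub>R Z) = - \<omega> p (1 *\<^sub>R ham p + (-1) *\<^sub>R Z) Y"
      by (rule form_antisym[OF tangent_space_comb[OF ham_tangent assms(1)] Y])
    also have "\<dots> = - (\<omega> p (ham p) Y - \<omega> p Z Y)"
      using form_comb_left[OF ham_tangent assms(1) Y, of 1 "-1"] by simp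
    also have "\<dots> = \<omega> p Y (ham p) - \<omega> p Y Z"
      using form_antisym[OF ham_tangent Y] form_antisym[OF assms(1) Y] by simp
    also have "\<dots> = 0" using diff_H_ham[OF Y] assms(2)[OF Y] by simp
    finally show "\<omega> p Y (1 *\<^sub>R ham p + (-1) *\<^sub>R Z) = 0" .
  qed
  then show ?thesis by simp
qed

lemma C1_on_grad:
  assumes "\<kappa> \<in> A"
  shows "C1_on (coords \<kappa> ` chart_dom \<kappa>) (\<lambda>x. grad \<kappa> x $ i)"
  using smooth_on_C1_on(2)[OF _ open_chart_image[OF assms], of "H \<circ> chart_inv \<kappa>" "axis i 1"] smooth_H assms
  by (simp add: grad_def smooth_function_def)

lemma C1_on_gram:
  assumes "\<kappa> \<in> A"
  shows "C1_on (coords \<kappa> ` chart_dom \<kappa>) (\<lambda>x. gram \<kappa> x $ i $ j)"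
proof -
  have "smooth_on (coords \<kappa> ` chart_dom \<kappa>) (\<lambda>x. form_in_chart A \<omega> \<kappa> x (axis i 1) (axis j 1))"
    using symplectic assms by (simp add: symplectic_form_def two_form_def)
  from smooth_on_C1_on(1)[OF this open_chart_image[OF assms]] show ?thesis by (simp add: gram_def)
qed

lemma C1_on_ham:
  assumes \<kappa>: "\<kappa> \<in> A"
  shows "C1_on (coords \<kappa> ` chart_dom \<kappa>) (\<lambda>x. ham (chart_inv \<kappa> x) \<kappa>)"
proof (rule C1_on_cong[OF _ open_chart_image[OF \<kappa>]])
  let ?U = "coords \<kappa> ` chart_dom \<kappa>"
  have "C1_on ?U (\<lambda>x. if j = k then grad \<kappa> x $ i else gram \<kappa> x $ i $ j)" for i j k
    by (cases "j = k") (auto intro: C1_on_grad[OF \<kappa>] C1_on_gram[OF \<kappa>])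
  then have num: "C1_on ?U (\<lambda>x. det (\<chi> i j. if j = k then grad \<kappa> x $ i else gram \<kappa> x $ i $ j))" for k
    by (rule C1_on_det)
  have "C1_on ?U (\<lambda>x. det (\<chi> i j. gram \<kappa> x $ i $ j))" by (rule C1_on_det[OF C1_on_gram[OF \<kappa>]])
  then have "C1_on ?U (\<lambda>x. det (gram \<kappa> x))" by simp
  then have "C1_on ?U (\<lambda>x. inverse (det (gram \<kappa> x)))"
    by (rule C1_on_inverse) (use det_gram_nonzero[OF \<kappa>] in auto)
  from C1_on_mult[OF num this] show "C1_on ?U (ham_coords \<kappa>)"
    unfolding ham_coords_def[abs_def] divide_inverse by (rule C1_on_vec)
  fix x assume "x \<in> ?U"
  then show "ham (chart_inv \<kappa> x) \<kappa> = ham_coords \<kappa> x"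
    using ham_field_eq(1)[OF \<kappa> chart_inv_in_dom] tangent_of_apply[OF \<kappa> chart_inv_in_dom] \<kappa> by simp
qed

sublocale C1_vector_field A "ham_field A \<omega> H"
  by unfold_locales (rule ham_tangent, rule C1_on_ham)

lemma form_self: "Y \<in> tangent_space A p \<Longrightarrow> \<omega> p Y Y = 0"
  using form_antisym[of Y p Y] by simp

lemma traj_conserves_H:
  assumes "traj p t q"
  shows "H q = H p"
proof -
  obtain \<gamma> I where \<gamma>: "open I" "is_interval I" "0 \<in> I" "t \<in> I" "\<gamma> 0 = p" "integral_curve \<gamma> I" "\<gamma> t = q"
    using assms unfolding traj_def by blast
  have "((H \<circ> \<gamma>) has_vector_derivative 0) (at s within I)" if "s \<in> I" for s
  proof -
    have v: "has_velocity A \<gamma> s (ham (\<gamma> s))" using \<gamma>(6) that by (simp add: integral_curve_def)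
    have "diff_fun A H (\<gamma> s) (ham (\<gamma> s)) = 0"
      using diff_H_ham[OF ham_tangent] form_self[OF ham_tangent] by simp
    then show ?thesis
      using velocity_fun[OF v fun_deriv_H[OF chart_at]] has_vector_derivative_at_within by metis
  qed
  then obtain c where "\<And>s. s \<in> I \<Longrightarrow> (H \<circ> \<gamma>) s = c"
    using has_vector_derivative_zero_constant[of I "H \<circ> \<gamma>"] is_interval_convex[OF \<gamma>(2)] by metis
  then show ?thesis using \<gamma> by (metis comp_apply)
qed

lemma involution_map_deriv:
  assumes "antisymplectic_involution A \<omega> \<rho>"
  obtains D where "map_deriv \<rho> p (chart_at A p) (chart_at A (\<rho> p)) D"
proof -
  have "smooth_self_map A \<rho>"
    using assms by (simp add: antisymplectic_involution_def diffeomorphism_def)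
  from smooth_self_map_deriv[OF this chart_at(1) chart_at(1) chart_at(2) chart_at(2)] that show thesis by blast
qed

lemma diff_map_involution:
  assumes \<rho>: "antisymplectic_involution A \<omega> \<rho>" and Y: "Y \<in> tangent_space A p"
  shows "diff_map A \<rho> p Y \<in> tangent_space A (\<rho> p)" "diff_map A \<rho> (\<rho> p) (diff_map A \<rho> p Y) = Y"
proof -
  obtain D where D: "map_deriv \<rho> p (chart_at A p) (chart_at A (\<rho> p)) D"
    using involution_map_deriv[OF \<rho>] by blast
  obtain E where E: "map_deriv \<rho> (\<rho> p) (chart_at A (\<rho> p)) (chart_at A (\<rho> (\<rho> p))) E"
    using involution_map_deriv[OF \<rho>] by blast
  show "diff_map A \<rho> p Y \<in> tangent_space A (\<rho> p)" by (rule diff_map_in[OF D Y])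
  have "\<rho> \<circ> \<rho> = id" using \<rho> by (simp add: antisymplectic_involution_def)
  then show "diff_map A \<rho> (\<rho> p) (diff_map A \<rho> p Y) = Y"
    using diff_map_comp[OF D E Y] diff_map_id[OF Y] by simp
qed

text \<open>An antisymplectic symmetry of \<open>H\<close> reverses the Hamiltonian vector field, hence time.\<close>

lemma involution_ham:
  assumes \<rho>: "antisymplectic_involution A \<omega> \<rho>" and inv: "H \<circ> \<rho> = H"
  shows "diff_map A \<rho> p (ham p) = - ham (\<rho> p)"
proof -
  have \<rho>\<rho>: "\<rho> (\<rho> p) = p"
    using \<rho> by (simp add: antisymplectic_involution_def) (metis comp_apply id_apply)
  define Z where "Z = diff_map A \<rho> p (ham p)"
  have Z: "Z \<in> tangent_space A (\<rho> p)" unfolding Z_def by (rule diff_map_involution(1)[OF \<rho> ham_tangent])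
  have mZ: "- Z \<in> tangent_space A (\<rho> p)" using subspace_neg[OF subspace_tangent_space Z] .
  have "ham (\<rho> p) = - Z"
  proof (rule ham_unique[OF mZ])
    fix Y assume Y: "Y \<in> tangent_space A (\<rho> p)"
    define Y' where "Y' = diff_map A \<rho> (\<rho> p) Y"
    have Y': "Y' \<in> tangent_space A p" "diff_map A \<rho> p Y' = Y"
      using diff_map_involution[OF \<rho> Y] \<rho>\<rho> by (simp_all add: Y'_def)
    obtain D where D: "map_deriv \<rho> p (chart_at A p) (chart_at A (\<rho> p)) D"
      using involution_map_deriv[OF \<rho>] by blast
    have "diff_fun A H (\<rho> p) Y = diff_fun A H p Y'"
      using diff_fun_comp[OF D fun_deriv_H[OF chart_at] Y'(1)] inv Y'(2) by simp
    also have "\<dots> = \<omega> p Y' (ham p)" by (rule diff_H_ham[OF Y'(1)])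
    also have "\<dots> = - \<omega> (\<rho> p) Y Z"
      using \<rho> Y' ham_tangent[of p] unfolding antisymplectic_involution_def Z_def by fastforce
    also have "\<dots> = \<omega> (\<rho> p) Z Y" using form_antisym[OF Y Z] by simp
    also have "\<dots> = - \<omega> (\<rho> p) (- Z) Y" using form_comb_left[OF Z Z Y, of "-1" 0] by simp
    also have "\<dots> = \<omega> (\<rho> p) Y (- Z)" using form_antisym[OF mZ Y] by simp
    finally show "diff_fun A H (\<rho> p) Y = \<omega> (\<rho> p) Y (- Z)" .
  qed
  then show ?thesis by (simp add: Z_def)
qed

lemma traj_involution:
  assumes \<rho>: "antisymplectic_involution A \<omega> \<rho>" and inv: "H \<circ> \<rho> = H" and t: "traj p t q"
  shows "traj (\<rho> p) (- t) (\<rho> q)"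
proof -
  obtain \<gamma> I where \<gamma>: "open I" "is_interval I" "0 \<in> I" "t \<in> I" "\<gamma> 0 = p" "integral_curve \<gamma> I" "\<gamma> t = q"
    using t unfolding traj_def by blast
  have "integral_curve (\<lambda>s. (\<rho> \<circ> \<gamma>) (- 1 * s + 0)) (uminus ` I)"
    unfolding integral_curve_def
  proof
    fix s assume "s \<in> uminus ` I"
    then have s: "- 1 * s + 0 \<in> I" by auto
    obtain D where D: "map_deriv \<rho> (\<gamma> (- 1 * s + 0)) (chart_at A (\<gamma> (- 1 * s + 0))) (chart_at A (\<rho> (\<gamma> (- 1 * s + 0)))) D"
      using involution_map_deriv[OF \<rho>] by blast
    have v: "has_velocity A \<gamma> (- 1 * s + 0) (ham (\<gamma> (- 1 * s + 0)))"
      using \<gamma>(6) s unfolding integral_curve_def by blast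
    from velocity_affine_reparam[OF velocity_diff_map[OF v D]]
    show "has_velocity A (\<lambda>s. (\<rho> \<circ> \<gamma>) (- 1 * s + 0)) s (ham ((\<rho> \<circ> \<gamma>) (- 1 * s + 0)))"
      by (simp add: involution_ham[OF \<rho> inv])
  qed
  from trajI[OF _ _ _ _ this, of 0 "- t"] show ?thesis
    using \<gamma> open_negations[OF \<gamma>(1)] by (auto simp: image_iff)
qed

end

section \<open>The trace of a product of involutions of a quotient plane\<close>

text \<open>A three-dimensional space \<open>V\<close> with basis \<open>e, f, x\<close>, to be divided by the line through \<open>x\<close>.\<close>

locale plane_quotient =
  fixes V :: "'v::real_vector set" and e f x :: 'v
  assumes V_eq: "V = {a *\<^sub>R e + b *\<^sub>R f + n *\<^sub>R x | a b n. True}"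
    and independent: "\<And>a b n. a *\<^sub>R e + b *\<^sub>R f + n *\<^sub>R x = 0 \<Longrightarrow> a = 0 \<and> b = 0 \<and> n = 0"
begin

text \<open>The coset with coordinates \<open>a, b\<close> with respect to the classes of \<open>e\<close> and \<open>f\<close>.\<close>

definition coset :: "real \<Rightarrow> real \<Rightarrow> 'v set" where
  "coset a b = range (\<lambda>n. a *\<^sub>R e + b *\<^sub>R f + n *\<^sub>R x)"

lemma coset_eq: "(+) (a *\<^sub>R e + b *\<^sub>R f + n *\<^sub>R x) ` span {x} = coset a b"
proof -
  have "(+) (a *\<^sub>R e + b *\<^sub>R f + n *\<^sub>R x) ` span {x} = (\<lambda>m. a *\<^sub>R e + b *\<^sub>R f + (n + m) *\<^sub>R x) ` UNIV"
    by (simp add: span_singleton image_image algebra_simps)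
  also have "\<dots> = (\<lambda>n. a *\<^sub>R e + b *\<^sub>R f + n *\<^sub>R x) ` ((+) n ` UNIV)" by (simp only: image_image)
  finally show ?thesis by (simp add: coset_def)
qed

lemma quotient_space_eq: "quotient_space V (span {x}) = {coset a b | a b. True}"
  unfolding quotient_space_def V_eq using coset_eq by (force simp: image_iff)

lemma coset_subset: "coset a b \<subseteq> V"
  unfolding coset_def V_eq by blast

lemma coset_inject: "coset a b = coset c d \<longleftrightarrow> a = c \<and> b = d"
proof
  assume "coset a b = coset c d"
  moreover have "a *\<^sub>R e + b *\<^sub>R f + 0 *\<^sub>R x \<in> coset a b" unfolding coset_def by blast
  ultimately obtain n where "a *\<^sub>R e + b *\<^sub>R f + 0 *\<^sub>R x = c *\<^sub>R e + d *\<^sub>R f + n *\<^sub>R x"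
    unfolding coset_def by blast
  then have "(a - c) *\<^sub>R e + (b - d) *\<^sub>R f + (- n) *\<^sub>R x = 0" by (simp add: algebra_simps)
  from independent[OF this] show "a = c \<and> b = d" by simp
qed simp

lemma coset_comb_coset: "coset_comb (span {x}) s (coset a b) t (coset c d) = coset (s * a + t * c) (s * b + t * d)"
proof (intro equalityI subsetI)
  fix y assume "y \<in> coset_comb (span {x}) s (coset a b) t (coset c d)"
  then obtain k l m where "y = s *\<^sub>R (a *\<^sub>R e + b *\<^sub>R f + k *\<^sub>R x) + t *\<^sub>R (c *\<^sub>R e + d *\<^sub>R f + l *\<^sub>R x) + m *\<^sub>R x"
    unfolding coset_comb_def coset_def span_singleton by blast
  then have "y = (s * a + t * c) *\<^sub>R e + (s * b + t * d) *\<^sub>R f + (s * k + t * l + m) *\<^sub>R x"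
    by (simp add: algebra_simps)
  then show "y \<in> coset (s * a + t * c) (s * b + t * d)" unfolding coset_def by blast
next
  fix y assume "y \<in> coset (s * a + t * c) (s * b + t * d)"
  then obtain m where "y = (s * a + t * c) *\<^sub>R e + (s * b + t * d) *\<^sub>R f + m *\<^sub>R x"
    unfolding coset_def by blast
  then have "y = s *\<^sub>R (a *\<^sub>R e + b *\<^sub>R f + 0 *\<^sub>R x) + t *\<^sub>R (c *\<^sub>R e + d *\<^sub>R f + 0 *\<^sub>R x) + m *\<^sub>R x"
    by (simp add: algebra_simps)
  then show "y \<in> coset_comb (span {x}) s (coset a b) t (coset c d)"
    unfolding coset_comb_def coset_def span_singleton by blast
qed

lemma quotient_basis_det:
  assumes "quotient_basis V (span {x}) (coset a b) (coset c d)"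
  shows "a * d - b * c \<noteq> 0"
proof
  assume det: "a * d - b * c = 0"
  have "coset 0 0 \<in> quotient_space V (span {x})" unfolding quotient_space_eq by blast
  with assms have "\<exists>!z. coset 0 0 = coset_comb (span {x}) (fst z) (coset a b) (snd z) (coset c d)"
    by (simp add: quotient_basis_def)
  then obtain z where "\<And>z'. coset 0 0 = coset_comb (span {x}) (fst z') (coset a b) (snd z') (coset c d) \<Longrightarrow> z' = z"
    by (elim ex1E) blast
  from this[of "(_, _)"] have z: "s * a + t * c = 0 \<Longrightarrow> s * b + t * d = 0 \<Longrightarrow> (s, t) = z" for s t
    by (simp add: coset_comb_coset coset_inject)
  have z0: "z = (0, 0)" using z[of 0 0] by simp
  have "d = 0" "b = 0" using z[of d "- b"] det z0 by (simp_all add: algebra_simps)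
  moreover have "c = 0" "a = 0" using z[of c "- a"] det z0 by (simp_all add: algebra_simps)
  ultimately show False using z[of 1 0] z0 by simp
qed

lemma quotient_trace_matrix:
  assumes T: "\<And>a b. T (coset a b) = coset (t11 * a + t12 * b) (t21 * a + t22 * b)"
  shows "quotient_trace V (span {x}) T = t11 + t22"
  unfolding quotient_trace_def
proof (rule the_equality)
  have "quotient_basis V (span {x}) (coset 1 0) (coset 0 1)"
    unfolding quotient_basis_def quotient_space_eq by (auto simp: coset_comb_coset coset_inject)
  moreover have "T (coset 1 0) = coset_comb (span {x}) t11 (coset 1 0) t21 (coset 0 1)"
    "T (coset 0 1) = coset_comb (span {x}) t12 (coset 1 0) t22 (coset 0 1)"
    by (simp_all add: T coset_comb_coset)
  ultimately show "\<exists>E F a b c d. quotient_basis V (span {x}) E F \<and> T E = coset_comb (span {x}) a E c F \<and>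
      T F = coset_comb (span {x}) b E d F \<and> t11 + t22 = a + d"
    by blast
  fix s assume "\<exists>E F a b c d. quotient_basis V (span {x}) E F \<and> T E = coset_comb (span {x}) a E c F \<and>
      T F = coset_comb (span {x}) b E d F \<and> s = a + d"
  then obtain E F \<alpha> \<beta> \<gamma> \<delta> where EF: "quotient_basis V (span {x}) E F"
    and TE: "T E = coset_comb (span {x}) \<alpha> E \<gamma> F" and TF: "T F = coset_comb (span {x}) \<beta> E \<delta> F"
    and s: "s = \<alpha> + \<delta>" by blast
  have "E \<in> quotient_space V (span {x})" "F \<in> quotient_space V (span {x})"
    using EF by (simp_all add: quotient_basis_def)
  then obtain a b c d where E: "E = coset a b" and F: "F = coset c d"
    by (auto simp: quotient_space_eq)
  have det: "a * d - b * c \<noteq> 0" using EF unfolding E F by (rule quotient_basis_det)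
  have 1: "t11 * a + t12 * b = \<alpha> * a + \<gamma> * c" "t21 * a + t22 * b = \<alpha> * b + \<gamma> * d"
    using TE unfolding E F T coset_comb_coset coset_inject by auto
  have 2: "t11 * c + t12 * d = \<beta> * a + \<delta> * c" "t21 * c + t22 * d = \<beta> * b + \<delta> * d"
    using TF unfolding E F T coset_comb_coset coset_inject by auto
  have "(\<alpha> + \<delta>) * (a * d - b * c) =
      (\<alpha> * a + \<gamma> * c) * d - (\<alpha> * b + \<gamma> * d) * c + a * (\<beta> * b + \<delta> * d) - b * (\<beta> * a + \<delta> * c)"
    by algebra
  also have "\<dots> = (t11 + t22) * (a * d - b * c)" unfolding 1[symmetric] 2[symmetric] by algebra
  finally show "s = t11 + t22" using det s by simp
qed

lemma image_coset:
  assumes L: "\<And>Y. Y \<in> V \<Longrightarrow> L Y \<in> V"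
    "\<And>a b Y Z. Y \<in> V \<Longrightarrow> Z \<in> V \<Longrightarrow> L (a *\<^sub>R Y + b *\<^sub>R Z) = a *\<^sub>R L Y + b *\<^sub>R L Z"
    and x: "L x = - x"
  obtains l11 l12 l21 l22 where "\<And>a b. L ` coset a b = coset (l11 * a + l12 * b) (l21 * a + l22 * b)"
proof -
  have in_V: "a *\<^sub>R e + b *\<^sub>R f + n *\<^sub>R x \<in> V" for a b n unfolding V_eq by blast
  have eV: "e \<in> V" "f \<in> V" "x \<in> V" using in_V[of 1 0 0] in_V[of 0 1 0] in_V[of 0 0 1] by simp_all
  obtain l11 l21 k where Le: "L e = l11 *\<^sub>R e + l21 *\<^sub>R f + k *\<^sub>R x" using L(1)[OF eV(1)] unfolding V_eq by blast
  obtain l12 l22 m where Lf: "L f = l12 *\<^sub>R e + l22 *\<^sub>R f + m *\<^sub>R x" using L(1)[OF eV(2)] unfolding V_eq by blast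
  have "L ` coset a b = coset (l11 * a + l12 * b) (l21 * a + l22 * b)" for a b
  proof -
    have "L (a *\<^sub>R e + b *\<^sub>R f + n *\<^sub>R x) =
        (l11 * a + l12 * b) *\<^sub>R e + (l21 * a + l22 * b) *\<^sub>R f + (a * k + b * m - n) *\<^sub>R x" for n
    proof -
      have "L (1 *\<^sub>R (a *\<^sub>R e + b *\<^sub>R f) + n *\<^sub>R x) = 1 *\<^sub>R L (a *\<^sub>R e + b *\<^sub>R f) + n *\<^sub>R L x"
        using in_V[of a b 0] eV by (intro L(2)) simp_all
      also have "L (a *\<^sub>R e + b *\<^sub>R f) = a *\<^sub>R L e + b *\<^sub>R L f" using eV by (intro L(2))
      finally show ?thesis by (simp add: Le Lf x algebra_simps)
    qed
    note Lcomb = this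
    have "L ` coset a b = (\<lambda>n. L (a *\<^sub>R e + b *\<^sub>R f + n *\<^sub>R x)) ` UNIV"
      by (simp only: coset_def image_image)
    also have "\<dots> = (\<lambda>n. (l11 * a + l12 * b) *\<^sub>R e + (l21 * a + l22 * b) *\<^sub>R f + n *\<^sub>R x) `
        (\<lambda>n. a * k + b * m - n) ` UNIV"
      by (simp only: image_image Lcomb)
    also have "(\<lambda>n. a * k + b * m - n) ` UNIV = UNIV"
      by (rule surjI[of _ "\<lambda>n. a * k + b * m - n"]) simp
    finally show ?thesis by (simp add: coset_def)
  qed
  then show thesis by (rule that)
qed

lemma involution_det:
  assumes inv: "\<And>Y. Y \<in> V \<Longrightarrow> L (L Y) = Y"
    and L: "\<And>a b. L ` coset a b = coset (l11 * a + l12 * b) (l21 * a + l22 * b)"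
  shows "(l11 * l22 - l12 * l21)\<^sup>2 = 1"
proof -
  have "coset (l11 * (l11 * a + l12 * b) + l12 * (l21 * a + l22 * b)) (l21 * (l11 * a + l12 * b) + l22 * (l21 * a + l22 * b)) = coset a b"
    for a b
  proof -
    have "L ` L ` coset a b = coset a b" using inv coset_subset[of a b] by (force simp: image_image image_iff)
    then show ?thesis by (simp only: L)
  qed
  from this[of 1 0] this[of 0 1]
  have "l11 * l11 + l12 * l21 = 1" "l21 * l11 + l22 * l21 = 0" "l11 * l12 + l12 * l22 = 0" "l21 * l12 + l22 * l22 = 1"
    by (simp_all add: coset_inject)
  then show ?thesis unfolding power2_eq_square by algebra
qed

text \<open>The product of two involutions of a plane has determinant \<open>\<delta> = 1\<close> or \<open>\<delta> = -1\<close>, and the square of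
  an endomorphism of a plane with trace \<open>m\<close> and determinant \<open>\<delta>\<close> has trace \<open>m\<^sup>2 - 2 * \<delta>\<close>.\<close>

theorem quotient_trace_two_involutions:
  assumes R: "\<And>Y. Y \<in> V \<Longrightarrow> R Y \<in> V"
      "\<And>a b Y Z. Y \<in> V \<Longrightarrow> Z \<in> V \<Longrightarrow> R (a *\<^sub>R Y + b *\<^sub>R Z) = a *\<^sub>R R Y + b *\<^sub>R R Z"
      "R x = - x" "\<And>Y. Y \<in> V \<Longrightarrow> R (R Y) = Y"
    and S: "\<And>Y. Y \<in> V \<Longrightarrow> S Y \<in> V"
      "\<And>a b Y Z. Y \<in> V \<Longrightarrow> Z \<in> V \<Longrightarrow> S (a *\<^sub>R Y + b *\<^sub>R Z) = a *\<^sub>R S Y + b *\<^sub>R S Z"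
      "S x = - x" "\<And>Y. Y \<in> V \<Longrightarrow> S (S Y) = Y"
    and T: "\<And>C. C \<subseteq> V \<Longrightarrow> T C = R ` S ` R ` S ` C"
  shows "quotient_trace V (span {x}) T \<ge> - 2"
proof -
  obtain r11 r12 r21 r22 where r: "\<And>a b. R ` coset a b = coset (r11 * a + r12 * b) (r21 * a + r22 * b)"
    using image_coset[OF R(1-3)] by metis
  obtain s11 s12 s21 s22 where s: "\<And>a b. S ` coset a b = coset (s11 * a + s12 * b) (s21 * a + s22 * b)"
    using image_coset[OF S(1-3)] by metis
  define m11 m12 m21 m22 where m: "m11 = r11 * s11 + r12 * s21" "m12 = r11 * s12 + r12 * s22"
    "m21 = r21 * s11 + r22 * s21" "m22 = r21 * s12 + r22 * s22"
  have RS: "R ` S ` coset a b = coset (m11 * a + m12 * b) (m21 * a + m22 * b)" for a b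
    unfolding r s m by (simp add: algebra_simps)
  have "T (coset a b) = coset ((m11 * m11 + m12 * m21) * a + (m11 * m12 + m12 * m22) * b)
      ((m21 * m11 + m22 * m21) * a + (m21 * m12 + m22 * m22) * b)" for a b
    unfolding T[OF coset_subset] RS by (simp add: algebra_simps)
  then have tr: "quotient_trace V (span {x}) T = (m11 * m11 + m12 * m21) + (m21 * m12 + m22 * m22)"
    by (rule quotient_trace_matrix)
  have "(m11 * m22 - m12 * m21)\<^sup>2 = (r11 * r22 - r12 * r21)\<^sup>2 * (s11 * s22 - s12 * s21)\<^sup>2"
    unfolding m power2_eq_square by algebra
  also have "\<dots> = 1" using involution_det[OF R(4) r] involution_det[OF S(4) s] by simp
  finally have "m11 * m22 - m12 * m21 \<le> 1" by (simp add: power2_eq_1_iff) linarith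
  moreover have "(m11 * m11 + m12 * m21) + (m21 * m12 + m22 * m22) = (m11 + m22)\<^sup>2 - 2 * (m11 * m22 - m12 * m21)"
    by (simp add: power2_eq_square algebra_simps)
  moreover have "- 2 \<le> (m11 + m22)\<^sup>2 - 2 * \<delta>" if "\<delta> \<le> 1" for \<delta>
    using that zero_le_power2[of "m11 + m22"] by linarith
  ultimately show ?thesis unfolding tr by metis
qed

end

section \<open>The tangent space of an energy level\<close>

lemma kernel_basis:
  fixes D :: "'e::euclidean_space \<Rightarrow> real" and x :: 'e
  assumes dim: "DIM('e) = 4" and D: "linear D" "D w \<noteq> 0" and x: "D x = 0" "x \<noteq> 0"
  obtains e f where "D e = 0" "D f = 0" "\<And>u. D u = 0 \<Longrightarrow> \<exists>a b n. u = a *\<^sub>R e + b *\<^sub>R f + n *\<^sub>R x"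
    and "\<And>a b n. a *\<^sub>R e + b *\<^sub>R f + n *\<^sub>R x = 0 \<Longrightarrow> a = 0 \<and> b = 0 \<and> n = 0"
proof -
  define k where "k = adjoint D 1"
  have k: "D u = k \<bullet> u" for u
    using adjoint_works[OF D(1), of u 1] by (simp add: k_def inner_commute)
  have "k \<noteq> 0" using D(2) k by auto
  then have dim3: "dim {u. D u = 0} = 3" using dim_hyperplane[of k] dim k by simp
  have "independent {x}" using x by simp
  then obtain B where B: "{x} \<subseteq> B" "B \<subseteq> {u. D u = 0}" "independent B" "{u. D u = 0} \<subseteq> span B"
    using maximal_independent_subset_extend[of "{x}" "{u. D u = 0}"] x by blast
  have "card B = 3" using basis_card_eq_dim[OF B(2,4,3)] dim3 by simp
  then have "finite B" "card (B - {x}) = 2" using B(1) by (auto intro: card_ge_0_finite)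
  then obtain e f where ef: "B - {x} = {e, f}" "e \<noteq> f" by (meson card_2_iff)
  then have B': "B = {e, f, x}" "e \<noteq> x" "f \<noteq> x" using B(1) by auto
  show thesis
  proof (rule that[of e f])
    show "D e = 0" "D f = 0" using B(2) B' by auto
    show "\<exists>a b n. u = a *\<^sub>R e + b *\<^sub>R f + n *\<^sub>R x" if "D u = 0" for u
    proof -
      have "u \<in> span {e, f, x}" using that B(4) B'(1) by auto
      then obtain a b n where "u - a *\<^sub>R e - b *\<^sub>R f = n *\<^sub>R x"
        by (auto simp: span_insert span_singleton)
      then have "u = a *\<^sub>R e + b *\<^sub>R f + n *\<^sub>R x" by (simp add: algebra_simps)
      then show ?thesis by blast
    qed
    show "a = 0 \<and> b = 0 \<and> n = 0" if "a *\<^sub>R e + b *\<^sub>R f + n *\<^sub>R x = 0" for a b n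
    proof -
      define c where "c z = (if z = e then a else if z = f then b else n)" for z
      have "(\<Sum>z\<in>B. c z *\<^sub>R z) = 0"
        using that ef(2) B' by (simp add: c_def add.assoc)
      then have "\<forall>z\<in>B. c z = 0"
        using B(3) \<open>finite B\<close> dependent_finite by blast
      then show ?thesis using ef(2) B' by (auto simp: c_def split: if_splits)
    qed
  qed
qed

context hamiltonian_system
begin

lemma dH_nonzero:
  assumes "ham p \<noteq> 0" and D: "fun_deriv H p \<kappa> D"
  obtains w where "D w \<noteq> 0"
proof -
  have "\<exists>w. D w \<noteq> 0"
  proof (rule ccontr)
    assume "\<not> (\<exists>w. D w \<noteq> 0)"
    then have "\<omega> p Y (ham p) = 0" if "Y \<in> tangent_space A p" for Y
      using diff_H_ham[OF that] diff_fun_eq[OF D that] by simp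
    then show False using form_nondegenerate[OF ham_tangent] assms(1) by blast
  qed
  then show thesis using that by blast
qed

text \<open>A nonzero Hamiltonian vector field makes the level set of \<open>H\<close> a hypersurface, whose tangent
  space is the kernel of \<open>dH\<close>. The map \<open>G\<close> in the proof straightens the level set: its derivative at
  the point is the identity, and it takes the level set to the affine hyperplane on which the
  linearization of \<open>H\<close> is constant.\<close>

lemma tangent_space_level:
  assumes nz: "ham p \<noteq> 0"
  shows "tangent_space_sub A (H -` {H p}) p = {Y \<in> tangent_space A p. diff_fun A H p Y = 0}"
proof (intro equalityI subsetI)
  fix Y assume "Y \<in> tangent_space_sub A (H -` {H p}) p"
  then obtain \<gamma> where \<gamma>: "\<And>t. H (\<gamma> t) = H p" "\<gamma> 0 = p" "has_velocity A \<gamma> 0 Y"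
    by (auto simp: tangent_space_sub_def)
  have "((H \<circ> \<gamma>) has_vector_derivative diff_fun A H p Y) (at 0)"
    using velocity_fun[OF \<gamma>(3) fun_deriv_H[OF chart_at]] \<gamma>(2) by simp
  moreover have "H \<circ> \<gamma> = (\<lambda>_. H p)" using \<gamma>(1) by auto
  ultimately have "diff_fun A H p Y = 0"
    by (metis has_vector_derivative_const vector_derivative_unique_at)
  then show "Y \<in> {Y \<in> tangent_space A p. diff_fun A H p Y = 0}"
    using \<gamma> by (simp add: has_velocity_def)
next
  fix Y assume "Y \<in> {Y \<in> tangent_space A p. diff_fun A H p Y = 0}"
  then have Y: "Y \<in> tangent_space A p" "diff_fun A H p Y = 0" by auto
  define \<kappa> where "\<kappa> = chart_at A p"
  have \<kappa>: "\<kappa> \<in> A" "p \<in> chart_dom \<kappa>" unfolding \<kappa>_def by (rule chart_at)+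
  define U where "U = coords \<kappa> ` chart_dom \<kappa>"
  have U: "open U" "coords \<kappa> p \<in> U" using open_chart_image \<kappa> by (auto simp: U_def)
  define x0 where "x0 = coords \<kappa> p"
  define f where "f = H \<circ> chart_inv \<kappa>"
  have "C1_on U f"
    unfolding U_def f_def using smooth_H \<kappa>(1)
    by (intro smooth_on_C1_on(1)[OF _ open_chart_image[OF \<kappa>(1)]]) (simp add: smooth_function_def)
  then obtain F where F: "\<And>x. x \<in> U \<Longrightarrow> (f has_derivative blinfun_apply (F x)) (at x)" "continuous_on U F"
    using C1_on_blinfun by blast
  have fd: "fun_deriv H p \<kappa> (blinfun_apply (F x0))"
    using F(1)[OF U(2)] \<kappa> by (simp add: fun_deriv_def f_def x0_def)
  obtain w' where w': "F x0 w' \<noteq> 0" using dH_nonzero[OF nz fd] by blast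
  define w where "w = (1 / F x0 w') *\<^sub>R w'"
  have w: "F x0 w = 1" using w' by (simp add: w_def blinfun.scaleR_right)
  define G where "G x = x + (f x - f x0 - F x0 (x - x0)) *\<^sub>R w" for x
  define G' where "G' x = id_blinfun + (blinfun_scaleR_left w o\<^sub>L (F x - F x0))" for x
  have G: "(G has_derivative blinfun_apply (G' x)) (at x)" if "x \<in> U" for x
  proof -
    have "(G has_derivative (\<lambda>u. u + (F x u - 0 - F x0 (u - 0)) *\<^sub>R w)) (at x)"
      unfolding G_def using F(1)[OF that]
      by (intro has_derivative_add has_derivative_ident has_derivative_scaleR_left has_derivative_diff
          has_derivative_const bounded_linear.has_derivative[OF blinfun.bounded_linear_right])
    moreover have "blinfun_apply (G' x) = (\<lambda>u. u + (F x u - 0 - F x0 (u - 0)) *\<^sub>R w)"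
      by (simp add: fun_eq_iff G'_def blinfun.add_left blinfun.diff_left)
    ultimately show ?thesis by simp
  qed
  have G'cont: "continuous_on U G'"
    unfolding G'_def by (intro continuous_intros F(2))
  have G'x0: "G' x0 = id_blinfun" by (simp add: G'_def)
  have "id_blinfun o\<^sub>L G' x0 = id_blinfun" by (simp add: G'x0 blinfun_eqI)
  then obtain U' V g g' where inv: "open U'" "U' \<subseteq> U" "x0 \<in> U'" "open V" "G x0 \<in> V" "homeomorphism U' V G g"
    "\<And>y. y \<in> V \<Longrightarrow> (g has_derivative (g' y)) (at y)"
    "\<And>y. y \<in> V \<Longrightarrow> g' y = inv (blinfun_apply (G' (g y)))"
    using inverse_function_theorem[OF U(1) G G'cont] U(2) unfolding x0_def by metis
  have Gx0: "G x0 = x0" by (simp add: G_def)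
  have gx0: "g x0 = x0" using inv(3,6) Gx0 homeomorphism_apply1 by metis
  have "g' x0 = id"
    using inv(8)[of x0] inv(5) Gx0 gx0 G'x0 by (simp add: inv_id[unfolded id_def] id_def)
  then have gder: "(g has_derivative id) (at x0)" using inv(5,7) Gx0 by metis
  define c where "c t = g (x0 + t *\<^sub>R Y \<kappa>)" for t
  \<comment> \<open>The curve must lie in the level set for all times, so it is set to \<open>p\<close> where \<open>g\<close> does not invert \<open>G\<close>.\<close>
  define \<gamma> where "\<gamma> t = (if x0 + t *\<^sub>R Y \<kappa> \<in> V then chart_inv \<kappa> (c t) else p)" for t
  have gV: "g y \<in> U" "G (g y) = y" if "y \<in> V" for y
    using inv(2,6) that by (auto simp: homeomorphism_def)
  have level: "H (\<gamma> t) = H p" for t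
  proof (cases "x0 + t *\<^sub>R Y \<kappa> \<in> V")
    case True
    have "F x0 (Y \<kappa>) = 0" using Y diff_fun_eq[OF fd Y(1)] by simp
    then have "F x0 (G (c t) - x0) = 0"
      using gV(2)[OF True] by (simp add: c_def blinfun.scaleR_right)
    then have "f (c t) = f x0"
      using w by (simp add: G_def blinfun.add_right blinfun.diff_right blinfun.scaleR_right)
    then show ?thesis using True \<kappa> by (simp add: \<gamma>_def f_def x0_def)
  qed (simp add: \<gamma>_def)
  have \<gamma>0: "\<gamma> 0 = p" using inv(5) Gx0 gx0 \<kappa> by (simp add: \<gamma>_def c_def x0_def)
  have line: "((\<lambda>t. x0 + t *\<^sub>R Y \<kappa>) has_derivative (\<lambda>t. t *\<^sub>R Y \<kappa>)) (at 0)"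
    by (auto intro!: derivative_eq_intros)
  have "\<forall>\<^sub>F t in nhds 0. x0 + t *\<^sub>R Y \<kappa> \<in> V"
    using isCont_eventually_in[OF has_derivative_continuous[OF line] inv(4)] inv(5) Gx0 by simp
  then have near: "\<forall>\<^sub>F t in nhds 0. \<gamma> t = (chart_inv \<kappa> \<circ> c) t" "\<forall>\<^sub>F t in nhds 0. (coords \<kappa> \<circ> \<gamma>) t = c t"
    using gV \<kappa> by (auto simp: \<gamma>_def c_def U_def elim: eventually_mono)
  have cder: "(c has_derivative (\<lambda>t. t *\<^sub>R Y \<kappa>)) (at 0)"
    using diff_chain_at[OF line, of g id] gder by (simp add: c_def[abs_def] o_def)
  have "isCont (chart_inv \<kappa> \<circ> c) 0"
    unfolding o_def
    by (rule isCont_o2[OF has_derivative_continuous[OF cder] isCont_chart_inv[OF \<kappa>(1)]])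
       (use U gx0 in \<open>simp add: c_def U_def x0_def\<close>)
  then have "isCont \<gamma> 0" unfolding isCont_cong[OF near(1)] .
  moreover have "((coords \<kappa> \<circ> \<gamma>) has_vector_derivative Y \<kappa>) (at 0)"
    unfolding has_vector_derivative_def by (rule has_derivative_eventually_cong[OF cder near(2)])
  ultimately have "has_velocity A \<gamma> 0 Y"
    using Y \<kappa> \<gamma>0 by (intro velocity_chartI[where \<kappa> = \<kappa>]) auto
  then show "Y \<in> tangent_space_sub A (H -` {H p}) p"
    unfolding tangent_space_sub_def mem_Collect_eq using level \<gamma>0 by (intro exI[of _ \<gamma>]) simp
qed

text \<open>Where the Hamiltonian vector field does not vanish, this is the tangent space of the energy level.\<close>

abbreviation level_tangent :: "'a \<Rightarrow> ('a, real ^ 'n) tvec set" where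
  "level_tangent p \<equiv> {Y \<in> tangent_space A p. diff_fun A H p Y = 0}"

lemma level_tangent_basis:
  assumes dim: "CARD('n) = 4" and nz: "ham p \<noteq> 0"
  obtains e f where "plane_quotient (level_tangent p) e f (ham p)"
proof -
  define \<kappa> where "\<kappa> = chart_at A p"
  have \<kappa>: "\<kappa> \<in> A" "p \<in> chart_dom \<kappa>" unfolding \<kappa>_def by (rule chart_at)+
  obtain D where D: "fun_deriv H p \<kappa> D" using smooth_function_fun_deriv[OF smooth_H \<kappa>] by blast
  have lin: "linear D" using D has_derivative_linear by (auto simp: fun_deriv_def)
  define x where "x = ham p \<kappa>"
  have x: "tangent_of A \<kappa> p x = ham p" unfolding x_def by (rule tangent_of_coordinate[OF \<kappa> ham_tangent])
  obtain w where w: "D w \<noteq> 0" using dH_nonzero[OF nz D] by blast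
  have Dx: "D x = 0"
    using diff_fun_eq[OF D ham_tangent] diff_H_ham[OF ham_tangent] form_self[OF ham_tangent] by (simp add: x_def)
  have "x \<noteq> 0"
  proof
    assume "x = 0"
    then have "ham p = tangent_of A \<kappa> p (0 *\<^sub>R 0 + 0 *\<^sub>R 0)" using x by simp
    then show False using nz tangent_of_comb[OF \<kappa>, of 0 0 0 0] by simp
  qed
  then obtain e f where ef: "D e = 0" "D f = 0" "\<And>u. D u = 0 \<Longrightarrow> \<exists>a b n. u = a *\<^sub>R e + b *\<^sub>R f + n *\<^sub>R x"
    and ind: "\<And>a b n. a *\<^sub>R e + b *\<^sub>R f + n *\<^sub>R x = 0 \<Longrightarrow> a = 0 \<and> b = 0 \<and> n = 0"
    using kernel_basis[OF _ lin w Dx] dim by (metis DIM_cart DIM_real mult.right_neutral)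
  let ?T = "tangent_of A \<kappa> p"
  have comb: "?T (a *\<^sub>R e + b *\<^sub>R f + n *\<^sub>R x) = a *\<^sub>R ?T e + b *\<^sub>R ?T f + n *\<^sub>R ham p" for a b n
    using tangent_of_comb[OF \<kappa>, of 1 "a *\<^sub>R e + b *\<^sub>R f" n x] tangent_of_comb[OF \<kappa>, of a e b f] x by simp
  have "plane_quotient (level_tangent p) (?T e) (?T f) (ham p)"
  proof
    show "level_tangent p = {a *\<^sub>R ?T e + b *\<^sub>R ?T f + n *\<^sub>R ham p | a b n. True}"
    proof (intro equalityI subsetI)
      fix Y assume "Y \<in> level_tangent p"
      then have Y: "Y \<in> tangent_space A p" "D (Y \<kappa>) = 0" using diff_fun_eq[OF D] by auto
      obtain a b n where "Y \<kappa> = a *\<^sub>R e + b *\<^sub>R f + n *\<^sub>R x" using ef(3)[OF Y(2)] by blast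
      then have "Y = a *\<^sub>R ?T e + b *\<^sub>R ?T f + n *\<^sub>R ham p"
        using comb tangent_of_coordinate[OF \<kappa> Y(1)] by simp
      then show "Y \<in> {a *\<^sub>R ?T e + b *\<^sub>R ?T f + n *\<^sub>R ham p | a b n. True}" by blast
    next
      fix Y assume "Y \<in> {a *\<^sub>R ?T e + b *\<^sub>R ?T f + n *\<^sub>R ham p | a b n. True}"
      then obtain a b n where "Y = a *\<^sub>R ?T e + b *\<^sub>R ?T f + n *\<^sub>R ham p" by blast
      then have Y: "Y = ?T (a *\<^sub>R e + b *\<^sub>R f + n *\<^sub>R x)" by (simp only: comb)
      have T: "Y \<in> tangent_space A p" unfolding Y by (rule tangent_of_in[OF \<kappa>])
      have "D (Y \<kappa>) = 0" unfolding Y using lin ef Dx \<kappa> by (simp add: linear_add linear_scale)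
      then show "Y \<in> level_tangent p" using T diff_fun_eq[OF D T] by simp
    qed
    show "a = 0 \<and> b = 0 \<and> n = 0" if "a *\<^sub>R ?T e + b *\<^sub>R ?T f + n *\<^sub>R ham p = 0" for a b n
    proof (rule ind)
      have "?T (a *\<^sub>R e + b *\<^sub>R f + n *\<^sub>R x) \<kappa> = 0" using that comb by simp
      then show "a *\<^sub>R e + b *\<^sub>R f + n *\<^sub>R x = 0" using \<kappa> by simp
    qed
  qed
  then show thesis by (rule that)
qed

end

section \<open>Doubly symmetric orbits\<close>

context hamiltonian_system
begin

text \<open>Let \<open>f\<close> be near \<open>p\<close> an involution that preserves \<open>H\<close> and reverses an orbit through its fixed point
  \<open>p\<close>. Then its differential acts on the level tangent space as an involution, and takes the
  Hamiltonian vector to its negative.\<close>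

lemma reversing_involution_differential:
  assumes f: "map_deriv f p \<kappa> \<kappa>' D" "f p = p"
    and inv: "\<forall>\<^sub>F x in nhds p. f (f x) = x" and H: "\<forall>\<^sub>F x in nhds p. H (f x) = H x"
    and v: "has_velocity A v 0 (\<tau> *\<^sub>R ham p)" "v 0 = p" "\<tau> > 0" "\<And>s. f (v s) = v (- s)"
  defines "L \<equiv> diff_map A f p"
  shows "Y \<in> level_tangent p \<Longrightarrow> L Y \<in> level_tangent p"
    and "Y \<in> level_tangent p \<Longrightarrow> Z \<in> level_tangent p \<Longrightarrow> L (a *\<^sub>R Y + b *\<^sub>R Z) = a *\<^sub>R L Y + b *\<^sub>R L Z"
    and "L (ham p) = - ham p"
    and "Y \<in> level_tangent p \<Longrightarrow> L (L Y) = Y"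
proof -
  have f': "map_deriv f (f p) \<kappa> \<kappa>' D" using f by simp
  have fd: "fun_deriv H (f p) (chart_at A (f p)) (frechet_derivative (H \<circ> chart_inv (chart_at A (f p)))
      (at (coords (chart_at A (f p)) (f p))))"
    by (rule fun_deriv_H[OF chart_at])
  show "L Y \<in> level_tangent p" if Y: "Y \<in> level_tangent p"
  proof -
    have T: "Y \<in> tangent_space A p" using Y by simp
    have "diff_fun A H p (L Y) = diff_fun A (H \<circ> f) p Y"
      using diff_fun_comp[OF f(1) fd T] f(2) by (simp add: L_def)
    also have "\<dots> = diff_fun A H p Y"
      using H by (intro diff_fun_cong[OF fun_deriv_H[OF chart_at] _ T]) simp
    finally show ?thesis using Y diff_map_in[OF f(1) T] f(2) by (simp add: L_def)
  qed
  show "L (a *\<^sub>R Y + b *\<^sub>R Z) = a *\<^sub>R L Y + b *\<^sub>R L Z" if "Y \<in> level_tangent p" "Z \<in> level_tangent p"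
    unfolding L_def using that by (intro diff_map_comb[OF f(1)]) simp_all
  have fv: "map_deriv f (v 0) \<kappa> \<kappa>' D" using f(1) v(2) by simp
  have vel: "has_velocity A (f \<circ> v) 0 (L (\<tau> *\<^sub>R ham p))"
    using velocity_diff_map[OF v(1) fv] v(2) by (simp add: L_def)
  have "f \<circ> v = (\<lambda>s. v (- 1 * s + 0))" using v(4) by auto
  moreover have "has_velocity A (\<lambda>s. v (- 1 * s + 0)) 0 (- 1 *\<^sub>R (\<tau> *\<^sub>R ham p))"
    using v(1) by (intro velocity_affine_reparam) simp
  ultimately have "L (\<tau> *\<^sub>R ham p) = - 1 *\<^sub>R (\<tau> *\<^sub>R ham p)"
    using velocity_unique[OF vel] by metis
  moreover have "L (\<tau> *\<^sub>R ham p) = \<tau> *\<^sub>R L (ham p)"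
    using diff_map_comb[OF f(1) ham_tangent ham_tangent, of \<tau> 0] by (simp add: L_def)
  ultimately have "\<tau> *\<^sub>R L (ham p) = \<tau> *\<^sub>R (- ham p)" by simp
  then show "L (ham p) = - ham p" by (rule scaleR_left_imp_eq[rotated]) (use v(3) in simp)
  show "L (L Y) = Y" if Y: "Y \<in> level_tangent p"
  proof -
    have T: "Y \<in> tangent_space A p" using Y by simp
    have "L (L Y) = diff_map A (f \<circ> f) p Y"
      using diff_map_comp[OF f(1) f' T] f(2) by (simp add: L_def)
    also have "\<dots> = diff_map A id p Y"
      using inv by (intro diff_map_cong[OF map_deriv_id[OF chart_at] _ T]) simp
    also have "\<dots> = Y" by (rule diff_map_id[OF T])
    finally show ?thesis .
  qed
qed

lemma period_integral_curve:
  assumes "is_period A ham v \<tau>"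
  shows "integral_curve (\<lambda>s. v (1 / \<tau> * s + 0)) UNIV"
  unfolding integral_curve_def
proof
  fix s :: real
  have \<tau>: "\<tau> > 0" "has_velocity A v (1 / \<tau> * s + 0) (\<tau> *\<^sub>R ham (v (1 / \<tau> * s + 0)))"
    using assms unfolding is_period_def by blast+
  from velocity_affine_reparam[OF \<tau>(2)] \<tau>(1)
  show "has_velocity A (\<lambda>s. v (1 / \<tau> * s + 0)) s (ham (v (1 / \<tau> * s + 0)))" by simp
qed

text \<open>Otherwise the constant curve would be a second integral curve through \<open>v 0\<close>.\<close>

lemma orbit_ham_nonzero:
  assumes "simple_periodic_orbit A ham v"
  shows "ham (v 0) \<noteq> 0"
proof
  assume z: "ham (v 0) = 0"
  obtain \<tau> where per: "is_period A ham v \<tau>" and inj: "\<And>s t. v s = v t \<longleftrightarrow> s - t \<in> \<int>"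
    using assms unfolding simple_periodic_orbit_def by blast
  have \<tau>: "\<tau> > 0" using per by (simp add: is_period_def)
  have curve: "integral_curve (\<lambda>s. v (1 / \<tau> * s + 0)) UNIV"
    by (rule period_integral_curve[OF per])
  have "has_velocity A (\<lambda>_. v 0) s 0" for s :: real
    by (rule velocity_chartI[where \<kappa> = "chart_at A (v 0)"])
       (simp_all add: subspace_0[OF subspace_tangent_space] o_def chart_at)
  then have const: "integral_curve (\<lambda>_. v 0) UNIV"
    by (simp add: integral_curve_def z)
  have "v (1 / \<tau> * (\<tau> / 2) + 0) = v 0"
    using integral_curve_unique[OF curve const, of 0 "\<tau> / 2"] by simp
  then have "(1 / 2 :: real) \<in> \<int>" using inj[of "1 / 2" 0] \<tau> by simp
  then show False by (auto elim!: Ints_cases)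
qed

theorem doubly_symmetric_not_negative_hyperbolic:
  assumes dim: "CARD('n) = 4"
    and \<rho>1: "antisymplectic_involution A \<omega> \<rho>1" "H \<circ> \<rho>1 = H"
    and \<rho>2: "antisymplectic_involution A \<omega> \<rho>2" "H \<circ> \<rho>2 = H"
    and comm: "\<rho>1 \<circ> \<rho>2 = \<rho>2 \<circ> \<rho>1"
    and orbit: "simple_periodic_orbit A ham v" and sym: "doubly_symmetric_orbit \<rho>1 \<rho>2 v"
  shows "\<not> negative_hyperbolic A \<omega> H v"
proof -
  define p where "p = v 0"
  obtain \<tau> where per: "is_period A ham v \<tau>"
    using orbit unfolding simple_periodic_orbit_def by blast
  have \<tau>: "\<tau> > 0" "\<And>t. has_velocity A v t (\<tau> *\<^sub>R ham (v t))"
    using per by (simp_all add: is_period_def)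
  have nz: "ham p \<noteq> 0" unfolding p_def by (rule orbit_ham_nonzero[OF orbit])
  have "orbit_period A ham v = \<tau>"
    unfolding orbit_period_def
  proof (rule the_equality)
    show "is_period A ham v \<tau>" by (rule per)
    fix \<sigma> assume "is_period A ham v \<sigma>"
    then have "has_velocity A v 0 (\<sigma> *\<^sub>R ham p)" by (simp add: is_period_def p_def)
    then have "\<sigma> *\<^sub>R ham p = \<tau> *\<^sub>R ham p"
      by (rule velocity_unique) (use \<tau>(2)[of 0] in \<open>simp add: p_def\<close>)
    then show "\<sigma> = \<tau>" using nz by simp
  qed
  have curve: "integral_curve (\<lambda>s. v (1 / \<tau> * s + 0)) UNIV"
    by (rule period_integral_curve[OF per])
  have vtraj: "traj (v s) (t * \<tau> - s * \<tau>) (v t)" for s t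
    using trajI[OF _ _ _ _ curve, of "s * \<tau>" "t * \<tau>"] \<tau>(1) by simp
  have reg: "regular t p" for t
    using regular_along_curve[OF curve] by (simp add: p_def)
  have sym1: "\<rho>1 (v s) = v (- s)" for s
    using sym unfolding doubly_symmetric_orbit_def symmetric_orbit_def by (metis minus_minus)
  have sym2: "\<rho>2 (v s) = v (1 / 2 - s)" for s
  proof (rule traj_unique)
    have "traj (\<rho>2 (v 0)) (- (s * \<tau> - 0 * \<tau>)) (\<rho>2 (v s))" by (rule traj_involution[OF \<rho>2 vtraj])
    then show "traj (v (1 / 2)) (- (s * \<tau>)) (\<rho>2 (v s))"
      using sym by (simp add: doubly_symmetric_orbit_def)
    show "traj (v (1 / 2)) (- (s * \<tau>)) (v (1 / 2 - s))"
      using vtraj[of "1 / 2" "1 / 2 - s"] by (simp add: algebra_simps)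
  qed
  have invol: "\<rho>1 (\<rho>1 x) = x" "\<rho>2 (\<rho>2 x) = x" "\<rho>1 (\<rho>2 x) = \<rho>2 (\<rho>1 x)" for x
    using \<rho>1(1) \<rho>2(1) comm by (auto simp: antisymplectic_involution_def fun_eq_iff)
  have H\<rho>: "H (\<rho>1 x) = H x" "H (\<rho>2 x) = H x" for x
    using \<rho>1(2) \<rho>2(2) by (auto simp: fun_eq_iff)
  define h where "h = \<tau> / 2"
  define \<phi> where "\<phi> = flow A ham h"
  \<comment> \<open>The half-period flow followed by \<open>\<rho>2\<close> maps the symmetric point \<open>p\<close> to itself.\<close>
  define S where "S x = \<rho>2 (\<phi> x)" for x
  have \<phi>: "\<forall>\<^sub>F x in nhds p. traj x h (\<phi> x)"
    using reg[of h] by (simp add: regular_def \<phi>_def)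
  have \<phi>v: "\<phi> (v s) = v (s + 1 / 2)" for s
    unfolding \<phi>_def by (rule flow_traj) (use vtraj[of s "s + 1 / 2"] in \<open>simp add: h_def algebra_simps\<close>)
  have Sv: "S (v s) = v (- s)" for s by (simp add: S_def \<phi>v sym2)
  have vp: "v 0 = p" by (simp add: p_def)
  have Rp: "\<rho>1 p = p" and Sp: "S p = p" using sym1[of 0] Sv[of 0] by (simp_all add: p_def)
  obtain D1 where D1: "map_deriv \<rho>1 p (chart_at A p) (chart_at A (\<rho>1 p)) D1"
    using involution_map_deriv[OF \<rho>1(1)] by blast
  obtain \<kappa> \<kappa>' E where E: "map_deriv \<phi> p \<kappa> \<kappa>' E" using reg[of h] by (auto simp: regular_def \<phi>_def)
  obtain D2 where D2: "map_deriv \<rho>2 (\<phi> p) (chart_at A (\<phi> p)) (chart_at A (\<rho>2 (\<phi> p))) D2"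
    using involution_map_deriv[OF \<rho>2(1)] by blast
  have "S = \<rho>2 \<circ> \<phi>" by (simp add: S_def fun_eq_iff)
  then obtain \<kappa>2 \<kappa>3 D where DS: "map_deriv S p \<kappa>2 \<kappa>3 D"
    using map_deriv_comp_obtain[OF E D2] by metis
  \<comment> \<open>\<open>\<rho>2\<close> reverses the orbit segment from \<open>x\<close> to \<open>\<phi> x\<close>, so it leads from \<open>S x\<close> to \<open>\<rho>2 x\<close>.\<close>
  have S_inv: "S (S x) = x" if "traj x h (\<phi> x)" for x
  proof -
    have "traj (S x) h (\<rho>2 x)"
      using traj_reverse[OF traj_involution[OF \<rho>2 that]] by (simp add: S_def)
    then have "\<phi> (S x) = \<rho>2 x" unfolding \<phi>_def by (rule flow_traj)
    then show ?thesis by (simp add: S_def invol)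
  qed
  have H_S: "H (S x) = H x" if "traj x h (\<phi> x)" for x
    using traj_conserves_H[OF that] by (simp add: S_def H\<rho>)
  \<comment> \<open>\<open>\<rho>1 \<circ> \<rho>2\<close> commutes with the flow and is an involution. It takes the second half of the orbit
    segment, which starts at \<open>\<phi> x\<close>, to a segment of the same duration that starts at \<open>\<rho>1 (S x)\<close>.\<close>
  have flow_split: "flow A ham \<tau> x = \<rho>1 (S (\<rho>1 (S x)))"
    if x: "traj x h (\<phi> x)" "traj x \<tau> (flow A ham \<tau> x)" for x
  proof -
    define z where "z = flow A ham \<tau> x"
    have "traj (\<phi> x) (- h + \<tau>) z" using traj_trans[OF traj_reverse[OF x(1)] x(2)] by (simp add: z_def)
    then have "traj (\<phi> x) h z" by (simp add: h_def)
    from traj_involution[OF \<rho>1 traj_involution[OF \<rho>2 this]]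
    have "traj (\<rho>1 (S x)) h (\<rho>1 (\<rho>2 z))" by (simp add: S_def)
    then have "\<phi> (\<rho>1 (S x)) = \<rho>1 (\<rho>2 z)" unfolding \<phi>_def by (rule flow_traj)
    then have "\<rho>1 (S (\<rho>1 (S x))) = z" by (simp add: S_def invol)
    then show ?thesis by (simp add: z_def)
  qed
  have vel: "has_velocity A v 0 (\<tau> *\<^sub>R ham p)" using \<tau>(2)[of 0] by (simp add: p_def)
  have ev1: "\<forall>\<^sub>F x in nhds p. \<rho>1 (\<rho>1 x) = x" "\<forall>\<^sub>F x in nhds p. H (\<rho>1 x) = H x"
    by (simp_all add: invol H\<rho>)
  have evS: "\<forall>\<^sub>F x in nhds p. S (S x) = x" "\<forall>\<^sub>F x in nhds p. H (S x) = H x"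
    using \<phi> by (auto elim!: eventually_mono simp: S_inv H_S)
  define LR where "LR = diff_map A \<rho>1 p"
  define LS where "LS = diff_map A S p"
  note R = reversing_involution_differential[OF D1 Rp ev1 vel vp \<tau>(1) sym1, folded LR_def]
  note S = reversing_involution_differential[OF DS Sp evS vel vp \<tau>(1) Sv, folded LS_def]
  have mono: "diff_map A (flow A ham \<tau>) p Y = LR (LS (LR (LS Y)))" if Y: "Y \<in> tangent_space A p" for Y
  proof -
    have R1: "map_deriv \<rho>1 (S p) (chart_at A p) (chart_at A (\<rho>1 p)) D1" using D1 Sp by simp
    obtain \<mu> \<mu>' D' where RS: "map_deriv (\<rho>1 \<circ> S) p \<mu> \<mu>' D'"
      using map_deriv_comp_obtain[OF DS R1] by blast
    have fix_p: "(\<rho>1 \<circ> S) p = p" using Sp Rp by simp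
    have RSp: "map_deriv (\<rho>1 \<circ> S) ((\<rho>1 \<circ> S) p) \<mu> \<mu>' D'" unfolding fix_p by (rule RS)
    have step: "diff_map A (\<rho>1 \<circ> S) p Z = LR (LS Z)" if "Z \<in> tangent_space A p" for Z
      using diff_map_comp[OF DS R1 that] Sp by (simp add: LR_def LS_def)
    obtain F where "map_deriv ((\<rho>1 \<circ> S) \<circ> (\<rho>1 \<circ> S)) p \<mu> \<mu>' F"
      using map_deriv_comp_obtain[OF RS RSp] by blast
    moreover have "\<forall>\<^sub>F x in nhds p. flow A ham \<tau> x = ((\<rho>1 \<circ> S) \<circ> (\<rho>1 \<circ> S)) x"
    proof -
      have "\<forall>\<^sub>F x in nhds p. traj x \<tau> (flow A ham \<tau> x)" using reg[of \<tau>] by (simp add: regular_def)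
      with \<phi> show ?thesis by eventually_elim (use flow_split in simp)
    qed
    ultimately have "diff_map A (flow A ham \<tau>) p Y = diff_map A ((\<rho>1 \<circ> S) \<circ> (\<rho>1 \<circ> S)) p Y"
      using Y by (rule diff_map_cong)
    also have "\<dots> = diff_map A (\<rho>1 \<circ> S) p (diff_map A (\<rho>1 \<circ> S) p Y)"
      using diff_map_comp[OF RS RSp Y] unfolding fix_p .
    also have "\<dots> = LR (LS (LR (LS Y)))"
      using step[OF Y] step[OF diff_map_in[OF RS Y, unfolded fix_p]] by simp
    finally show ?thesis .
  qed
  obtain e f where "plane_quotient (level_tangent p) e f (ham p)"
    using level_tangent_basis[OF dim nz] by blast
  then interpret plane_quotient "level_tangent p" e f "ham p" .
  have T: "reduced_monodromy A ham v C = LR ` LS ` LR ` LS ` C" if "C \<subseteq> level_tangent p" for C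
    unfolding reduced_monodromy_def \<open>orbit_period A ham v = \<tau>\<close> image_image vp
    using that mono by (intro image_cong) auto
  have "quotient_trace (level_tangent p) (span {ham p}) (reduced_monodromy A ham v) \<ge> - 2"
    by (rule quotient_trace_two_involutions[OF R S T])
  then show ?thesis
    unfolding negative_hyperbolic_def vp tangent_space_level[OF nz] by simp
qed

end

theorem theoremA:
  fixes A :: "('a::{t2_space, second_countable_topology}, real ^ 4) chart set"
    and \<omega> :: "'a \<Rightarrow> ('a, real ^ 4) tvec \<Rightarrow> ('a, real ^ 4) tvec \<Rightarrow> real"
    and \<rho>1 \<rho>2 :: "'a \<Rightarrow> 'a"
    and H :: "'a \<Rightarrow> real"
    and v :: "real \<Rightarrow> 'a"
  assumes "symplectic_manifold A \<omega>"
    and "antisymplectic_involution A \<omega> \<rho>1"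
    and "antisymplectic_involution A \<omega> \<rho>2"
    and "\<rho>1 \<noteq> \<rho>2"
    and "\<rho>1 \<circ> \<rho>2 = \<rho>2 \<circ> \<rho>1"
    and "smooth_function A H"
    and "H \<circ> \<rho>1 = H"
    and "H \<circ> \<rho>2 = H"
    and "simple_periodic_orbit A (ham_field A \<omega> H) v"
    and "doubly_symmetric_orbit \<rho>1 \<rho>2 v"
  shows "\<not> negative_hyperbolic A \<omega> H v"
proof -
  interpret hamiltonian_system A \<omega> H
    using assms(1,6) by unfold_locales (auto simp: symplectic_manifold_def)
  show ?thesis
    by (rule doubly_symmetric_not_negative_hyperbolic[OF _ assms(2,7,3,8,5,9,10)]) simp
qed

end
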